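(* Suppose $u\in C_w([0,T];L^2(\mathbb{T}^3_L))$ is a weak solution to the Euler equations and $$\varepsilon=\limsup_{q\to\infty}\lambda_q\langle|u_q|^3\rangle<\infty .$$ Then the energy flux accumulates on $A=\limsup_{q\to\infty}A_q=\bigcap_{p\ge1}\bigcup_{q>p}A_q$, where $A_q$ are the active regions of $u$.
   Context: **Setting.** $L,T>0$; $\mathbb{T}^3_L$ is the three-dimensional torus of side length $L$; $\Omega_T=[0,T]\times\mathbb{T}^3_L$, $\Omega_t=[0,t]\times\mathbb{T}^3_L$; $\langle f\rangle=\frac{1}{TL^3}\int_{\Omega_T}f\,dx\,dt$. **Littlewood-Paley decomposition.** Fix a nonnegative radial $\chi\in C_0^\infty(B(0,1))$ on $\mathbb{R}^3$ with $\chi(\xi)=1$ for $|\xi|\le 1/2$, and $\phi(\xi)=\chi(\xi/2)-\chi(\xi)$. Let $\varphi_{-1}(\xi)=\chi(L\xi)$, $\varphi_q(\xi)=\phi(L\xi/2^q)$ for $q\ge 0$. With Fourier coefficients $\mathcal F(u)(k)=L^{-3}\int_{\mathbb{T}^3_L}u(x)e^{-2\pi i k\cdot x}dx$, $k\in\frac1L\mathbb{Z}^3$, set $u_q=\sum_{k\in\frac1L\mathbb{Z}^3}\varphi_q(k)\mathcal F(u)(k)e^{2\pi i k\cdot x}$ (acting in the space variable), so $u=\sum_{q\ge-1}u_q$. Put $\lambda_q=2^q/L$, $\ell_q=L/2^q$. **Weak solutions.** The Euler equations are $\partial_tu+(u\cdot\nabla)u=-\nabla p+f$, $\nabla\cdot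 u=0$ on $\mathbb{T}^3_L$, where the force $f$ is time independent with $\mathrm{supp}\,\mathcal F(f)\subset B(0,c/L)$ for some $c>1$. $C_w([0,T];L^2)$ is the space of weakly continuous $L^2$-valued functions. $u\in C_w([0,T];L^2(\mathbb{T}^3_L))$ is a weak solution with initial data $u_0\in L^2$ if for all $\psi\in C_0^\infty([0,T]\times\mathbb{T}^3_L)$ with $\nabla_x\cdot\psi=0$ and all $0\le t\le T$ $$\int_{\mathbb{T}^3_L\times\{t\}}u\cdot\psi-\int_{\mathbb{T}^3_L\times\{0\}}u_0\cdot\psi-\int_{\Omega_t}u\cdot\partial_s\psi=\int_{\Omega_t}(u\otimes u):\nabla\psi+\int_{\Omega_t}f\cdot\psi,$$ and $\nabla_x\cdot u(t)=0$ in the sense of distributions. **Flux density and accumulation.** Here $(a\otimes b):\nabla v=\sum_{i,j}a_ib_j\partial_iv_j$. For $q\ge1$ the energy flux density is $$\pi_q=\sum_{\substack{p'\ge q-1,\ p''\ge q,\ p'''<q\\|p'-p''|<2}}(u_{p'}\otimes u_{p''}):\nabla u_{p'''} .$$ The energy flux *accumulates* on a measurable set $G\subset\Omega_T$ if there is a decreasing sequence of sets $G_q$ with $G=\bigcap_{q\ge1}G_q$ such that for all $q\in\mathbb{N}$, $\lim_{p\to\infty}\langle|\pi_p|\,\mathbf 1_{\Omega_T\setminus G_q}\rangle=0$. **Atomic decomposition.** For $q\ge 0$, $k\in[0,2^q-1]^3\cap\mathbb{Z}^3$ let $Q_{qk}=[0,\ell_q)^3+\ell_qk\subset\mathbb{T}^3_L$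 and $Q^*_{qk}=\bigcup_{|k'-k|<3}Q_{qk'}$ (indices understood periodically). Fix an integer $M>1$ and a smooth nonnegative kernel $\eta$ supported in the unit ball with $\int\eta=1$. Let $\chi_{qk}$ be the characteristic function of $Q_{qk}$, $\chi'_{qk}(x)=\frac1{L^3}\int\chi_{qk}(x-y)\eta_q(y)\,dy$ with $\eta_q(y)=2^{3q}\eta(\lambda_qy)$, $b_{qk}=u_q\chi'_{qk}$ and $$s_{qk}(t)=\max_{|\beta|\le M}\lambda_q^{-|\beta|}\|\partial_x^\beta b_{qk}(t,\cdot)\|_\infty,\qquad a_{qk}=b_{qk}/s_{qk},$$ so that $u_q=\sum_k s_{qk}a_{qk}$. **Active regions.** Fix a positive decreasing sequence of numbers $\sigma_q\to0$ with $\lim_{q\to\infty}\frac{\log\sigma_q}{q}=0$. Set $$A_q(t)=\bigcup\Big\{Q^*_{qk}:\ |s_{qk}(t)|>\sigma_q\frac{\langle|u_q|^3\rangle}{\langle|u_q|^2\rangle}\Big\},\qquad A_q=\{(t,x)\in\Omega_T:x\in A_q(t)\},$$ with the convention $A_q=\emptyset$ if $u_q=0$ a.e. *)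

theory Defs
  imports "HOL-Analysis.Analysis"
begin

(* Functions on the torus of side length L are the L-periodic functions on R^3.  Subsets of the
   torus, and integrals over it, are taken on the fundamental cell [0,L)^3. *)

definition cell :: "real \<Rightarrow> (real^3) set" where
  "cell L = {x. \<forall>i. 0 \<le> x $ i \<and> x $ i < L}"

definition periodic :: "real \<Rightarrow> (real^3 \<Rightarrow> 'b) \<Rightarrow> bool" where
  "periodic L g \<longleftrightarrow> (\<forall>x i. g (x + axis i L) = g x)"

definition Omega :: "real \<Rightarrow> real \<Rightarrow> (real \<times> (real^3)) set" where
  "Omega L T = {0..T} \<times> cell L"

(* The space-time mean <F> is only needed for nonnegative F.  Taking it with values in [0,\<infinity>]
   ensures that a non-integrable F has mean \<infinity>, whereas its Bochner integral would be 0. *)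
definition avg :: "real \<Rightarrow> real \<Rightarrow> (real \<times> (real^3) \<Rightarrow> real) \<Rightarrow> ennreal" where
  "avg L T F = (\<integral>\<^sup>+z\<in>Omega L T. ennreal (F z) \<partial>lebesgue) / ennreal (T * L ^ 3)"


section \<open>Partial derivatives and smoothness\<close>

definition pdiff ::
    "'a::real_normed_vector \<Rightarrow> ('a \<Rightarrow> 'b::real_normed_vector) \<Rightarrow> 'a \<Rightarrow> 'b" where
  "pdiff v f x = frechet_derivative f (at x) v"

(* All iterated partial derivatives exist and are differentiable, i.e. f is of class C^infinity. *)
definition smooth :: "('a::euclidean_space \<Rightarrow> 'b::real_normed_vector) \<Rightarrow> bool" where
  "smooth f \<longleftrightarrow> (\<forall>vs. set vs \<subseteq> Basis \<longrightarrow> (\<forall>x. foldr pdiff vs f differentiable (at x)))"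

definition mdiff ::
    "nat^3 \<Rightarrow> (real^3 \<Rightarrow> 'b::real_normed_vector) \<Rightarrow> real^3 \<Rightarrow> 'b" where
  "mdiff \<beta> f = (pdiff (axis 1 1) ^^ (\<beta> $ 1)) ((pdiff (axis 2 1) ^^ (\<beta> $ 2))
     ((pdiff (axis 3 1) ^^ (\<beta> $ 3)) f))"

definition divergence :: "(real^3 \<Rightarrow> real^3) \<Rightarrow> real^3 \<Rightarrow> real" where
  "divergence v x = (\<Sum>i\<in>UNIV. pdiff (axis i 1) v x $ i)"

(* (a \<otimes> b) : \<nabla>v at the point x *)
definition tensor_grad :: "real^3 \<Rightarrow> real^3 \<Rightarrow> (real^3 \<Rightarrow> real^3) \<Rightarrow> real^3 \<Rightarrow> real" where
  "tensor_grad a b v x =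
     (\<Sum>i\<in>UNIV. \<Sum>j\<in>UNIV. a $ i * b $ j * pdiff (axis i 1) v x $ j)"


section \<open>Littlewood-Paley decomposition\<close>

definition lattice :: "real \<Rightarrow> (real^3) set" where
  "lattice L = {k. \<forall>i. \<exists>n::int. k $ i = of_int n / L}"

definition fourier_coeff :: "real \<Rightarrow> (real^3 \<Rightarrow> real^3) \<Rightarrow> real^3 \<Rightarrow> complex^3" where
  "fourier_coeff L g k = (\<chi> j. complex_of_real (1 / L ^ 3) *
     (LINT x:cell L|lebesgue. complex_of_real (g x $ j) * cis (- 2 * pi * (k \<bullet> x))))"

(* The Littlewood-Paley cutoff, written \<kappa> here because the usual letter chi is the vector binder. *)
definition lp_cutoff :: "(real^3 \<Rightarrow> real) \<Rightarrow> bool" where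
  "lp_cutoff \<kappa> \<longleftrightarrow> smooth \<kappa> \<and> closure {\<xi>. \<kappa> \<xi> \<noteq> 0} \<subseteq> ball 0 1
     \<and> (\<forall>\<xi>. 0 \<le> \<kappa> \<xi>)
     \<and> (\<forall>\<xi> \<zeta>. norm \<xi> = norm \<zeta> \<longrightarrow> \<kappa> \<xi> = \<kappa> \<zeta>)
     \<and> (\<forall>\<xi>. norm \<xi> \<le> 1/2 \<longrightarrow> \<kappa> \<xi> = 1)"

(* Only indices q \<ge> -1 are used. *)
definition lp_symbol :: "real \<Rightarrow> (real^3 \<Rightarrow> real) \<Rightarrow> int \<Rightarrow> real^3 \<Rightarrow> real" where
  "lp_symbol L \<kappa> q \<xi> =
     (if q = -1 then \<kappa> (L *\<^sub>R \<xi>)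
      else (let \<zeta> = (L / 2 powi q) *\<^sub>R \<xi> in \<kappa> ((1/2) *\<^sub>R \<zeta>) - \<kappa> \<zeta>))"

(* The Fourier sum has finitely many nonzero terms, and it is real because g is real-valued and the
   symbol is even; Re only adjusts the type. *)
definition lp :: "real \<Rightarrow> (real^3 \<Rightarrow> real) \<Rightarrow> int \<Rightarrow> (real^3 \<Rightarrow> real^3) \<Rightarrow> real^3 \<Rightarrow> real^3" where
  "lp L \<kappa> q g x = (\<chi> j. Re (\<Sum>\<^sub>\<infinity>k\<in>lattice L.
     complex_of_real (lp_symbol L \<kappa> q k) * fourier_coeff L g k $ j * cis (2 * pi * (k \<bullet> x))))"

definition lam :: "real \<Rightarrow> nat \<Rightarrow> real" where
  "lam L q = 2 ^ q / L"

definition ell :: "real \<Rightarrow> nat \<Rightarrow> real" where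
  "ell L q = L / 2 ^ q"


section \<open>Weak solutions of the Euler equations\<close>

definition torus_L2 :: "real \<Rightarrow> (real^3 \<Rightarrow> real^3) set" where
  "torus_L2 L = {g. periodic L g \<and> g \<in> borel_measurable lebesgue
     \<and> set_integrable lebesgue (cell L) (\<lambda>x. (norm (g x))\<^sup>2)}"

definition weakly_continuous_L2 :: "real \<Rightarrow> real \<Rightarrow> (real \<Rightarrow> real^3 \<Rightarrow> real^3) \<Rightarrow> bool" where
  "weakly_continuous_L2 L T u \<longleftrightarrow> (\<forall>t\<in>{0..T}. u t \<in> torus_L2 L)
     \<and> (\<forall>g\<in>torus_L2 L. continuous_on {0..T} (\<lambda>t. LINT x:cell L|lebesgue. u t x \<bullet> g x))"

definition admissible_force :: "real \<Rightarrow> (real^3 \<Rightarrow> real^3) \<Rightarrow> bool" where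
  "admissible_force L f \<longleftrightarrow> f \<in> torus_L2 L
     \<and> (\<exists>c>1. {k \<in> lattice L. fourier_coeff L f k \<noteq> 0} \<subseteq> ball 0 (c / L))"

(* Smooth functions on the closed set [0,T] x torus are the restrictions of smooth functions on
   R x torus; compact support is automatic there. *)
definition test_field :: "real \<Rightarrow> real \<Rightarrow> (real \<Rightarrow> real^3 \<Rightarrow> real^3) \<Rightarrow> bool" where
  "test_field L T \<psi> \<longleftrightarrow> smooth (\<lambda>(t, x). \<psi> t x) \<and> (\<forall>t. periodic L (\<psi> t))
     \<and> (\<forall>t\<in>{0..T}. \<forall>x. divergence (\<psi> t) x = 0)"

definition weakly_div_free :: "real \<Rightarrow> (real^3 \<Rightarrow> real^3) \<Rightarrow> bool" where
  "weakly_div_free L v \<longleftrightarrow> (\<forall>\<theta> :: real^3 \<Rightarrow> real. smooth \<theta> \<longrightarrow> periodic L \<theta> \<longrightarrow>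
     (LINT x:cell L|lebesgue. (\<Sum>i\<in>UNIV. v x $ i * pdiff (axis i 1) \<theta> x)) = 0)"

(* The integrals over [0,t] x torus are iterated ones, because u is a curve in L^2: its values at
   different times are chosen representatives, and need not be jointly measurable. *)
definition st_integral :: "real \<Rightarrow> real \<Rightarrow> (real \<Rightarrow> real^3 \<Rightarrow> real) \<Rightarrow> real" where
  "st_integral L t F = (LINT s:{0..t}|lebesgue. (LINT x:cell L|lebesgue. F s x))"

definition weak_euler_solution ::
    "real \<Rightarrow> real \<Rightarrow> (real^3 \<Rightarrow> real^3) \<Rightarrow> (real^3 \<Rightarrow> real^3) \<Rightarrow>
     (real \<Rightarrow> real^3 \<Rightarrow> real^3) \<Rightarrow> bool" where
  "weak_euler_solution L T f u0 u \<longleftrightarrow>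
     (\<forall>\<psi>. test_field L T \<psi> \<longrightarrow> (\<forall>t\<in>{0..T}.
        (LINT x:cell L|lebesgue. u t x \<bullet> \<psi> t x)
          - (LINT x:cell L|lebesgue. u0 x \<bullet> \<psi> 0 x)
          - st_integral L t (\<lambda>s x. u s x \<bullet> vector_derivative (\<lambda>r. \<psi> r x) (at s))
        = st_integral L t (\<lambda>s x. tensor_grad (u s x) (u s x) (\<psi> s) x)
          + st_integral L t (\<lambda>s x. f x \<bullet> \<psi> s x)))
     \<and> (\<forall>t\<in>{0..T}. weakly_div_free L (u t))"


section \<open>Energy flux density and accumulation\<close>

(* For u(t) in L^2 the series converges absolutely at almost every x. *)
definition flux ::
    "real \<Rightarrow> (real^3 \<Rightarrow> real) \<Rightarrow> (real \<Rightarrow> real^3 \<Rightarrow> real^3) \<Rightarrow> nat \<Rightarrow> real \<times> (real^3) \<Rightarrow> real" where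
  "flux L \<kappa> u q = (\<lambda>(t, x).
     \<Sum>\<^sub>\<infinity>(p1, p2, p3)\<in>{(p1, p2, p3). p1 \<ge> int q - 1 \<and> p2 \<ge> int q \<and> -1 \<le> p3 \<and> p3 < int q
                              \<and> \<bar>p1 - p2\<bar> < 2}.
       tensor_grad (lp L \<kappa> p1 (u t) x) (lp L \<kappa> p2 (u t) x) (lp L \<kappa> p3 (u t)) x)"

definition flux_accumulates_on ::
    "real \<Rightarrow> real \<Rightarrow> (real^3 \<Rightarrow> real) \<Rightarrow> (real \<Rightarrow> real^3 \<Rightarrow> real^3) \<Rightarrow>
     (real \<times> (real^3)) set \<Rightarrow> bool" where
  "flux_accumulates_on L T \<kappa> u G \<longleftrightarrow> G \<in> sets lebesgue \<and> G \<subseteq> Omega L T \<and>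
     (\<exists>Gs :: nat \<Rightarrow> (real \<times> (real^3)) set.
        (\<forall>q\<ge>1. Gs q \<in> sets lebesgue \<and> Gs q \<subseteq> Omega L T \<and> Gs (Suc q) \<subseteq> Gs q)
        \<and> G = (\<Inter>q\<in>{1..}. Gs q)
        \<and> (\<forall>q\<ge>1. (\<lambda>p. avg L T (\<lambda>z. \<bar>flux L \<kappa> u p z\<bar> * indicator (Omega L T - Gs q) z))
                    \<longlonglongrightarrow> 0))"


section \<open>Atomic decomposition and active regions\<close>

definition cube_index :: "nat \<Rightarrow> (int^3) set" where
  "cube_index q = {k. \<forall>i. 0 \<le> k $ i \<and> k $ i < 2 ^ q}"

definition cube :: "real \<Rightarrow> nat \<Rightarrow> int^3 \<Rightarrow> (real^3) set" where
  "cube L q k =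
     {x. \<forall>i. ell L q * of_int (k $ i) \<le> x $ i \<and> x $ i < ell L q * (of_int (k $ i) + 1)}"

(* Indices are understood modulo 2^q: m ranges over the possible periodic shifts. *)
definition cube_star :: "real \<Rightarrow> nat \<Rightarrow> int^3 \<Rightarrow> (real^3) set" where
  "cube_star L q k = (\<Union>k'\<in>{k'\<in>cube_index q. \<exists>m :: int^3.
     norm ((\<chi> i. real_of_int (k' $ i - k $ i + 2 ^ q * m $ i)) :: real^3) < 3}. cube L q k')"

(* The characteristic function of a cube as a function on the torus, i.e. extended periodically. *)
definition cube_char :: "real \<Rightarrow> nat \<Rightarrow> int^3 \<Rightarrow> real^3 \<Rightarrow> real" where
  "cube_char L q k = indicator {x. \<exists>m :: int^3. x + (\<chi> i. L * of_int (m $ i)) \<in> cube L q k}"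

definition mollifier :: "(real^3 \<Rightarrow> real) \<Rightarrow> bool" where
  "mollifier \<eta> \<longleftrightarrow> smooth \<eta> \<and> (\<forall>y. 0 \<le> \<eta> y) \<and> closure {y. \<eta> y \<noteq> 0} \<subseteq> cball 0 1
     \<and> (LINT y|lebesgue. \<eta> y) = 1"

definition cube_cutoff ::
    "real \<Rightarrow> (real^3 \<Rightarrow> real) \<Rightarrow> nat \<Rightarrow> int^3 \<Rightarrow> real^3 \<Rightarrow> real" where
  "cube_cutoff L \<eta> q k x =
     1 / L ^ 3 * (LINT y|lebesgue. cube_char L q k (x - y) * (2 ^ (3 * q) * \<eta> (lam L q *\<^sub>R y)))"

definition piece ::
    "real \<Rightarrow> (real^3 \<Rightarrow> real) \<Rightarrow> (real^3 \<Rightarrow> real) \<Rightarrow> (real \<Rightarrow> real^3 \<Rightarrow> real^3) \<Rightarrow>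
     nat \<Rightarrow> int^3 \<Rightarrow> real \<Rightarrow> real^3 \<Rightarrow> real^3" where
  "piece L \<kappa> \<eta> u q k t x = cube_cutoff L \<eta> q k x *\<^sub>R lp L \<kappa> (int q) (u t) x"

definition atom_coeff ::
    "real \<Rightarrow> (real^3 \<Rightarrow> real) \<Rightarrow> (real^3 \<Rightarrow> real) \<Rightarrow> nat \<Rightarrow> (real \<Rightarrow> real^3 \<Rightarrow> real^3) \<Rightarrow>
     nat \<Rightarrow> int^3 \<Rightarrow> real \<Rightarrow> real" where
  "atom_coeff L \<kappa> \<eta> M u q k t =
     Max ((\<lambda>\<beta>. (SUP x. norm (mdiff \<beta> (piece L \<kappa> \<eta> u q k t) x)) / lam L q ^ (\<Sum>i\<in>UNIV. \<beta> $ i))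
       ` {\<beta> :: nat^3. (\<Sum>i\<in>UNIV. \<beta> $ i) \<le> M})"

definition lp_moment ::
    "real \<Rightarrow> real \<Rightarrow> (real^3 \<Rightarrow> real) \<Rightarrow> (real \<Rightarrow> real^3 \<Rightarrow> real^3) \<Rightarrow> nat \<Rightarrow> nat \<Rightarrow> ennreal" where
  "lp_moment L T \<kappa> u q r = avg L T (\<lambda>(t, x). norm (lp L \<kappa> (int q) (u t) x) ^ r)"

definition active_region ::
    "real \<Rightarrow> real \<Rightarrow> (real^3 \<Rightarrow> real) \<Rightarrow> (real^3 \<Rightarrow> real) \<Rightarrow> nat \<Rightarrow> (nat \<Rightarrow> real) \<Rightarrow>
     (real \<Rightarrow> real^3 \<Rightarrow> real^3) \<Rightarrow> nat \<Rightarrow> (real \<times> (real^3)) set" where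
  "active_region L T \<kappa> \<eta> M \<sigma> u q =
     (if (AE (t, x) in lebesgue. (t, x) \<in> Omega L T \<longrightarrow> lp L \<kappa> (int q) (u t) x = 0) then {}
      else {(t, x) \<in> Omega L T. \<exists>k\<in>cube_index q. x \<in> cube_star L q k
        \<and> ennreal \<bar>atom_coeff L \<kappa> \<eta> M u q k t\<bar>
            > ennreal (\<sigma> q) * (lp_moment L T \<kappa> u q 3 / lp_moment L T \<kappa> u q 2)})"

end

theory Submission
  imports Defs
begin

text \<open>Write \<open>G p\<close> for the union of the active regions of index larger than \<open>p\<close>. These sets decrease to
the limsup, so the claim is that the flux density of index \<open>q\<close> tends to zero in mean on the
complement \<open>Z\<close> of \<open>G p\<close>, for each fixed \<open>p\<close>.

Fix \<open>q > p\<close> and let \<open>R\<close> be the threshold \<open>\<sigma> q * m3 / m2\<close> of the active region, where \<open>m2\<close>, \<open>m3\<close> are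
the means of the square and the cube of the length of \<open>u_q\<close>. At a point of \<open>Z\<close> only boundedly many
atoms are nonzero and all of them have coefficient at most \<open>R\<close>; hence \<open>u_q\<close> is \<open>O(R)\<close> and its gradient is
\<open>O(\<lambda>_q R)\<close> there (\<open>lp_bound_by_atoms\<close>). Splitting a cube into a factor bounded on \<open>Z\<close> and a square
integrated over all of space-time, the mean of the cube of \<open>u_q\<close> over \<open>Z\<close> is at most
\<open>C R m2 = C \<sigma> q m3\<close>. By hypothesis \<open>\<lambda>_q m3\<close> stays bounded, so this is \<open>o(1 / \<lambda>_q)\<close>. The same argument
applies to the gradient, because the mean square of the gradient is at most \<open>C \<lambda>_q^2 m2\<close> by
Parseval (\<open>bernstein_mean\<close>); the outcome is \<open>o(\<lambda>_q^2)\<close> (\<open>quiet_cubic_means\<close>).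

The flux density is dominated by products of two pieces of index at least about \<open>q\<close> and the gradient
of a piece of lower index \<open>r\<close>. Young's inequality, with a weight adapted to the gap between the
indices, turns the two estimates above into a geometric factor in that gap times a null sequence
(\<open>mean_flux_term_le\<close>). Summing over all indices gives the convolution of a summable geometric
sequence with a null sequence, which tends to zero (\<open>mean_flux_tendsto_0\<close>).

The remaining point is that the active regions are measurable. A Littlewood-Paley piece has finitely
many Fourier modes, whose coefficients are continuous in time since \<open>u\<close> is weakly continuous. An
atomic coefficient is a maximum of suprema over \<open>x\<close> of derivatives of an atom, each of them continuous
in time, so its strict superlevel sets are open (\<open>open_atom_coeff_greater\<close>). This rests on the
smoothness of the cutoffs, that is, on convolution with a mollifier.\<close>

section \<open>Functions with bounded derivatives\<close>

lemma pdiff_eqI: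
  assumes "(f has_derivative D) (at x)"
  shows "pdiff v f x = D v"
  using frechet_derivative_at[OF assms] by (simp add: pdiff_def)

lemma has_derivative_pdiff:
  assumes "f differentiable at x"
  shows "(f has_derivative (\<lambda>v. pdiff v f x)) (at x)"
  using assms by (simp add: pdiff_def[abs_def] frechet_derivative_works)

text \<open>Recursion on the order turns the Leibniz rule into an induction. Boundedness is part of the notion
because atomic coefficients are real-valued suprema, which are meaningful only for bounded functions.\<close>

primrec bounded_derivs ::
    "nat \<Rightarrow> ('a::euclidean_space \<Rightarrow> 'b::real_normed_vector) \<Rightarrow> bool" where
  "bounded_derivs 0 f \<longleftrightarrow> bounded (range f)"
| "bounded_derivs (Suc n) f \<longleftrightarrow> bounded (range f) \<and> (\<forall>x. f differentiable at x)
     \<and> (\<forall>v\<in>Basis. bounded_derivs n (pdiff v f))"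

lemma bounded_derivs_SucD: "bounded_derivs (Suc n) f \<Longrightarrow> bounded_derivs n f"
proof (induction n arbitrary: f)
  case (Suc n)
  have "bounded_derivs n (pdiff v f)" if "v \<in> Basis" for v
    using Suc.IH[of "pdiff v f"] Suc.prems that by auto
  then show ?case using Suc.prems by auto
qed auto

lemma bounded_range_add:
  fixes f g :: "'a \<Rightarrow> 'b::real_normed_vector"
  assumes "bounded (range f)" "bounded (range g)"
  shows "bounded (range (\<lambda>x. f x + g x))"
proof -
  obtain a b where "\<And>x. norm (f x) \<le> a" "\<And>x. norm (g x) \<le> b"
    using assms by (auto simp: bounded_iff)
  then have "norm (f x + g x) \<le> a + b" for x
    by (meson add_mono norm_triangle_le)
  then show ?thesis by (auto simp: bounded_iff)
qed

lemma bounded_range_scaleR: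
  fixes f :: "'a \<Rightarrow> real" and g :: "'a \<Rightarrow> 'b::real_normed_vector"
  assumes "bounded (range f)" "bounded (range g)"
  shows "bounded (range (\<lambda>x. f x *\<^sub>R g x))"
proof -
  obtain a b where "\<And>x. norm (f x) \<le> a" "\<And>x. norm (g x) \<le> b"
    using assms by (auto simp: bounded_iff)
  then have "norm (f x *\<^sub>R g x) \<le> a * b" for x
    by (simp add: mult_mono')
  then show ?thesis by (auto simp: bounded_iff)
qed

lemma pdiff_add:
  assumes "f differentiable at x" "g differentiable at x"
  shows "pdiff v (\<lambda>x. f x + g x) x = pdiff v f x + pdiff v g x"
  by (rule pdiff_eqI) (intro has_derivative_add has_derivative_pdiff assms)

lemma pdiff_scaleR:
  fixes f :: "'a::real_normed_vector \<Rightarrow> real"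
  assumes "f differentiable at x" "g differentiable at x"
  shows "pdiff v (\<lambda>x. f x *\<^sub>R g x) x = f x *\<^sub>R pdiff v g x + pdiff v f x *\<^sub>R g x"
  by (rule pdiff_eqI) (intro has_derivative_scaleR has_derivative_pdiff assms)

lemma differentiable_scaleR_fun:
  fixes f :: "'a::real_normed_vector \<Rightarrow> real"
  assumes "f differentiable at x" "g differentiable at x"
  shows "(\<lambda>x. f x *\<^sub>R g x) differentiable at x"
  using has_derivative_scaleR[OF has_derivative_pdiff[OF assms(1)] has_derivative_pdiff[OF assms(2)]]
  by (auto simp: differentiable_def)

lemma bounded_derivs_add:
  "bounded_derivs n f \<Longrightarrow> bounded_derivs n g \<Longrightarrow> bounded_derivs n (\<lambda>x. f x + g x)"
proof (induction n arbitrary: f g)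
  case (Suc n)
  have "pdiff v (\<lambda>x. f x + g x) = (\<lambda>x. pdiff v f x + pdiff v g x)" for v
    using Suc.prems by (auto simp: pdiff_add)
  then show ?case using Suc by (auto intro: bounded_range_add)
qed (auto intro: bounded_range_add)

lemma bounded_derivs_scaleR:
  fixes f :: "'a::euclidean_space \<Rightarrow> real"
  shows "bounded_derivs n f \<Longrightarrow> bounded_derivs n g \<Longrightarrow> bounded_derivs n (\<lambda>x. f x *\<^sub>R g x)"
proof (induction n arbitrary: f g)
  case (Suc n)
  have "pdiff v (\<lambda>x. f x *\<^sub>R g x) = (\<lambda>x. f x *\<^sub>R pdiff v g x + pdiff v f x *\<^sub>R g x)" for v
    using Suc.prems by (auto simp: pdiff_scaleR)
  moreover have "bounded_derivs n f" "bounded_derivs n g"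
    using Suc.prems by (auto intro: bounded_derivs_SucD simp del: bounded_derivs.simps)
  ultimately show ?case
    using Suc.prems
    by (auto intro!: Suc.IH bounded_derivs_add bounded_range_scaleR differentiable_scaleR_fun)
qed (auto intro: bounded_range_scaleR)

lemma bounded_derivs_const: "bounded_derivs n (\<lambda>x. c)"
proof (induction n arbitrary: c)
  case (Suc n)
  have "pdiff v (\<lambda>x. c) = (\<lambda>x. 0)" for v :: 'a
    by (auto intro!: pdiff_eqI derivative_eq_intros)
  then show ?case using Suc by auto
qed auto

lemma bounded_derivs_sum:
  assumes "\<And>i. i \<in> I \<Longrightarrow> bounded_derivs n (f i)"
  shows "bounded_derivs n (\<lambda>x. \<Sum>i\<in>I. f i x)"
  using assms
  by (induction I rule: infinite_finite_induct) (auto intro: bounded_derivs_add bounded_derivs_const)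

lemma bounded_derivs_trig:
  fixes a :: "'a::euclidean_space"
  shows "bounded_derivs n (\<lambda>x. cos (a \<bullet> x)) \<and> bounded_derivs n (\<lambda>x. sin (a \<bullet> x))"
proof (induction n)
  case 0
  show ?case by (auto simp: bounded_iff intro!: exI[of _ 1])
next
  case (Suc n)
  have c: "((\<lambda>x. cos (a \<bullet> x)) has_derivative (\<lambda>v. (- (a \<bullet> v)) *\<^sub>R sin (a \<bullet> x))) (at x)"
    and s: "((\<lambda>x. sin (a \<bullet> x)) has_derivative (\<lambda>v. (a \<bullet> v) *\<^sub>R cos (a \<bullet> x))) (at x)" for x
    by (auto intro!: derivative_eq_intros)
  have "pdiff v (\<lambda>x. cos (a \<bullet> x)) = (\<lambda>x. (- (a \<bullet> v)) *\<^sub>R sin (a \<bullet> x))"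
       "pdiff v (\<lambda>x. sin (a \<bullet> x)) = (\<lambda>x. (a \<bullet> v) *\<^sub>R cos (a \<bullet> x))" for v
    by (simp_all only: fun_eq_iff pdiff_eqI[OF c] pdiff_eqI[OF s] simp_thms)
  moreover have "(\<lambda>x. cos (a \<bullet> x)) differentiable at x" "(\<lambda>x. sin (a \<bullet> x)) differentiable at x" for x
    using c s unfolding differentiable_def by blast+
  moreover have "bounded (range (\<lambda>x. cos (a \<bullet> x)))" "bounded (range (\<lambda>x. sin (a \<bullet> x)))"
    by (auto simp: bounded_iff intro!: exI[of _ 1])
  ultimately show ?case
    using Suc by (simp only: bounded_derivs.simps)
      (intro conjI ballI allI TrueI bounded_derivs_scaleR bounded_derivs_const; simp)
qed

definition bounded_smooth :: "('a::euclidean_space \<Rightarrow> 'b::real_normed_vector) \<Rightarrow> bool" where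
  "bounded_smooth f \<longleftrightarrow> (\<forall>n. bounded_derivs n f)"

lemma bounded_smoothD:
  assumes "bounded_smooth f"
  shows "bounded (range f)" and "f differentiable at x"
    and "v \<in> Basis \<Longrightarrow> bounded_smooth (pdiff v f)"
  using assms bounded_derivs.simps(2)[of _ f] unfolding bounded_smooth_def by auto

lemma bounded_smooth_pdiff_power:
  assumes "bounded_smooth f" "v \<in> Basis"
  shows "bounded_smooth ((pdiff v ^^ n) f)"
  by (induction n) (auto simp: assms intro: bounded_smoothD)

lemma bounded_smooth_mdiff:
  assumes "bounded_smooth f"
  shows "bounded_smooth (mdiff \<beta> f)"
  unfolding mdiff_def by (intro bounded_smooth_pdiff_power assms) auto

lemma pdiff_sum:
  assumes "\<And>i. i \<in> I \<Longrightarrow> f i differentiable at x"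
  shows "pdiff v (\<lambda>x. \<Sum>i\<in>I. a i *\<^sub>R f i x) x = (\<Sum>i\<in>I. a i *\<^sub>R pdiff v (f i) x)"
  by (rule pdiff_eqI)
     (intro has_derivative_sum has_derivative_scaleR_right has_derivative_pdiff assms)

lemma pdiff_power_sum:
  assumes "\<And>i. i \<in> I \<Longrightarrow> bounded_smooth (f i)" "v \<in> Basis"
  shows "(pdiff v ^^ n) (\<lambda>x. \<Sum>i\<in>I. a i *\<^sub>R f i x) = (\<lambda>x. \<Sum>i\<in>I. a i *\<^sub>R (pdiff v ^^ n) (f i) x)"
  by (induction n)
     (auto simp: assms intro!: pdiff_sum bounded_smoothD bounded_smooth_pdiff_power)

lemma mdiff_sum:
  assumes "\<And>i. i \<in> I \<Longrightarrow> bounded_smooth (f i)"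
  shows "mdiff \<beta> (\<lambda>x. \<Sum>i\<in>I. a i *\<^sub>R f i x) = (\<lambda>x. \<Sum>i\<in>I. a i *\<^sub>R mdiff \<beta> (f i) x)"
  unfolding mdiff_def
  by (subst pdiff_power_sum; (intro bounded_smooth_pdiff_power assms)?; simp?)+

section \<open>Trigonometric polynomials on the torus\<close>

lemma lborel_integral_affine:
  fixes f :: "'a::euclidean_space \<Rightarrow> 'b::{banach, second_countable_topology}"
  assumes [measurable]: "f \<in> borel_measurable borel" and c: "c \<noteq> 0"
  shows "(\<integral>x. f x \<partial>lborel) = \<bar>c\<bar> ^ DIM('a) *\<^sub>R (\<integral>x. f (t + c *\<^sub>R x) \<partial>lborel)"
  by (subst lborel_affine[OF c, of t]) (simp add: integral_density integral_distr)

lemma cell_borel [measurable]: "cell L \<in> sets borel"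
proof -
  have "cell L = (\<Inter>i. {x. 0 \<le> x $ i} \<inter> {x. x $ i < L})"
    by (auto simp: cell_def)
  also have "\<dots> \<in> sets borel"
    by (intro sets.countable_INT'' sets.Int borel_closed borel_open closed_Collect_le open_Collect_less
        continuous_intros) (auto simp: countable_finite)
  finally show ?thesis .
qed

lemma bounded_cell: "bounded (cell L)"
proof (rule bounded_subset[OF bounded_cbox])
  show "cell L \<subseteq> cbox 0 (\<chi> i. L)"
    by (auto simp: cell_def mem_box_cart) (meson less_imp_le)
qed

lemma emeasure_cell_finite: "emeasure lborel (cell L) < \<infinity>"
  by (rule emeasure_bounded_finite[OF bounded_cell])

lemma set_integrable_cell:
  fixes f :: "real^3 \<Rightarrow> 'b::{banach, second_countable_topology}"
  assumes "continuous_on UNIV f"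
  shows "set_integrable lborel (cell L) f"
proof -
  have "set_integrable lborel (cbox 0 (\<chi> i. L)) f"
    using assms by (intro borel_integrable_compact[folded set_integrable_def] continuous_on_subset[OF assms]) auto
  then show ?thesis
    by (rule set_integrable_subset)
       (use cell_borel in \<open>auto simp: cell_def mem_box_cart less_eq_real_def\<close>)
qed

text \<open>Sliding the cell by half a period in a direction in which the character oscillates changes the sign of
the integral, and by periodicity it changes nothing.\<close>

lemma integral_character_eq_0:
  assumes L: "L > 0" and k: "k \<in> lattice L" "k \<noteq> 0"
  shows "(LINT x:cell L|lborel. cis (2 * pi * (k \<bullet> x))) = 0"
proof -
  obtain i where ki: "k $ i \<noteq> 0"
    using k(2) by (auto simp: vec_eq_iff)
  obtain n :: int where n: "k $ i = n / L"
    using k(1) by (auto simp: lattice_def)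
  have n0: "n \<noteq> 0" using ki n by auto
  define e where "e x = cis (2 * pi * (k \<bullet> x))" for x
  define h where "h = L / (2 * \<bar>real_of_int n\<bar>)"
  have h: "0 < h" "h < L"
  proof -
    have "1 \<le> \<bar>real_of_int n\<bar>" using n0 by linarith
    then show "0 < h" "h < L" using L by (auto simp: h_def field_simps)
  qed
  define a where "a = axis i h"
  define b where "b = axis i L"
  have ea: "e (a + x) = - e x" for x
  proof -
    have "k \<bullet> a = sgn (real_of_int n) / 2"
      using n0 L by (auto simp: a_def inner_axis n h_def sgn_if field_simps)
    then have "k \<bullet> a = 1 / 2 \<or> k \<bullet> a = - (1 / 2)"
      using n0 by (auto simp: sgn_if)
    then have "cis (2 * pi * (k \<bullet> a)) = -1"
      by (elim disjE; simp only:; simp add: complex_eq_iff)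
    then show ?thesis
      by (simp add: e_def inner_add_right ring_distribs flip: cis_mult)
  qed
  have eb: "e (b + x) = e x" for x
  proof -
    have "k \<bullet> b = n" using L by (simp add: b_def inner_axis n)
    then have "cis (2 * pi * (k \<bullet> b)) = 1"
      by (simp add: cis_multiple_2pi)
    then show ?thesis
      by (simp add: e_def inner_add_right ring_distribs flip: cis_mult)
  qed
  have [measurable]: "e \<in> borel_measurable borel"
    unfolding e_def by (intro borel_measurable_continuous_onI continuous_intros)
  have ce: "continuous_on UNIV e" unfolding e_def by (intro continuous_intros)
  \<comment> \<open>The slid cell consists of the part \<open>A\<close> that stays inside and, after one full period, the part \<open>B\<close>
      that has left.\<close>
  define A where "A = {x \<in> cell L. x $ i < L - h}"
  define B where "B = {x \<in> cell L. L - h \<le> x $ i}"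
  have m1: "{x::real^3. x $ i < L - h} \<in> sets borel"
    by (intro borel_open open_Collect_less continuous_intros)
  have m2: "{x::real^3. L - h \<le> x $ i} \<in> sets borel"
    by (intro borel_closed closed_Collect_le continuous_intros)
  have [measurable]: "A \<in> sets borel" "B \<in> sets borel"
    using sets.Int[OF cell_borel m1] sets.Int[OF cell_borel m2]
    by (auto simp: A_def B_def Int_def)
  have int: "integrable lborel (\<lambda>x. indicator S x *\<^sub>R e x)" if "S \<subseteq> cell L" "S \<in> sets borel" for S
    using set_integrable_subset[OF set_integrable_cell[OF ce, of L], of S] that
    by (simp add: set_integrable_def)
  have "(\<integral>x. indicator (cell L) x *\<^sub>R e x \<partial>lborel)
      = (\<integral>x. indicator (cell L) (a + x) *\<^sub>R e (a + x) \<partial>lborel)"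
    by (subst lborel_integral_affine[of _ 1 a]) auto
  also have "\<dots> = - (\<integral>x. indicator A x *\<^sub>R e x + indicator B (b + x) *\<^sub>R e (b + x) \<partial>lborel)"
    unfolding ea eb integral_minus[symmetric]
  proof (rule Bochner_Integration.integral_cong[OF refl])
    fix x
    have "indicator (cell L) (a + x) = (indicator A x + indicator B (b + x) :: real)"
    proof -
      have cell_i: "y \<in> cell L \<longleftrightarrow> (\<forall>j. j \<noteq> i \<longrightarrow> 0 \<le> y $ j \<and> y $ j < L) \<and> 0 \<le> y $ i \<and> y $ i < L" for y
        unfolding cell_def mem_Collect_eq by metis
      have 1: "a + x \<in> cell L \<longleftrightarrow> (\<forall>j. j \<noteq> i \<longrightarrow> 0 \<le> x $ j \<and> x $ j < L) \<and> 0 \<le> h + x $ i \<and> h + x $ i < L"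
        unfolding cell_i by (simp add: a_def axis_def)
      have 2: "x \<in> A \<longleftrightarrow> (\<forall>j. j \<noteq> i \<longrightarrow> 0 \<le> x $ j \<and> x $ j < L) \<and> 0 \<le> x $ i \<and> x $ i < L - h"
        using h unfolding A_def mem_Collect_eq cell_i by auto
      have 3: "b + x \<in> B \<longleftrightarrow> (\<forall>j. j \<noteq> i \<longrightarrow> 0 \<le> x $ j \<and> x $ j < L) \<and> - h \<le> x $ i \<and> x $ i < 0"
        using h L unfolding B_def mem_Collect_eq cell_i by (auto simp: b_def axis_def)
      show ?thesis
        unfolding indicator_def of_bool_def 1 2 3 using h by auto
    qed
    then show "indicator (cell L) (a + x) *\<^sub>R - e x
        = - (indicator A x *\<^sub>R e x + indicator B (b + x) *\<^sub>R e x)"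
      by (simp add: algebra_simps)
  qed
  also have "\<dots> = - ((\<integral>x. indicator A x *\<^sub>R e x \<partial>lborel) + (\<integral>x. indicator B (b + x) *\<^sub>R e (b + x) \<partial>lborel))"
  proof (subst Bochner_Integration.integral_add)
    show "integrable lborel (\<lambda>x. indicator A x *\<^sub>R e x)"
      by (rule int) (auto simp: A_def)
    have "integrable (distr lborel borel ((+) b)) (\<lambda>x. indicator B x *\<^sub>R e x)"
      unfolding lborel_distr_plus by (rule int) (auto simp: B_def)
    then show "integrable lborel (\<lambda>x. indicator B (b + x) *\<^sub>R e (b + x))"
      by (subst (asm) integrable_distr_eq) auto
  qed simp
  also have "(\<integral>x. indicator B (b + x) *\<^sub>R e (b + x) \<partial>lborel) = (\<integral>x. indicator B x *\<^sub>R e x \<partial>lborel)"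
    by (subst lborel_integral_affine[of "\<lambda>x. indicator B x *\<^sub>R e x" 1 b]) auto
  also have "(\<integral>x. indicator A x *\<^sub>R e x \<partial>lborel) + (\<integral>x. indicator B x *\<^sub>R e x \<partial>lborel)
      = (\<integral>x. indicator (cell L) x *\<^sub>R e x \<partial>lborel)"
  proof (subst Bochner_Integration.integral_add[symmetric])
    show "integrable lborel (\<lambda>x. indicator A x *\<^sub>R e x)" "integrable lborel (\<lambda>x. indicator B x *\<^sub>R e x)"
      by (rule int; auto simp: A_def B_def)+
  qed (auto intro!: Bochner_Integration.integral_cong simp: A_def B_def indicator_def)
  finally have "(\<integral>x. indicator (cell L) x *\<^sub>R e x \<partial>lborel) = 0"
    by simp
  then show ?thesis
    by (simp add: e_def set_lebesgue_integral_def)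
qed

lemma lattice_diff: "k \<in> lattice L \<Longrightarrow> l \<in> lattice L \<Longrightarrow> k - l \<in> lattice L"
proof -
  assume "k \<in> lattice L" "l \<in> lattice L"
  then obtain m n :: "3 \<Rightarrow> int" where "\<And>i. k $ i = m i / L" "\<And>i. l $ i = n i / L"
    unfolding lattice_def mem_Collect_eq by metis
  then have "(k - l) $ i = of_int (m i - n i) / L" for i
    by (simp add: diff_divide_distrib)
  then show "k - l \<in> lattice L"
    unfolding lattice_def by blast
qed

lemma lattice_minus: "k \<in> lattice L \<Longrightarrow> - k \<in> lattice L"
  using lattice_diff[of 0 L k] by (force simp: lattice_def intro: exI[of _ 0])

lemma parseval_cell:
  assumes L: "L > 0" and S: "finite S" "S \<subseteq> lattice L"
  shows "(LINT x:cell L|lborel. (cmod (\<Sum>k\<in>S. \<gamma> k * cis (2 * pi * (k \<bullet> x))))\<^sup>2)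
    = measure lborel (cell L) * (\<Sum>k\<in>S. (cmod (\<gamma> k))\<^sup>2)"
proof -
  let ?e = "\<lambda>k x. cis (2 * pi * (k \<bullet> x))"
  let ?m = "complex_of_real (measure lborel (cell L))"
  have orth: "(LINT x:cell L|lborel. ?e k x * cnj (?e l x)) = (if k = l then ?m else 0)"
    if "k \<in> S" "l \<in> S" for k l
  proof (cases "k = l")
    case True
    then show ?thesis
      by (simp add: complex_norm_square[symmetric] set_lebesgue_integral_def scaleR_conv_of_real)
  next
    case False
    have "?e k x * cnj (?e l x) = ?e (k - l) x" for x
      by (simp add: cis_cnj cis_mult inner_diff_left right_diff_distrib)
    then show ?thesis
      using False integral_character_eq_0[OF L lattice_diff[of k L l]] that S by auto
  qed
  have int: "integrable lborel (\<lambda>x. indicator (cell L) x *\<^sub>R (?e k x * cnj (?e l x)))" for k l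
  proof -
    have "continuous_on UNIV (\<lambda>x. ?e k x * cnj (?e l x))"
      by (intro continuous_intros)
    from set_integrable_cell[OF this] show ?thesis
      by (simp add: set_integrable_def)
  qed
  have "complex_of_real (LINT x:cell L|lborel. (cmod (\<Sum>k\<in>S. \<gamma> k * ?e k x))\<^sup>2)
      = (LINT x:cell L|lborel. complex_of_real ((cmod (\<Sum>k\<in>S. \<gamma> k * ?e k x))\<^sup>2))"
    unfolding set_lebesgue_integral_def scaleR_conv_of_real
    by (simp flip: integral_complex_of_real)
  also have "\<dots> = (\<integral>x. (\<Sum>k\<in>S. \<Sum>l\<in>S. (\<gamma> k * cnj (\<gamma> l)) *
      (indicator (cell L) x *\<^sub>R (?e k x * cnj (?e l x)))) \<partial>lborel)"
    unfolding set_lebesgue_integral_def complex_norm_square cnj_sum complex_cnj_mult sum_product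
      scaleR_sum_right
    by (intro Bochner_Integration.integral_cong refl sum.cong) (simp add: mult_ac)
  also have "\<dots> = (\<Sum>k\<in>S. \<Sum>l\<in>S. (\<gamma> k * cnj (\<gamma> l)) * (LINT x:cell L|lborel. ?e k x * cnj (?e l x)))"
    unfolding set_lebesgue_integral_def
    by (subst Bochner_Integration.integral_sum; (intro Bochner_Integration.integrable_sum
        integrable_mult_right int sum.cong refl)?)+ (simp only: integral_mult_right_zero)
  also have "\<dots> = (\<Sum>k\<in>S. \<Sum>l\<in>S. if k = l then (\<gamma> k * cnj (\<gamma> l)) * ?m else 0)"
    by (intro sum.cong refl) (simp add: orth)
  also have "\<dots> = ?m * (\<Sum>k\<in>S. complex_of_real ((cmod (\<gamma> k))\<^sup>2))"
    unfolding complex_norm_square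
    using S by (simp add: sum.delta' sum_distrib_left mult_ac)
  also have "\<dots> = complex_of_real (measure lborel (cell L) * (\<Sum>k\<in>S. (cmod (\<gamma> k))\<^sup>2))"
    by simp
  finally show ?thesis
    using of_real_eq_iff by blast
qed


definition trig_poly :: "(real^3) set \<Rightarrow> (real^3 \<Rightarrow> complex^3) \<Rightarrow> real^3 \<Rightarrow> real^3" where
  "trig_poly S c x = (\<chi> j. Re (\<Sum>k\<in>S. c k $ j * cis (2 * pi * (k \<bullet> x))))"

text \<open>In the real expansion the amplitudes carry all the dependence on the coefficients, hence on time, and
the modes all the dependence on space. Derivatives of an atom thus become linear combinations of
fixed bounded functions with amplitudes as scalars.\<close>

definition trig_mode :: "(real^3) \<times> 3 \<times> bool \<Rightarrow> real^3 \<Rightarrow> real^3" where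
  "trig_mode = (\<lambda>(k, j, s) x.
     (if s then cos (((2 * pi) *\<^sub>R k) \<bullet> x) else sin (((2 * pi) *\<^sub>R k) \<bullet> x)) *\<^sub>R axis j 1)"

definition trig_amplitude :: "(real^3 \<Rightarrow> complex^3) \<Rightarrow> (real^3) \<times> 3 \<times> bool \<Rightarrow> real" where
  "trig_amplitude c = (\<lambda>(k, j, s). if s then Re (c k $ j) else - Im (c k $ j))"

lemma trig_poly_modes:
  "trig_poly S c x = (\<Sum>i\<in>S \<times> UNIV. trig_amplitude c i *\<^sub>R trig_mode i x)"
proof -
  have "(\<Sum>i\<in>S \<times> UNIV. trig_amplitude c i *\<^sub>R trig_mode i x)
      = (\<Sum>k\<in>S. \<Sum>j\<in>UNIV. Re (c k $ j * cis (2 * pi * (k \<bullet> x))) *\<^sub>R axis j 1)"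
    unfolding UNIV_Times_UNIV[symmetric] sum.cartesian_product'
    by (intro sum.cong refl)
       (auto simp: UNIV_bool trig_amplitude_def trig_mode_def sum.cartesian_product' algebra_simps)
  also have "\<dots> = trig_poly S c x"
    by (auto simp: vec_eq_iff trig_poly_def axis_def if_distrib cong: if_cong)
  finally show ?thesis ..
qed

lemma bounded_smooth_trig_mode: "bounded_smooth (trig_mode i)"
proof -
  obtain k j s where i: "i = (k, j, s)" by (cases i)
  show ?thesis
    unfolding i bounded_smooth_def trig_mode_def prod.case
    using bounded_derivs_trig
    by (cases s) (auto intro!: bounded_derivs_scaleR bounded_derivs_const simp del: inner_scaleR_left)
qed

lemma bounded_smooth_sum:
  "(\<And>i. i \<in> I \<Longrightarrow> bounded_smooth (f i)) \<Longrightarrow> bounded_smooth (\<lambda>x. \<Sum>i\<in>I. f i x)"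
  unfolding bounded_smooth_def by (blast intro: bounded_derivs_sum)

lemma bounded_smooth_scaleR:
  fixes f :: "'a::euclidean_space \<Rightarrow> real"
  shows "bounded_smooth f \<Longrightarrow> bounded_smooth g \<Longrightarrow> bounded_smooth (\<lambda>x. f x *\<^sub>R g x)"
  unfolding bounded_smooth_def by (blast intro: bounded_derivs_scaleR)

lemma bounded_smooth_const: "bounded_smooth (\<lambda>x. c)"
  unfolding bounded_smooth_def by (blast intro: bounded_derivs_const)

lemma bounded_smooth_trig_poly: "bounded_smooth (trig_poly S c)"
  unfolding trig_poly_modes[abs_def]
  by (intro bounded_smooth_sum bounded_smooth_scaleR bounded_smooth_const bounded_smooth_trig_mode)

lemma pdiff_trig_poly:
  "pdiff v (trig_poly S c) = trig_poly S (\<lambda>k. \<chi> j. \<i> * of_real (2 * pi * (k \<bullet> v)) * c k $ j)"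
proof
  fix x
  let ?D = "\<lambda>v. \<Sum>i\<in>S \<times> UNIV. trig_amplitude c i *\<^sub>R pdiff v (trig_mode i) x"
  have 1: "pdiff v (trig_poly S c) x = ?D v"
    unfolding trig_poly_modes[abs_def]
    by (rule pdiff_sum) (rule bounded_smoothD(2)[OF bounded_smooth_trig_mode])
  have 2: "pdiff v (trig_mode (k, j, s)) x = (if s then - (2 * pi * (k \<bullet> v)) *\<^sub>R trig_mode (k, j, False) x
      else (2 * pi * (k \<bullet> v)) *\<^sub>R trig_mode (k, j, True) x)" for k j s
    unfolding trig_mode_def prod.case
    by (cases s; simp only: if_True if_False; rule pdiff_eqI) (auto intro!: derivative_eq_intros)
  show "pdiff v (trig_poly S c) x
      = trig_poly S (\<lambda>k. \<chi> j. \<i> * of_real (2 * pi * (k \<bullet> v)) * c k $ j) x"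
    unfolding 1 unfolding trig_poly_modes UNIV_Times_UNIV[symmetric] sum.cartesian_product'
    by (simp add: UNIV_bool trig_amplitude_def 2 sum.cartesian_product' algebra_simps)
qed

lemma finite_vectors:
  assumes "finite A"
  shows "finite {n :: 'a^'n. \<forall>i. n $ i \<in> A}"
proof (rule finite_surj)
  show "finite (UNIV \<rightarrow>\<^sub>E A :: ('n \<Rightarrow> 'a) set)"
    using assms by (intro finite_PiE) auto
  show "{n :: 'a^'n. \<forall>i. n $ i \<in> A} \<subseteq> vec_lambda ` (UNIV \<rightarrow>\<^sub>E A)"
  proof safe
    fix n :: "'a^'n" assume "\<forall>i. n $ i \<in> A"
    then show "n \<in> vec_lambda ` (UNIV \<rightarrow>\<^sub>E A)"
      by (intro image_eqI[of _ _ "($) n"]) (auto simp: vec_nth_inverse)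
  qed
qed

lemma finite_lattice_ball:
  assumes "L > 0"
  shows "finite {k \<in> lattice L. norm k \<le> R}"
proof (rule finite_surj)
  let ?N = "{n :: int^3. \<forall>i. n $ i \<in> {- \<lceil>L * R\<rceil>..\<lceil>L * R\<rceil>}}"
  show "finite ?N"
    by (rule finite_vectors) simp
  show "{k \<in> lattice L. norm k \<le> R} \<subseteq> (\<lambda>n. \<chi> i. of_int (n $ i) / L) ` ?N"
  proof safe
    fix k assume k: "k \<in> lattice L" "norm k \<le> R"
    then obtain m :: "3 \<Rightarrow> int" where m: "\<And>i. k $ i = m i / L"
      unfolding lattice_def mem_Collect_eq by metis
    have "\<bar>real_of_int (m i)\<bar> \<le> L * R" for i
    proof -
      have "\<bar>k $ i\<bar> \<le> R" using component_le_norm_cart[of k i] k(2) by linarith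
      then show ?thesis using assms by (simp add: m field_simps abs_mult)
    qed
    then have "m i \<in> {- \<lceil>L * R\<rceil>..\<lceil>L * R\<rceil>}" for i
      by (smt (verit) atLeastAtMost_iff le_of_int_ceiling of_int_le_iff of_int_minus abs_le_iff)
    then show "k \<in> (\<lambda>n. \<chi> i. of_int (n $ i) / L) ` ?N"
      by (intro image_eqI[of _ _ "\<chi> i. m i"]) (auto simp: vec_eq_iff m)
  qed
qed

text \<open>The real part couples the frequencies \<open>k\<close> and \<open>-k\<close>. Passing to the coefficients
\<open>(c k + cnj (c (-k))) / 2\<close> makes the complex sum itself real, so that Parseval applies, and this
symmetrisation commutes with multiplication by the symbol \<open>2 \<pi> i k\<close> of the derivative.\<close>

lemma bernstein_cell:
  fixes R :: real
  assumes L: "L > 0"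
  defines "S \<equiv> {k \<in> lattice L. norm k \<le> R}"
  shows "(LINT x:cell L|lborel. (norm (pdiff (axis i 1) (trig_poly S c) x))\<^sup>2)
    \<le> (2 * pi * R)\<^sup>2 * (LINT x:cell L|lborel. (norm (trig_poly S c x))\<^sup>2)"
proof -
  let ?e = "\<lambda>k x. cis (2 * pi * (k \<bullet> x))"
  have S: "finite S" "S \<subseteq> lattice L"
    using finite_lattice_ball[OF L] by (auto simp: S_def)
  have Sm: "uminus ` S = S"
  proof -
    have "- k \<in> S" if "k \<in> S" for k using that by (auto simp: S_def lattice_minus)
    then show ?thesis by (force simp: image_iff)
  qed
  define \<gamma> where "\<gamma> d j k = (d k $ j + cnj (d (- k) $ j)) / (2::complex)" for d :: "real^3 \<Rightarrow> complex^3" and j k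
  have sym: "complex_of_real (trig_poly S d x $ j) = (\<Sum>k\<in>S. \<gamma> d j k * ?e k x)" for d j x
  proof -
    have "complex_of_real (trig_poly S d x $ j)
        = ((\<Sum>k\<in>S. d k $ j * ?e k x) + cnj (\<Sum>k\<in>S. d k $ j * ?e k x)) / 2"
      by (simp add: trig_poly_def complex_add_cnj del: Re_sum cnj_sum)
    also have "cnj (\<Sum>k\<in>S. d k $ j * ?e k x) = (\<Sum>k\<in>uminus ` S. cnj (d (- k) $ j) * ?e k x)"
      by (subst sum.reindex) (auto simp: inj_on_def cis_cnj)
    finally show ?thesis
      by (simp add: Sm \<gamma>_def sum.distrib[symmetric] sum_divide_distrib add_divide_distrib ring_distribs)
  qed
  have norm_int: "(LINT x:cell L|lborel. (norm (trig_poly S d x))\<^sup>2)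
      = measure lborel (cell L) * (\<Sum>j\<in>UNIV. \<Sum>k\<in>S. (cmod (\<gamma> d j k))\<^sup>2)" for d
  proof -
    have 1: "(norm (trig_poly S d x))\<^sup>2 = (\<Sum>j\<in>UNIV. (cmod (\<Sum>k\<in>S. \<gamma> d j k * ?e k x))\<^sup>2)" for x
      unfolding sym[symmetric] norm_of_real power2_abs
      unfolding power2_norm_eq_inner inner_vec_def by (simp add: power2_eq_square)
    have int: "integrable lborel (\<lambda>x. indicator (cell L) x *\<^sub>R (cmod (\<Sum>k\<in>S. \<gamma> d j k * ?e k x))\<^sup>2)" for j
    proof -
      have "continuous_on UNIV (\<lambda>x. (cmod (\<Sum>k\<in>S. \<gamma> d j k * ?e k x))\<^sup>2)"
        by (intro continuous_intros)
      from set_integrable_cell[OF this] show ?thesis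
        by (simp add: set_integrable_def)
    qed
    show ?thesis
      unfolding 1 set_lebesgue_integral_def scaleR_sum_right
      by (subst Bochner_Integration.integral_sum[OF int])
         (simp only: parseval_cell[OF L S, unfolded set_lebesgue_integral_def] sum_distrib_left)
  qed
  define d where "d k = (\<chi> j. \<i> * of_real (2 * pi * (k \<bullet> axis i 1)) * c k $ j)" for k
  have "(cmod (\<gamma> d j k))\<^sup>2 \<le> (2 * pi * R)\<^sup>2 * (cmod (\<gamma> c j k))\<^sup>2" if "k \<in> S" for j k
  proof -
    have "\<gamma> d j k = \<i> * of_real (2 * pi * (k $ i)) * \<gamma> c j k"
      by (simp add: \<gamma>_def d_def inner_axis field_simps)
    moreover have "\<bar>k $ i\<bar> \<le> R"
      using that component_le_norm_cart[of k i] by (auto simp: S_def)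
    then have "(2 * pi * (k $ i))\<^sup>2 \<le> (2 * pi * R)\<^sup>2"
      by (intro abs_le_square_iff[THEN iffD1]) (auto simp: abs_mult)
    ultimately show ?thesis
      by (simp add: norm_mult power_mult_distrib mult_right_mono)
  qed
  then have "(\<Sum>j\<in>UNIV. \<Sum>k\<in>S. (cmod (\<gamma> d j k))\<^sup>2)
      \<le> (\<Sum>j\<in>UNIV. \<Sum>k\<in>S. (2 * pi * R)\<^sup>2 * (cmod (\<gamma> c j k))\<^sup>2)"
    by (intro sum_mono)
  also have "\<dots> = (2 * pi * R)\<^sup>2 * (\<Sum>j\<in>UNIV. \<Sum>k\<in>S. (cmod (\<gamma> c j k))\<^sup>2)"
    by (simp only: sum_distrib_left)
  finally show ?thesis
    unfolding pdiff_trig_poly d_def[symmetric] norm_int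
    using mult_left_mono[OF _ measure_nonneg, of _ _ lborel "cell L"]
    by (simp only: mult.left_commute)
qed

section \<open>Convolution with smooth functions of compact support\<close>

lemma uniformly_continuous_compact_support:
  fixes f :: "'a::euclidean_space \<Rightarrow> 'b::real_normed_vector"
  assumes f: "continuous_on UNIV f" and R: "\<And>z. R < norm z \<Longrightarrow> f z = 0" and e: "e > 0"
  obtains d where "d > 0" "d \<le> 1" "\<And>x y. dist x y < d \<Longrightarrow> norm (f x - f y) < e"
proof -
  have "uniformly_continuous_on (cball 0 (R + 1)) f"
    by (intro compact_uniformly_continuous continuous_on_subset[OF f]) auto
  then obtain d where d: "d > 0"
    and fd: "\<And>x y. x \<in> cball 0 (R + 1) \<Longrightarrow> y \<in> cball 0 (R + 1) \<Longrightarrow> dist y x < d \<Longrightarrow> dist (f y) (f x) < e"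
    using e unfolding uniformly_continuous_on_def by metis
  have "norm (f x - f y) < e" if "dist x y < min d 1" for x y
  proof (cases "x \<in> cball 0 (R + 1) \<and> y \<in> cball 0 (R + 1)")
    case True
    then show ?thesis using fd[of y x] that by (auto simp: dist_norm)
  next
    case False
    then have "R < norm x" "R < norm y"
      using that norm_triangle_ineq2[of x y] norm_triangle_ineq2[of y x]
      by (auto simp: dist_norm norm_minus_commute)
    then show ?thesis using R e by simp
  qed
  then show thesis using that[of "min d 1"] d by auto
qed

lemma pdiff_Basis_sum:
  fixes h :: "'a::euclidean_space \<Rightarrow> 'b::real_normed_vector"
  assumes "h differentiable at z"
  shows "pdiff v h z = (\<Sum>b\<in>Basis. (v \<bullet> b) *\<^sub>R pdiff b h z)"
proof -
  interpret bounded_linear "\<lambda>v. pdiff v h z"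
    using has_derivative_pdiff[OF assms] by (rule has_derivative_bounded_linear)
  have "pdiff v h z = pdiff (\<Sum>b\<in>Basis. (v \<bullet> b) *\<^sub>R b) h z"
    by (simp add: euclidean_representation)
  also have "\<dots> = (\<Sum>b\<in>Basis. (v \<bullet> b) *\<^sub>R pdiff b h z)"
    by (simp add: sum scaleR)
  finally show ?thesis .
qed

lemma pdiff_outside_support:
  assumes "\<And>z. R < norm z \<Longrightarrow> h z = 0" and "R < norm z"
  shows "pdiff v h z = 0"
proof (rule pdiff_eqI)
  show "(h has_derivative (\<lambda>v. 0)) (at z)"
  proof (rule has_derivative_transform_within_open)
    show "open {z :: 'a. R < norm z}"
      by (intro open_Collect_less continuous_intros)
  qed (use assms in \<open>auto intro: has_derivative_const\<close>)
qed

text \<open>By the mean value theorem the error is controlled by the oscillation of the derivative over a distance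
\<open>d\<close>, and a continuous function of compact support is uniformly continuous.\<close>

lemma uniform_first_order_expansion:
  fixes h :: "'a::euclidean_space \<Rightarrow> real"
  assumes h: "\<And>z. h differentiable at z"
    and c: "\<And>b. b \<in> Basis \<Longrightarrow> continuous_on UNIV (pdiff b h)"
    and R: "\<And>z. R < norm z \<Longrightarrow> h z = 0" and e: "e > 0"
  obtains d where "d > 0" "d \<le> 1"
    "\<And>z v. norm v < d \<Longrightarrow> \<bar>h (z + v) - h z - pdiff v h z\<bar> \<le> e * norm v"
proof -
  define e' where "e' = e / DIM('a)"
  have e': "e' > 0" using e by (simp add: e'_def)
  have "\<forall>b\<in>Basis. \<exists>d>0. d \<le> 1 \<and>
      (\<forall>x y. dist x y < d \<longrightarrow> norm (pdiff b h x - pdiff b h y) < e')"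
  proof
    fix b :: 'a assume b: "b \<in> Basis"
    have Rb: "R < norm z \<Longrightarrow> pdiff b h z = 0" for z
      by (rule pdiff_outside_support[OF R])
    obtain d where "d > 0" "d \<le> 1" "\<And>x y. dist x y < d \<Longrightarrow> norm (pdiff b h x - pdiff b h y) < e'"
      using uniformly_continuous_compact_support[OF c[OF b] Rb e'] by blast
    then show "\<exists>d>0. d \<le> 1 \<and> (\<forall>x y. dist x y < d \<longrightarrow> norm (pdiff b h x - pdiff b h y) < e')"
      by blast
  qed
  then obtain d where d: "\<And>b. b \<in> Basis \<Longrightarrow> d b > 0 \<and> d b \<le> 1 \<and>
      (\<forall>x y. dist x y < d b \<longrightarrow> norm (pdiff b h x - pdiff b h y) < e')"
    by (elim bchoice[THEN exE]) blast
  define D where "D = Min (d ` Basis)"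
  have D: "D > 0" "\<And>b. b \<in> Basis \<Longrightarrow> D \<le> d b"
    using d by (auto simp: D_def)
  have D1: "D \<le> 1"
    using D(2)[OF SOME_Basis] d[OF SOME_Basis] by linarith
  have main: "\<bar>h (z + v) - h z - pdiff v h z\<bar> \<le> e * norm v" if v: "norm v < D" for z v
  proof -
    define g where "g w = h w - pdiff w h z" for w
    interpret lin: bounded_linear "\<lambda>v. pdiff v h z"
      using has_derivative_pdiff[OF h] by (rule has_derivative_bounded_linear)
    have dg: "(g has_derivative (\<lambda>v. pdiff v h w - pdiff v h z)) (at w within ball z D)" for w
      unfolding g_def
      by (intro has_derivative_diff has_derivative_at_withinI[OF has_derivative_pdiff[OF h]]
          lin.has_derivative has_derivative_ident)
    have bd: "onorm (\<lambda>v. pdiff v h w - pdiff v h z) \<le> e" if w: "w \<in> ball z D" for w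
    proof (rule onorm_bound)
      fix u :: 'a
      have "pdiff u h w - pdiff u h z = (\<Sum>b\<in>Basis. (u \<bullet> b) * (pdiff b h w - pdiff b h z))"
        by (simp add: pdiff_Basis_sum[OF h, of u] sum_subtractf right_diff_distrib)
      also have "norm \<dots> \<le> (\<Sum>b\<in>(Basis :: 'a set). norm u * e')"
      proof (rule sum_norm_le)
        fix b :: 'a assume b: "b \<in> Basis"
        have "norm (pdiff b h w - pdiff b h z) \<le> e'"
          using d[OF b] D(2)[OF b] w by (auto simp: dist_commute intro: less_imp_le)
        then show "norm ((u \<bullet> b) * (pdiff b h w - pdiff b h z)) \<le> norm u * e'"
          using Basis_le_norm[OF b, of u] e' unfolding norm_mult
          by (intro mult_mono) auto
      qed
      also have "\<dots> = e * norm u" by (simp add: e'_def)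
      finally show "norm (pdiff u h w - pdiff u h z) \<le> e * norm u" .
    qed (use e in auto)
    have "norm (g (z + v) - g z) \<le> e * norm (z + v - z)"
      by (rule differentiable_bound[OF convex_ball dg bd]) (use v D in \<open>auto simp: dist_norm\<close>)
    then show ?thesis by (simp add: g_def lin.add algebra_simps)
  qed
  show thesis by (rule that[OF D(1) D1 main])
qed

text \<open>The rough factor \<open>\<theta>\<close>, a bounded function such as the characteristic function of a periodic family of
cubes, comes first.\<close>

definition conv :: "('a::euclidean_space \<Rightarrow> real) \<Rightarrow> ('a \<Rightarrow> real) \<Rightarrow> 'a \<Rightarrow> real" where
  "conv \<theta> h x = (\<integral>y. \<theta> y * h (x - y) \<partial>lborel)"

lemma conv_integrable:
  fixes h :: "'a::euclidean_space \<Rightarrow> real"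
  assumes [measurable]: "\<theta> \<in> borel_measurable borel" and b: "\<And>y. \<bar>\<theta> y\<bar> \<le> 1"
    and h: "continuous_on UNIV h" "\<And>z. R < norm z \<Longrightarrow> h z = 0"
  shows "integrable lborel (\<lambda>y. \<theta> y * h (x - y))"
proof -
  have [measurable]: "h \<in> borel_measurable borel"
    by (rule borel_measurable_continuous_onI[OF h(1)])
  have "integrable lborel (\<lambda>y. indicator (cball x R) y *\<^sub>R \<bar>h (x - y)\<bar>)"
    by (intro borel_integrable_compact continuous_intros continuous_on_compose2[OF h(1)]) auto
  then show ?thesis
  proof (rule Bochner_Integration.integrable_bound)
    show "AE y in lborel. norm (\<theta> y * h (x - y)) \<le> norm (indicator (cball x R) y *\<^sub>R \<bar>h (x - y)\<bar>)"
    proof (rule AE_I2)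
      fix y
      show "norm (\<theta> y * h (x - y)) \<le> norm (indicator (cball x R) y *\<^sub>R \<bar>h (x - y)\<bar>)"
        using b[of y] h(2)[of "x - y"]
        by (auto simp: indicator_def dist_norm abs_mult mult_left_le_one_le)
    qed
  qed measurable
qed

text \<open>For increments shorter than \<open>1\<close> the error in the first order expansion of \<open>h (x - y)\<close> vanishes for \<open>y\<close>
outside the ball of radius \<open>R + 1\<close> about \<open>x\<close>. Inside it is uniformly small, so it stays small after
integration.\<close>

lemma conv_has_derivative:
  fixes h :: "'a::euclidean_space \<Rightarrow> real"
  assumes \<theta>: "\<theta> \<in> borel_measurable borel" "\<And>y. \<bar>\<theta> y\<bar> \<le> 1"
    and h: "\<And>z. h differentiable at z"
    and c: "\<And>b. b \<in> Basis \<Longrightarrow> continuous_on UNIV (pdiff b h)"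
    and R: "\<And>z. R < norm z \<Longrightarrow> h z = 0"
  shows "(conv \<theta> h has_derivative (\<lambda>v. conv \<theta> (pdiff v h) x)) (at x)"
  unfolding has_derivative_at_alt
proof (intro conjI allI impI)
  have hc: "continuous_on UNIV h"
    by (intro continuous_at_imp_continuous_on ballI differentiable_imp_continuous_within h)
  have cv: "continuous_on UNIV (pdiff v h)" for v
  proof -
    have "pdiff v h = (\<lambda>z. \<Sum>b\<in>Basis. (v \<bullet> b) *\<^sub>R pdiff b h z)"
      using pdiff_Basis_sum[OF h, of v] by (rule ext)
    then show ?thesis by (simp only:) (intro continuous_intros c)
  qed
  have Rv: "R < norm z \<Longrightarrow> pdiff v h z = 0" for v z
    by (rule pdiff_outside_support[OF R])
  have i1: "integrable lborel (\<lambda>y. \<theta> y * h (x - y))" for x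
    by (rule conv_integrable[OF \<theta> hc R])
  have i2: "integrable lborel (\<lambda>y. \<theta> y * pdiff v h (x - y))" for x v
    by (rule conv_integrable[OF \<theta> cv Rv])
  have "conv \<theta> (pdiff v h) x = (\<Sum>b\<in>Basis. (v \<bullet> b) *\<^sub>R conv \<theta> (pdiff b h) x)" for v
  proof -
    have "conv \<theta> (pdiff v h) x = (\<integral>y. (\<Sum>b\<in>Basis. (v \<bullet> b) * (\<theta> y * pdiff b h (x - y))) \<partial>lborel)"
      unfolding conv_def
    proof (rule Bochner_Integration.integral_cong[OF refl])
      fix y
      show "\<theta> y * pdiff v h (x - y) = (\<Sum>b\<in>Basis. (v \<bullet> b) * (\<theta> y * pdiff b h (x - y)))"
        using pdiff_Basis_sum[OF h, of v "x - y"] by (simp add: sum_distrib_left mult.left_commute)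
    qed
    also have "\<dots> = (\<Sum>b\<in>Basis. (v \<bullet> b) *\<^sub>R conv \<theta> (pdiff b h) x)"
      by (simp add: conv_def i2)
    finally show ?thesis .
  qed
  then have "(\<lambda>v. conv \<theta> (pdiff v h) x) = (\<lambda>v. \<Sum>b\<in>Basis. (v \<bullet> b) *\<^sub>R conv \<theta> (pdiff b h) x)"
    by (rule ext)
  moreover have "bounded_linear (\<lambda>v. \<Sum>b\<in>Basis. (v \<bullet> b) *\<^sub>R conv \<theta> (pdiff b h) x)"
    by (intro bounded_linear_sum bounded_linear_scaleR_const bounded_linear_inner_left)
  ultimately show "bounded_linear (\<lambda>v. conv \<theta> (pdiff v h) x)"
    by (simp only:)
  fix e :: real assume e: "e > 0"
  define m where "m = measure lborel (cball x (R + 1))"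
  have m: "0 \<le> m" by (simp add: m_def)
  have em: "e / (m + 1) > 0" using e m by simp
  obtain d where d: "d > 0" "d \<le> 1"
    and exp: "\<And>z v. norm v < d \<Longrightarrow> \<bar>h (z + v) - h z - pdiff v h z\<bar> \<le> e / (m + 1) * norm v"
    using uniform_first_order_expansion[OF h c R em] by blast
  show "\<exists>d>0. \<forall>y. norm (y - x) < d \<longrightarrow>
      norm (conv \<theta> h y - conv \<theta> h x - conv \<theta> (pdiff (y - x) h) x) \<le> e * norm (y - x)"
  proof (intro exI[of _ d] conjI allI impI d(1))
    fix y assume y: "norm (y - x) < d"
    define v where "v = y - x"
    let ?E = "\<lambda>w. \<theta> w * (h (y - w) - h (x - w) - pdiff v h (x - w))"
    have eq: "conv \<theta> h y - conv \<theta> h x - conv \<theta> (pdiff v h) x = (\<integral>w. ?E w \<partial>lborel)"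
      unfolding conv_def right_diff_distrib by (simp add: i1 i2)
    have "norm (\<integral>w. ?E w \<partial>lborel) \<le> (\<integral>w. indicator (cball x (R + 1)) w *\<^sub>R (e / (m + 1) * norm v) \<partial>lborel)"
    proof (rule Bochner_Integration.integral_norm_bound_integral)
      show "integrable lborel ?E"
        unfolding right_diff_distrib by (intro Bochner_Integration.integrable_diff i1 i2)
      show "integrable lborel (\<lambda>w. indicator (cball x (R + 1)) w *\<^sub>R (e / (m + 1) * norm v))"
        by (intro borel_integrable_compact) auto
      fix w
      show "norm (?E w) \<le> indicator (cball x (R + 1)) w *\<^sub>R (e / (m + 1) * norm v)"
      proof (cases "w \<in> cball x (R + 1)")
        case True
        have "\<bar>h (y - w) - h (x - w) - pdiff v h (x - w)\<bar> \<le> e / (m + 1) * norm v"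
          using exp[of v "x - w"] y by (simp add: v_def)
        then have "\<bar>\<theta> w\<bar> * \<bar>h (y - w) - h (x - w) - pdiff v h (x - w)\<bar> \<le> 1 * (e / (m + 1) * norm v)"
          by (intro mult_mono \<theta>) auto
        then show ?thesis using True by (simp add: abs_mult)
      next
        case False
        then have "R + 1 < norm (x - w)" by (simp add: dist_norm)
        moreover have "norm (x - w) \<le> norm (y - w) + norm (y - x)"
          using norm_triangle_ineq4[of "y - w" "y - x"] by simp
        ultimately have "R < norm (x - w)" "R < norm (y - w)"
          using y d(2) by auto
        then show ?thesis using False by (simp add: R Rv)
      qed
    qed
    also have "\<dots> = m * (e / (m + 1) * norm v)"
      by (simp add: m_def)
    also have "\<dots> = m / (m + 1) * (e * norm v)" by simp
    also have "\<dots> \<le> 1 * (e * norm v)"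
      using m e by (intro mult_right_mono) auto
    finally show "norm (conv \<theta> h y - conv \<theta> h x - conv \<theta> (pdiff (y - x) h) x) \<le> e * norm (y - x)"
      unfolding eq[unfolded v_def] by (simp add: v_def)
  qed
qed

lemma smooth_pdiff:
  fixes h :: "'a::euclidean_space \<Rightarrow> 'b::real_normed_vector"
  shows "smooth h \<Longrightarrow> b \<in> Basis \<Longrightarrow> smooth (pdiff b h)"
  unfolding smooth_def
proof (intro allI impI)
  fix vs :: "'a list" and x assume h: "\<forall>vs. set vs \<subseteq> Basis \<longrightarrow> (\<forall>x. foldr pdiff vs h differentiable at x)"
    and "b \<in> Basis" "set vs \<subseteq> Basis"
  then have "foldr pdiff (vs @ [b]) h differentiable at x"
    by (intro h[rule_format]) auto
  then show "foldr pdiff vs (pdiff b h) differentiable at x" by simp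
qed

lemma smooth_differentiable: "smooth h \<Longrightarrow> h differentiable at x"
  unfolding smooth_def by (drule spec[of _ "[]"]) simp

lemma smooth_continuous: "smooth h \<Longrightarrow> continuous_on UNIV h"
  by (intro continuous_at_imp_continuous_on ballI differentiable_imp_continuous_within
      smooth_differentiable)

lemma smooth_scaled:
  fixes h :: "'a::euclidean_space \<Rightarrow> real"
  assumes "smooth h"
  shows "smooth (\<lambda>x. c * h (a *\<^sub>R x))"
proof -
  have D: "((\<lambda>x. C * g (a *\<^sub>R x)) has_derivative (\<lambda>v. C * pdiff (a *\<^sub>R v) g (a *\<^sub>R x))) (at x)"
    if "\<And>x. g differentiable at x" for C and g :: "'a \<Rightarrow> real" and x
    by (intro has_derivative_mult_right has_derivative_compose[of "\<lambda>x. a *\<^sub>R x", OF _ has_derivative_pdiff[OF that]]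
        has_derivative_scaleR_right has_derivative_ident)
  have eq: "foldr pdiff vs (\<lambda>x. c * h (a *\<^sub>R x)) = (\<lambda>x. c * a ^ length vs * foldr pdiff vs h (a *\<^sub>R x))"
    if "set vs \<subseteq> Basis" for vs
    using that
  proof (induction vs)
    case (Cons v vs)
    let ?g = "foldr pdiff vs h" and ?C = "c * a ^ length vs"
    have dg: "?g differentiable at x" for x
      using assms Cons.prems by (simp add: smooth_def)
    have "foldr pdiff (v # vs) (\<lambda>x. c * h (a *\<^sub>R x)) x = ?C * pdiff (a *\<^sub>R v) ?g (a *\<^sub>R x)" for x
      using Cons.IH Cons.prems pdiff_eqI[OF D[OF dg, of ?C x], of v] by simp
    moreover have "pdiff (a *\<^sub>R v) ?g y = a * pdiff v ?g y" for y
      using linear_scale[OF bounded_linear.linear[OF has_derivative_bounded_linear[OF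
          has_derivative_pdiff[OF dg]]], of a v y] by simp
    ultimately show ?case by (simp add: fun_eq_iff)
  qed simp
  show ?thesis
    unfolding smooth_def
  proof (intro allI impI)
    fix vs :: "'a list" and x assume vs: "set vs \<subseteq> Basis"
    have "foldr pdiff vs h differentiable at x" for x
      using assms vs by (simp add: smooth_def)
    from D[OF this] show "foldr pdiff vs (\<lambda>x. c * h (a *\<^sub>R x)) differentiable at x"
      unfolding eq[OF vs] differentiable_def by blast
  qed
qed

text \<open>Every derivative falls on \<open>h\<close>, and the derivatives of \<open>h\<close> are again smooth with the same support bound.\<close>

lemma bounded_smooth_conv:
  fixes h :: "'a::euclidean_space \<Rightarrow> real"
  assumes \<theta>[measurable]: "\<theta> \<in> borel_measurable borel" and \<theta>1: "\<And>y. \<bar>\<theta> y\<bar> \<le> 1"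
    and h: "smooth h" "\<And>z. R < norm z \<Longrightarrow> h z = 0"
  shows "bounded_smooth (conv \<theta> h)"
proof -
  have bd: "bounded (range (conv \<theta> h))"
    if h: "smooth h" "\<And>z. R < norm z \<Longrightarrow> h z = 0" for h :: "'a \<Rightarrow> real"
  proof -
    have [measurable]: "h \<in> borel_measurable borel"
      by (rule borel_measurable_continuous_onI[OF smooth_continuous[OF h(1)]])
    have "norm (conv \<theta> h x) \<le> (\<integral>y. \<bar>h y\<bar> \<partial>lborel)" for x
    proof -
      have "norm (conv \<theta> h x) \<le> (\<integral>y. \<bar>1 * h (x - y)\<bar> \<partial>lborel)"
        unfolding conv_def
      proof (rule Bochner_Integration.integral_norm_bound_integral)
        show "integrable lborel (\<lambda>y. \<theta> y * h (x - y))"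
          by (rule conv_integrable[OF \<theta> \<theta>1 smooth_continuous[OF h(1)] h(2)])
        show "integrable lborel (\<lambda>y. \<bar>1 * h (x - y)\<bar>)"
          by (rule integrable_abs[OF conv_integrable[OF _ _ smooth_continuous[OF h(1)] h(2)]]) auto
        show "norm (\<theta> y * h (x - y)) \<le> \<bar>1 * h (x - y)\<bar>" for y
          using \<theta>1[of y] by (simp add: abs_mult mult_left_le_one_le)
      qed
      also have "\<dots> = (\<integral>y. \<bar>h y\<bar> \<partial>lborel)"
        by (subst lborel_integral_affine[of "\<lambda>y. \<bar>h y\<bar>" "-1" x]) auto
      finally show ?thesis .
    qed
    then show ?thesis unfolding bounded_iff by blast
  qed
  have "bounded_derivs n (conv \<theta> h)"
    if "smooth h" "\<And>z. R < norm z \<Longrightarrow> h z = 0" for n and h :: "'a \<Rightarrow> real"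
    using that
  proof (induction n arbitrary: h)
    case 0
    then show ?case using bd by simp
  next
    case (Suc n)
    have D: "(conv \<theta> h has_derivative (\<lambda>v. conv \<theta> (pdiff v h) x)) (at x)" for x
      by (rule conv_has_derivative[OF \<theta> \<theta>1 smooth_differentiable smooth_continuous[OF smooth_pdiff]])
         (use Suc.prems in auto)
    have "pdiff v (conv \<theta> h) = conv \<theta> (pdiff v h)" for v
      by (simp add: fun_eq_iff pdiff_eqI[OF D])
    moreover have "bounded_derivs n (conv \<theta> (pdiff v h))" if "v \<in> Basis" for v
      using that Suc.prems
      by (intro Suc.IH smooth_pdiff pdiff_outside_support[of R h]) auto
    ultimately show ?case
      using D bd[OF Suc.prems] by (auto simp: differentiable_def)
  qed
  then show ?thesis using h by (simp add: bounded_smooth_def)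
qed

section \<open>Cubes and their smooth cutoffs\<close>

definition grid_index :: "real \<Rightarrow> nat \<Rightarrow> real^3 \<Rightarrow> int^3" where
  "grid_index L q x = (\<chi> i. \<lfloor>x $ i / ell L q\<rfloor>)"

lemma ell_pos: "L > 0 \<Longrightarrow> ell L q > 0"
  by (simp add: ell_def)

lemma lam_pos: "L > 0 \<Longrightarrow> lam L q > 0"
  by (simp add: lam_def)

lemma mem_cube_iff:
  assumes "L > 0"
  shows "x \<in> cube L q k \<longleftrightarrow> grid_index L q x = k"
proof -
  have "ell L q * of_int n \<le> y \<and> y < ell L q * (of_int n + 1) \<longleftrightarrow> \<lfloor>y / ell L q\<rfloor> = n" for y and n :: int
    using ell_pos[OF assms, of q] by (simp add: floor_eq_iff field_simps)
  then show ?thesis by (simp add: cube_def grid_index_def vec_eq_iff)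
qed

lemma grid_index_shift:
  assumes "L > 0"
  shows "grid_index L q (x + (\<chi> i. L * of_int (m $ i))) = grid_index L q x + (\<chi> i. 2 ^ q * m $ i)"
proof -
  have "(x $ i + L * of_int (m $ i)) / ell L q = x $ i / ell L q + of_int (2 ^ q * m $ i)" for i
    using assms by (simp add: ell_def field_simps)
  then show ?thesis
    unfolding grid_index_def vec_eq_iff
    by (intro allI) (simp only: vector_add_component vec_lambda_beta floor_add_int)
qed

text \<open>A periodic shift moves the grid index by multiples of \<open>2 ^ q\<close>, so the periodic extension of a cube is
described by a residue. In particular these extensions partition space.\<close>

lemma cube_char_eq:
  assumes "L > 0" and k: "k \<in> cube_index q"
  shows "cube_char L q k x = of_bool (k = (\<chi> i. grid_index L q x $ i mod 2 ^ q))"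
proof -
  have "(\<exists>m::int^3. grid_index L q x + (\<chi> i. 2 ^ q * m $ i) = k)
      \<longleftrightarrow> k = (\<chi> i. grid_index L q x $ i mod 2 ^ q)" (is "?l \<longleftrightarrow> ?r")
  proof
    assume ?l
    then obtain m :: "int^3" where "\<And>i. k $ i = grid_index L q x $ i + 2 ^ q * m $ i"
      unfolding vec_eq_iff by (metis vec_lambda_beta vector_add_component)
    then have "k $ i mod 2 ^ q = grid_index L q x $ i mod 2 ^ q" for i by simp
    then show ?r using k by (simp add: cube_index_def vec_eq_iff)
  next
    assume r: ?r
    have "grid_index L q x $ i + 2 ^ q * (- (grid_index L q x $ i div 2 ^ q)) = k $ i" for i
      unfolding r using minus_mult_div_eq_mod[of "grid_index L q x $ i" "2 ^ q"] by simp
    then show ?l by (intro exI[of _ "\<chi> i. - (grid_index L q x $ i div 2 ^ q)"]) (simp add: vec_eq_iff)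
  qed
  then show ?thesis
    by (simp add: cube_char_def indicator_def mem_cube_iff[OF assms(1)] grid_index_shift[OF assms(1)])
qed

lemma finite_cube_index: "finite (cube_index q)"
proof -
  have "cube_index q \<subseteq> {k. \<forall>i. k $ i \<in> {0..2 ^ q}}"
    by (auto simp: cube_index_def intro: less_imp_le)
  then show ?thesis using finite_subset finite_vectors[of "{0..2 ^ q :: int}"] by blast
qed

lemma sum_cube_char:
  assumes "L > 0"
  shows "(\<Sum>k\<in>cube_index q. cube_char L q k x) = 1"
proof -
  have "(\<chi> i. grid_index L q x $ i mod 2 ^ q) \<in> cube_index q"
    by (simp add: cube_index_def)
  moreover have "(\<Sum>k\<in>cube_index q. cube_char L q k x)
      = (\<Sum>k\<in>cube_index q. if k = (\<chi> i. grid_index L q x $ i mod 2 ^ q) then 1 else 0)"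
    using assms by (intro sum.cong refl) (simp add: cube_char_eq of_bool_def)
  ultimately show ?thesis using finite_cube_index by simp
qed

lemma cube_char_bounds: "0 \<le> cube_char L q k x" "\<bar>cube_char L q k x\<bar> \<le> 1"
  by (auto simp: cube_char_def indicator_def)

lemma grid_index_measurable: "(\<lambda>x. grid_index L q x $ i) \<in> borel \<rightarrow>\<^sub>M count_space UNIV"
  unfolding grid_index_def by simp

lemma cube_borel:
  assumes "L > 0"
  shows "cube L q k \<in> sets borel"
proof -
  have "{x. grid_index L q x $ i = k $ i} \<in> sets borel" for i
    using measurable_sets[OF grid_index_measurable, of "{k $ i}"] by (simp add: vimage_def)
  then have "(\<Inter>i. {x. grid_index L q x $ i = k $ i}) \<in> sets borel"
    by (intro sets.countable_INT'') (auto simp: countable_finite)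
  moreover have "cube L q k = (\<Inter>i. {x. grid_index L q x $ i = k $ i})"
    by (auto simp: mem_cube_iff[OF assms] vec_eq_iff)
  ultimately show ?thesis by simp
qed

lemma cube_char_measurable:
  assumes "L > 0"
  shows "cube_char L q k \<in> borel_measurable borel"
proof -
  have "{x. \<exists>m :: int^3. x + (\<chi> i. L * of_int (m $ i)) \<in> cube L q k}
      = (\<Union>m :: int^3. {x. x + (\<chi> i. L * of_int (m $ i)) \<in> cube L q k})"
    by auto
  also have "\<dots> \<in> sets borel"
  proof (intro sets.countable_UN'')
    fix m :: "int^3"
    have "(\<lambda>x. x + (\<chi> i. L * of_int (m $ i))) \<in> borel_measurable borel" by measurable
    from measurable_sets[OF this cube_borel[OF assms, of q k]]
    show "{x. x + (\<chi> i. L * of_int (m $ i)) \<in> cube L q k} \<in> sets borel"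
      by (simp add: vimage_def)
  qed auto
  finally show ?thesis unfolding cube_char_def by simp
qed

text \<open>The prefactor is \<open>lam L q ^ 3\<close>, which is what keeps the integral equal to \<open>1\<close>.\<close>

definition scaled_mollifier :: "real \<Rightarrow> (real^3 \<Rightarrow> real) \<Rightarrow> nat \<Rightarrow> real^3 \<Rightarrow> real" where
  "scaled_mollifier L \<eta> q y = 1 / L ^ 3 * 2 ^ (3 * q) * \<eta> (lam L q *\<^sub>R y)"

lemma scaled_mollifier:
  assumes L: "L > 0" and \<eta>: "mollifier \<eta>"
  shows "smooth (scaled_mollifier L \<eta> q)"
    and "0 \<le> scaled_mollifier L \<eta> q y"
    and "ell L q < norm y \<Longrightarrow> scaled_mollifier L \<eta> q y = 0"
    and "(\<integral>y. scaled_mollifier L \<eta> q y \<partial>lborel) = 1"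
proof -
  have sm: "smooth \<eta>" and int: "(LINT y|lebesgue. \<eta> y) = 1" and nn: "\<And>y. 0 \<le> \<eta> y"
    and supp: "closure {y. \<eta> y \<noteq> 0} \<subseteq> cball 0 1"
    using \<eta> by (auto simp: mollifier_def)
  show "smooth (scaled_mollifier L \<eta> q)"
    unfolding scaled_mollifier_def[abs_def] by (rule smooth_scaled[OF sm])
  show "0 \<le> scaled_mollifier L \<eta> q y"
    using nn L by (simp add: scaled_mollifier_def)
  show "scaled_mollifier L \<eta> q y = 0" if "ell L q < norm y"
  proof -
    have "1 < norm (lam L q *\<^sub>R y)"
      using that L by (simp add: lam_def ell_def field_simps)
    then have "lam L q *\<^sub>R y \<notin> {y. \<eta> y \<noteq> 0}"
      using supp closure_subset[of "{y. \<eta> y \<noteq> 0}"] by (meson linorder_not_le mem_cball_0 subset_iff)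
    then show ?thesis by (simp add: scaled_mollifier_def)
  qed
  have [measurable]: "\<eta> \<in> borel_measurable borel"
    by (rule borel_measurable_continuous_onI[OF smooth_continuous[OF sm]])
  have "1 = (\<integral>y. \<eta> y \<partial>lborel)"
    using int by (simp add: integral_completion)
  also have "\<dots> = lam L q ^ 3 * (\<integral>y. \<eta> (lam L q *\<^sub>R y) \<partial>lborel)"
    using lam_pos[OF L, of q] by (subst lborel_integral_affine[of \<eta> "lam L q" 0]) auto
  also have "lam L q ^ 3 = 1 / L ^ 3 * 2 ^ (3 * q)"
    by (simp add: lam_def power_divide power_mult flip: power_mult[of 2 q 3] mult.commute[of 3 q])
  finally show "(\<integral>y. scaled_mollifier L \<eta> q y \<partial>lborel) = 1"
    unfolding scaled_mollifier_def integral_mult_right_zero by (rule sym)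
qed

lemma cube_cutoff_eq_integral:
  assumes L: "L > 0" and \<eta>: "mollifier \<eta>"
  shows "cube_cutoff L \<eta> q k x = (\<integral>y. cube_char L q k (x - y) * scaled_mollifier L \<eta> q y \<partial>lborel)"
proof -
  have [measurable]: "\<eta> \<in> borel_measurable borel"
    using \<eta> by (intro borel_measurable_continuous_onI smooth_continuous) (simp add: mollifier_def)
  note [measurable] = cube_char_measurable[OF L, of q k]
  have "cube_cutoff L \<eta> q k x
      = 1 / L ^ 3 * (\<integral>y. cube_char L q k (x - y) * (2 ^ (3 * q) * \<eta> (lam L q *\<^sub>R y)) \<partial>lborel)"
    unfolding cube_cutoff_def by (subst integral_completion) simp_all
  also have "\<dots> = (\<integral>y. 1 / L ^ 3 * (cube_char L q k (x - y) * (2 ^ (3 * q) * \<eta> (lam L q *\<^sub>R y))) \<partial>lborel)"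
    by (rule integral_mult_right_zero[symmetric])
  finally show ?thesis by (simp add: scaled_mollifier_def mult_ac)
qed

lemma cube_cutoff_conv:
  assumes L: "L > 0" and \<eta>: "mollifier \<eta>"
  shows "cube_cutoff L \<eta> q k = conv (cube_char L q k) (scaled_mollifier L \<eta> q)"
proof
  fix x
  have [measurable]: "scaled_mollifier L \<eta> q \<in> borel_measurable borel"
    by (intro borel_measurable_continuous_onI smooth_continuous scaled_mollifier L \<eta>)
  note [measurable] = cube_char_measurable[OF L, of q k]
  show "cube_cutoff L \<eta> q k x = conv (cube_char L q k) (scaled_mollifier L \<eta> q) x"
    unfolding cube_cutoff_eq_integral[OF L \<eta>] conv_def
    by (subst lborel_integral_affine[of "\<lambda>y. cube_char L q k (x - y) * scaled_mollifier L \<eta> q y" "-1" x]) auto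
qed

lemma bounded_smooth_cube_cutoff:
  assumes L: "L > 0" and \<eta>: "mollifier \<eta>"
  shows "bounded_smooth (cube_cutoff L \<eta> q k)"
  unfolding cube_cutoff_conv[OF L \<eta>]
  by (intro bounded_smooth_conv[where R = "ell L q"] cube_char_measurable cube_char_bounds scaled_mollifier L \<eta>)

lemma cube_cutoff_integrable:
  assumes L: "L > 0" and \<eta>: "mollifier \<eta>"
  shows "integrable lborel (\<lambda>y. cube_char L q k (x - y) * scaled_mollifier L \<eta> q y)"
proof -
  have "(\<lambda>y. cube_char L q k (x - y)) \<in> borel_measurable borel"
    using cube_char_measurable[OF L, of q k] by measurable
  then have "integrable lborel (\<lambda>y. cube_char L q k (x - y) * scaled_mollifier L \<eta> q (- (0 - y)))"
    by (intro conv_integrable[where h = "\<lambda>z. scaled_mollifier L \<eta> q (- z)" and R = "ell L q"]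
        cube_char_bounds scaled_mollifier L \<eta>
        continuous_on_compose2[OF smooth_continuous[OF scaled_mollifier(1)[OF L \<eta>]]]
        continuous_intros) (auto intro: scaled_mollifier L \<eta>)
  then show ?thesis by simp
qed

lemma cube_cutoff_nonneg:
  assumes L: "L > 0" and \<eta>: "mollifier \<eta>"
  shows "0 \<le> cube_cutoff L \<eta> q k x"
  unfolding cube_cutoff_eq_integral[OF L \<eta>]
  by (intro integral_nonneg_AE AE_I2 mult_nonneg_nonneg cube_char_bounds scaled_mollifier L \<eta>)

lemma sum_cube_cutoff:
  assumes L: "L > 0" and \<eta>: "mollifier \<eta>"
  shows "(\<Sum>k\<in>cube_index q. cube_cutoff L \<eta> q k x) = 1"
proof -
  have "(\<Sum>k\<in>cube_index q. cube_cutoff L \<eta> q k x)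
      = (\<integral>y. (\<Sum>k\<in>cube_index q. cube_char L q k (x - y) * scaled_mollifier L \<eta> q y) \<partial>lborel)"
    unfolding cube_cutoff_eq_integral[OF L \<eta>]
    by (rule Bochner_Integration.integral_sum[symmetric]) (rule cube_cutoff_integrable[OF L \<eta>])
  also have "\<dots> = 1"
    by (simp add: sum_distrib_right[symmetric] sum_cube_char[OF L] scaled_mollifier[OF L \<eta>])
  finally show ?thesis .
qed

text \<open>Offsets between a cube and the cubes touching it; their number is the overlap constant in all pointwise
estimates.\<close>

definition near_indices :: "(int^3) set" where
  "near_indices = {v. \<forall>i. v $ i \<in> {-1..1}}"

text \<open>The mollification radius equals the side length of the cubes, so a cutoff reaches at most into the
adjacent cubes. These lie within index distance \<open>sqrt 3 < 3\<close>, hence in the starred cube.\<close>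

lemma cube_cutoff_support:
  assumes L: "L > 0" and \<eta>: "mollifier \<eta>" and k: "k \<in> cube_index q" and x: "x \<in> cell L"
    and nz: "cube_cutoff L \<eta> q k x \<noteq> 0"
  shows "x \<in> cube_star L q k"
    and "k \<in> (\<lambda>v. \<chi> i. (grid_index L q x $ i + v $ i) mod 2 ^ q) ` near_indices"
proof -
  let ?n = "grid_index L q x"
  have "\<exists>y. cube_char L q k (x - y) * scaled_mollifier L \<eta> q y \<noteq> 0"
  proof (rule ccontr)
    assume "\<not> ?thesis"
    then have "cube_cutoff L \<eta> q k x = (\<integral>y. 0 \<partial>(lborel :: (real^3) measure))"
      unfolding cube_cutoff_eq_integral[OF L \<eta>] by (intro Bochner_Integration.integral_cong) auto
    then show False using nz by simp
  qed
  then obtain y where y: "cube_char L q k (x - y) \<noteq> 0" "scaled_mollifier L \<eta> q y \<noteq> 0"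
    by auto
  let ?n' = "grid_index L q (x - y)"
  have kn': "k $ i = ?n' $ i mod 2 ^ q" for i
    using y(1) cube_char_eq[OF L k, of "x - y"] by (simp add: vec_eq_iff of_bool_def split: if_splits)
  define v where "v = ?n' - ?n"
  have v: "\<bar>v $ i\<bar> \<le> 1" for i
  proof -
    have "norm y \<le> ell L q"
      using y(2) scaled_mollifier(3)[OF L \<eta>] by (meson linorder_not_le)
    then have "\<bar>y $ i\<bar> \<le> ell L q" using component_le_norm_cart[of y i] by linarith
    then have "\<bar>y $ i / ell L q\<bar> \<le> 1" using ell_pos[OF L, of q] by (simp add: field_simps)
    moreover have "(x - y) $ i / ell L q = x $ i / ell L q - y $ i / ell L q"
      by (simp add: diff_divide_distrib)
    ultimately show ?thesis
      unfolding v_def grid_index_def vector_minus_component vec_lambda_beta by linarith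
  qed
  show "k \<in> (\<lambda>v. \<chi> i. (?n $ i + v $ i) mod 2 ^ q) ` near_indices"
  proof (rule image_eqI)
    show "v \<in> near_indices" using v by (auto simp: near_indices_def abs_le_iff minus_le_iff)
    show "k = (\<chi> i. (?n $ i + v $ i) mod 2 ^ q)" by (simp add: vec_eq_iff kn' v_def)
  qed
  have n: "?n \<in> cube_index q"
  proof -
    have "0 \<le> x $ i / ell L q \<and> x $ i / ell L q < 2 ^ q" for i
      using x L ell_pos[OF L, of q] by (auto simp: cell_def ell_def field_simps)
    then show ?thesis
      unfolding cube_index_def grid_index_def by (simp add: le_floor_iff floor_less_iff)
  qed
  define m :: "int^3" where "m = (\<chi> i. - (?n' $ i div 2 ^ q))"
  have eq: "?n $ i - k $ i + 2 ^ q * m $ i = - v $ i" for i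
    unfolding kn' m_def v_def using minus_mult_div_eq_mod[of "?n' $ i" "2 ^ q"] by (simp add: algebra_simps)
  let ?w = "(\<chi> i. real_of_int (?n $ i - k $ i + 2 ^ q * m $ i)) :: real^3"
  have "(norm ?w)\<^sup>2 = (\<Sum>i\<in>UNIV. (real_of_int (v $ i))\<^sup>2)"
    unfolding power2_norm_eq_inner inner_vec_def by (simp add: eq power2_eq_square)
  also have "\<dots> \<le> (\<Sum>i\<in>(UNIV :: 3 set). 1)"
  proof (rule sum_mono)
    show "(real_of_int (v $ i))\<^sup>2 \<le> 1" for i
      using v[of i] by (simp add: abs_square_le_1 flip: of_int_abs)
  qed
  also have "\<dots> < 3\<^sup>2" by simp
  finally have "norm ?w < 3" by (rule power_less_imp_less_base) simp
  then have "\<exists>m :: int^3. norm ((\<chi> i. real_of_int (?n $ i - k $ i + 2 ^ q * m $ i)) :: real^3) < 3"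
    by blast
  then show "x \<in> cube_star L q k"
    unfolding cube_star_def using n mem_cube_iff[OF L, of x q ?n] by blast
qed

lemma finite_near_indices: "finite near_indices"
  unfolding near_indices_def by (rule finite_vectors) simp

lemma card_overlapping_cutoffs:
  assumes L: "L > 0" and \<eta>: "mollifier \<eta>" and x: "x \<in> cell L"
  shows "card {k \<in> cube_index q. cube_cutoff L \<eta> q k x \<noteq> 0} \<le> card near_indices"
  by (rule surj_card_le[OF finite_near_indices, of _ "\<lambda>v. \<chi> i. (grid_index L q x $ i + v $ i) mod 2 ^ q"])
     (use cube_cutoff_support(2)[OF L \<eta> _ x] in blast)

lemma cube_star_borel: "L > 0 \<Longrightarrow> cube_star L q k \<in> sets borel"
  unfolding cube_star_def
  by (intro sets.finite_UN finite_subset[OF _ finite_cube_index[of q]] cube_borel) auto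

section \<open>Littlewood-Paley pieces as trigonometric polynomials\<close>

text \<open>For \<open>r \<ge> 0\<close> the symbol lives where \<open>L / 2 powi r * norm k < 2\<close>. The low-frequency symbol, \<open>r = -1\<close>, lives
where \<open>L * norm k < 1\<close>, which is the same formula.\<close>

definition lp_modes :: "real \<Rightarrow> int \<Rightarrow> (real^3) set" where
  "lp_modes L r = {k \<in> lattice L. norm k \<le> 2 * 2 powi r / L}"

definition lp_coeff :: "real \<Rightarrow> (real^3 \<Rightarrow> real) \<Rightarrow> int \<Rightarrow> (real^3 \<Rightarrow> real^3) \<Rightarrow> real^3 \<Rightarrow> complex^3" where
  "lp_coeff L \<kappa> r g k = (\<chi> j. complex_of_real (lp_symbol L \<kappa> r k) * fourier_coeff L g k $ j)"

lemma finite_lp_modes: "L > 0 \<Longrightarrow> finite (lp_modes L r)"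
  unfolding lp_modes_def by (rule finite_lattice_ball)

lemma lp_symbol_support:
  assumes L: "L > 0" and \<kappa>: "lp_cutoff \<kappa>" and nz: "lp_symbol L \<kappa> r \<xi> \<noteq> 0"
  shows "norm \<xi> \<le> 2 * 2 powi r / L"
proof -
  have supp: "\<kappa> \<zeta> \<noteq> 0 \<Longrightarrow> norm \<zeta> < 1" for \<zeta>
  proof -
    assume "\<kappa> \<zeta> \<noteq> 0"
    then have "\<zeta> \<in> closure {\<xi>. \<kappa> \<xi> \<noteq> 0}" by (intro subsetD[OF closure_subset]) simp
    also have "\<dots> \<subseteq> ball 0 1" using \<kappa> unfolding lp_cutoff_def by blast
    finally show "norm \<zeta> < 1" by simp
  qed
  define \<zeta> where "\<zeta> = (L / 2 powi r) *\<^sub>R \<xi>"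
  have p: "(0::real) < 2 powi r" by simp
  have "norm \<zeta> < 2"
  proof (cases "r = -1")
    case True
    then have "\<kappa> (L *\<^sub>R \<xi>) \<noteq> 0" using nz by (simp add: lp_symbol_def)
    from supp[OF this] show ?thesis
      using L True by (simp add: \<zeta>_def)
  next
    case False
    then have "\<kappa> ((1/2) *\<^sub>R \<zeta>) \<noteq> 0 \<or> \<kappa> \<zeta> \<noteq> 0"
      using nz unfolding lp_symbol_def Let_def \<zeta>_def[symmetric] by (cases "\<kappa> \<zeta> = 0") auto
    then show ?thesis using supp[of \<zeta>] supp[of "(1/2) *\<^sub>R \<zeta>"] by (elim disjE) simp_all
  qed
  then have "L / 2 powi r * norm \<xi> < 2"
    using L p by (simp add: \<zeta>_def)
  then show ?thesis using L p by (simp add: field_simps)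
qed

lemma lp_trig_poly:
  assumes L: "L > 0" and \<kappa>: "lp_cutoff \<kappa>"
  shows "lp L \<kappa> r g = trig_poly (lp_modes L r) (lp_coeff L \<kappa> r g)"
proof
  fix x
  have "(\<Sum>\<^sub>\<infinity>k\<in>lattice L. complex_of_real (lp_symbol L \<kappa> r k) * fourier_coeff L g k $ j * cis (2 * pi * (k \<bullet> x)))
      = (\<Sum>k\<in>lp_modes L r. lp_coeff L \<kappa> r g k $ j * cis (2 * pi * (k \<bullet> x)))" for j
  proof -
    have "(\<Sum>\<^sub>\<infinity>k\<in>lattice L. complex_of_real (lp_symbol L \<kappa> r k) * fourier_coeff L g k $ j * cis (2 * pi * (k \<bullet> x)))
      = (\<Sum>\<^sub>\<infinity>k\<in>lp_modes L r. lp_coeff L \<kappa> r g k $ j * cis (2 * pi * (k \<bullet> x)))"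
    proof (rule infsum_cong_neutral)
      fix k assume "k \<in> lattice L - lp_modes L r"
      then have "lp_symbol L \<kappa> r k = 0"
        using lp_symbol_support[OF L \<kappa>, of r k] by (auto simp: lp_modes_def)
      then show "complex_of_real (lp_symbol L \<kappa> r k) * fourier_coeff L g k $ j * cis (2 * pi * (k \<bullet> x)) = 0"
        by simp
    next
      fix k assume "k \<in> lattice L \<inter> lp_modes L r"
      show "complex_of_real (lp_symbol L \<kappa> r k) * fourier_coeff L g k $ j * cis (2 * pi * (k \<bullet> x))
          = lp_coeff L \<kappa> r g k $ j * cis (2 * pi * (k \<bullet> x))"
        by (simp add: lp_coeff_def)
    qed (auto simp: lp_modes_def)
    then show ?thesis by (simp add: finite_lp_modes[OF L])
  qed
  then show "lp L \<kappa> r g x = trig_poly (lp_modes L r) (lp_coeff L \<kappa> r g) x"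
    by (simp add: lp_def trig_poly_def)
qed

text \<open>This is what weak continuity provides for the pieces. Imposing it at all real times makes every piece
jointly continuous on the whole of space-time; a curve on \<open>[0, T]\<close> is brought into this form by
freezing it at its endpoint values.\<close>

definition continuous_spectrum :: "real \<Rightarrow> (real \<Rightarrow> real^3 \<Rightarrow> real^3) \<Rightarrow> bool" where
  "continuous_spectrum L u \<longleftrightarrow>
     (\<forall>k\<in>lattice L. \<forall>j. continuous_on UNIV (\<lambda>t. fourier_coeff L (u t) k $ j))"

lemma character_in_torus_L2:
  assumes L: "L > 0" and k: "k \<in> lattice L"
    and f: "f = (\<lambda>x. cos (2 * pi * (k \<bullet> x)) *\<^sub>R axis j 1) \<or> f = (\<lambda>x. sin (2 * pi * (k \<bullet> x)) *\<^sub>R axis j (1::real))"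
  shows "f \<in> torus_L2 L"
proof -
  have "cis (2 * pi * (k \<bullet> (x + axis i L))) = cis (2 * pi * (k \<bullet> x))" for x i
  proof -
    obtain n :: int where "k $ i = n / L" using k by (auto simp: lattice_def)
    then have "k \<bullet> axis i L = n" using L by (simp add: inner_axis)
    then have "cis (2 * pi * (k \<bullet> axis i L)) = 1" by (simp add: cis_multiple_2pi)
    then show ?thesis unfolding inner_add_right ring_distribs cis_mult[symmetric] by simp
  qed
  then have "periodic L f"
    using f by (auto simp: periodic_def complex_eq_iff)
  moreover have c: "continuous_on UNIV f"
    using f by (auto intro!: continuous_intros)
  then have "f \<in> borel_measurable lebesgue"
    by (intro measurable_completion) (simp add: borel_measurable_continuous_onI)
  moreover have "set_integrable lebesgue (cell L) (\<lambda>x. (norm (f x))\<^sup>2)"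
  proof -
    have c2: "continuous_on UNIV (\<lambda>x. (norm (f x))\<^sup>2)" by (intro continuous_intros c)
    then have "(\<lambda>x. indicat_real (cell L) x *\<^sub>R (norm (f x))\<^sup>2) \<in> borel_measurable lborel"
      by (intro borel_measurable_scaleR borel_measurable_indicator) (auto intro: borel_measurable_continuous_onI)
    then show ?thesis
      using set_integrable_cell[OF c2, of L] unfolding set_integrable_def
      by (simp add: integrable_completion)
  qed
  ultimately show ?thesis by (simp add: torus_L2_def)
qed

lemma fourier_coeff_real_imag:
  assumes g: "g \<in> torus_L2 L"
  shows "Re (fourier_coeff L g k $ j)
      = 1 / L ^ 3 * (LINT x:cell L|lebesgue. g x \<bullet> (cos (2 * pi * (k \<bullet> x)) *\<^sub>R axis j 1))"
    and "Im (fourier_coeff L g k $ j)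
      = - 1 / L ^ 3 * (LINT x:cell L|lebesgue. g x \<bullet> (sin (2 * pi * (k \<bullet> x)) *\<^sub>R axis j 1))"
proof -
  let ?f = "\<lambda>x. indicat_real (cell L) x *\<^sub>R (complex_of_real (g x $ j) * cis (- 2 * pi * (k \<bullet> x)))"
  have gm[measurable]: "g \<in> borel_measurable lebesgue"
    and g2: "integrable lebesgue (\<lambda>x. indicat_real (cell L) x *\<^sub>R (norm (g x))\<^sup>2)"
    using g by (auto simp: torus_L2_def set_integrable_def)
  have cm[measurable]: "cell L \<in> sets lebesgue" by (simp add: sets_completionI_sets)
  have [measurable]: "(\<lambda>x. cis (- 2 * pi * (k \<bullet> x))) \<in> borel_measurable lebesgue"
    by (intro measurable_completion) (simp, intro borel_measurable_continuous_onI continuous_intros)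
  have gj: "(\<lambda>x. g x $ j) \<in> borel_measurable lebesgue"
    using gm by (rule borel_measurable_continuous_on[OF continuous_on_component, OF continuous_on_id])
  have 1: "integrable lebesgue (\<lambda>x. indicat_real (cell L) x *\<^sub>R (1::real))"
    using emeasure_cell_finite[of L] by (simp add: integrable_indicator_iff)
  have int: "integrable lebesgue ?f"
  proof (rule Bochner_Integration.integrable_bound[OF Bochner_Integration.integrable_add[OF 1 g2]])
    show "?f \<in> borel_measurable lebesgue"
      using gj by measurable
    show "AE x in lebesgue. norm (?f x)
        \<le> norm (indicat_real (cell L) x *\<^sub>R 1 + indicat_real (cell L) x *\<^sub>R (norm (g x))\<^sup>2)"
    proof (rule AE_I2)
      fix x
      have "\<bar>g x $ j\<bar> \<le> norm (g x)" by (rule component_le_norm_cart)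
      also have "norm (g x) \<le> 1 + (norm (g x))\<^sup>2"
        using sum_squares_bound[of 1 "norm (g x)"] by (simp add: power2_eq_square) (smt (verit) norm_ge_zero)
      finally show "norm (?f x) \<le> norm (indicat_real (cell L) x *\<^sub>R 1 + indicat_real (cell L) x *\<^sub>R (norm (g x))\<^sup>2)"
        by (auto simp: indicator_def norm_mult)
    qed
  qed
  have "Re (fourier_coeff L g k $ j) = 1 / L ^ 3 * Re (\<integral>x. ?f x \<partial>lebesgue)"
    "Im (fourier_coeff L g k $ j) = 1 / L ^ 3 * Im (\<integral>x. ?f x \<partial>lebesgue)"
    by (simp_all add: fourier_coeff_def set_lebesgue_integral_def)
  moreover have "Re (\<integral>x. ?f x \<partial>lebesgue) = (\<integral>x. Re (?f x) \<partial>lebesgue)"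
    "Im (\<integral>x. ?f x \<partial>lebesgue) = (\<integral>x. Im (?f x) \<partial>lebesgue)"
    by (rule integral_bounded_linear[OF bounded_linear_Re int, symmetric]
        integral_bounded_linear[OF bounded_linear_Im int, symmetric])+
  ultimately have re: "Re (fourier_coeff L g k $ j) = 1 / L ^ 3 * (\<integral>x. Re (?f x) \<partial>lebesgue)"
    and im: "Im (fourier_coeff L g k $ j) = 1 / L ^ 3 * (\<integral>x. Im (?f x) \<partial>lebesgue)"
    by simp_all
  have re_f: "Re (?f x) = indicat_real (cell L) x *\<^sub>R (g x \<bullet> (cos (2 * pi * (k \<bullet> x)) *\<^sub>R axis j 1))"
    and im_f: "Im (?f x) = - (indicat_real (cell L) x *\<^sub>R (g x \<bullet> (sin (2 * pi * (k \<bullet> x)) *\<^sub>R axis j 1)))" for x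
    by (simp_all add: inner_axis)
  show "Re (fourier_coeff L g k $ j)
      = 1 / L ^ 3 * (LINT x:cell L|lebesgue. g x \<bullet> (cos (2 * pi * (k \<bullet> x)) *\<^sub>R axis j 1))"
    unfolding re re_f set_lebesgue_integral_def ..
  show "Im (fourier_coeff L g k $ j)
      = - 1 / L ^ 3 * (LINT x:cell L|lebesgue. g x \<bullet> (sin (2 * pi * (k \<bullet> x)) *\<^sub>R axis j 1))"
    unfolding im im_f set_lebesgue_integral_def integral_minus by simp
qed

text \<open>The real and imaginary parts of a Fourier coefficient are pairings with cosines and sines of lattice
frequencies, which are admissible test functions for weak continuity.\<close>

lemma continuous_spectrum_clamp:
  assumes L: "L > 0" and T: "T > 0" and u: "weakly_continuous_L2 L T u"
  shows "continuous_spectrum L (\<lambda>t. u (max 0 (min T t)))"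
  unfolding continuous_spectrum_def
proof (intro ballI allI)
  fix k :: "real^3" and j :: 3 assume k: "k \<in> lattice L"
  let ?P = "\<lambda>t f. LINT x:cell L|lebesgue. u t x \<bullet> f x"
  have c: "continuous_on {0..T} (\<lambda>t. ?P t f)" if "f \<in> torus_L2 L" for f
    using u that unfolding weakly_continuous_L2_def by blast
  let ?c = "\<lambda>x. cos (2 * pi * (k \<bullet> x)) *\<^sub>R (axis j 1 :: real^3)"
    and ?s = "\<lambda>x. sin (2 * pi * (k \<bullet> x)) *\<^sub>R (axis j 1 :: real^3)"
  have "?c \<in> torus_L2 L" "?s \<in> torus_L2 L"
    by (rule character_in_torus_L2[OF L k disjI1[OF refl]], rule character_in_torus_L2[OF L k disjI2[OF refl]])
  from c[OF this(1)] c[OF this(2)]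
  have "continuous_on {0..T} (\<lambda>t. Complex (1 / L ^ 3 * ?P t ?c) (- 1 / L ^ 3 * ?P t ?s))"
    by (rule continuous_on_Complex[OF continuous_on_mult_left continuous_on_mult_left])
  moreover have "Complex (1 / L ^ 3 * ?P t ?c) (- 1 / L ^ 3 * ?P t ?s) = fourier_coeff L (u t) k $ j"
    if "t \<in> {0..T}" for t
  proof -
    have ut: "u t \<in> torus_L2 L" using u that unfolding weakly_continuous_L2_def by blast
    show ?thesis
      by (rule complex_eqI)
         (simp_all only: complex.sel fourier_coeff_real_imag[OF ut, of k j])
  qed
  ultimately have "continuous_on {0..T} (\<lambda>t. fourier_coeff L (u t) k $ j)"
    by (rule continuous_on_eq)
  then show "continuous_on UNIV (\<lambda>t. fourier_coeff L (u (max 0 (min T t))) k $ j)"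
  proof (rule continuous_on_compose2[of _ "\<lambda>t. fourier_coeff L (u t) k $ j"])
    show "continuous_on UNIV (\<lambda>t. max 0 (min T t))" by (intro continuous_intros)
    show "(\<lambda>t. max 0 (min T t)) ` UNIV \<subseteq> {0..T}" using T by auto
  qed
qed

lemma continuous_trig_poly:
  assumes "\<And>k j. k \<in> S \<Longrightarrow> continuous_on UNIV (\<lambda>t. c t k $ j)"
  shows "continuous_on UNIV (\<lambda>z::real \<times> _. trig_poly S (c (fst z)) (snd z))"
  unfolding trig_poly_def
  by (intro continuous_intros continuous_on_compose2[OF assms]) auto

lemma continuous_lp:
  assumes L: "L > 0" and \<kappa>: "lp_cutoff \<kappa>" and u: "continuous_spectrum L u"
  shows "continuous_on UNIV (\<lambda>z. lp L \<kappa> r (u (fst z)) (snd z))"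
    and "continuous_on UNIV (\<lambda>z. pdiff v (lp L \<kappa> r (u (fst z))) (snd z))"
proof -
  have c: "continuous_on UNIV (\<lambda>t. fourier_coeff L (u t) k $ j)" if "k \<in> lp_modes L r" for k j
    using u that by (auto simp: continuous_spectrum_def lp_modes_def)
  show "continuous_on UNIV (\<lambda>z. lp L \<kappa> r (u (fst z)) (snd z))"
    unfolding lp_trig_poly[OF L \<kappa>]
    by (rule continuous_trig_poly) (auto simp: lp_coeff_def intro!: continuous_intros c)
  show "continuous_on UNIV (\<lambda>z. pdiff v (lp L \<kappa> r (u (fst z))) (snd z))"
    unfolding lp_trig_poly[OF L \<kappa>] pdiff_trig_poly
    by (rule continuous_trig_poly) (auto simp: lp_coeff_def intro!: continuous_intros c)
qed

section \<open>Space-time means\<close>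

text \<open>With values in \<open>ennreal\<close> already at the level of integrands, means commute with infinite sums.\<close>

definition mean :: "real \<Rightarrow> real \<Rightarrow> (real \<times> (real^3) \<Rightarrow> ennreal) \<Rightarrow> ennreal" where
  "mean L T F = (\<integral>\<^sup>+z\<in>Omega L T. F z \<partial>lebesgue) / ennreal (T * L ^ 3)"

lemma avg_eq_mean: "avg L T F = mean L T (\<lambda>z. ennreal (F z))"
  by (simp add: avg_def mean_def)

lemma Omega_borel: "Omega L T \<in> sets borel"
  unfolding Omega_def by (intro borel_Times cell_borel) auto

lemma Omega_lebesgue [measurable]: "Omega L T \<in> sets lebesgue"
  using Omega_borel by (simp add: sets_completionI_sets)

lemma mean_mono:
  "(\<And>z. z \<in> Omega L T \<Longrightarrow> F z \<le> G z) \<Longrightarrow> mean L T F \<le> mean L T G"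
  unfolding mean_def
  by (intro divide_right_mono_ennreal nn_integral_mono) (auto simp: indicator_def)

lemma mean_cmult:
  assumes [measurable]: "F \<in> borel_measurable lebesgue"
  shows "mean L T (\<lambda>z. c * F z) = c * mean L T F"
  unfolding mean_def by (simp add: mult.assoc nn_integral_cmult ennreal_times_divide)

lemma mean_add:
  assumes [measurable]: "F \<in> borel_measurable lebesgue" "G \<in> borel_measurable lebesgue"
  shows "mean L T (\<lambda>z. F z + G z) = mean L T F + mean L T G"
  unfolding mean_def by (simp add: distrib_right nn_integral_add add_divide_distrib_ennreal)

lemma mean_sum:
  assumes "\<And>i. i \<in> I \<Longrightarrow> F i \<in> borel_measurable lebesgue"
  shows "mean L T (\<lambda>z. \<Sum>i\<in>I. F i z) = (\<Sum>i\<in>I. mean L T (F i))"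
  using assms
proof (induction I rule: infinite_finite_induct)
  case (insert i I)
  then show ?case by (simp add: mean_add)
qed (simp_all add: mean_def)

lemma mean_suminf:
  assumes [measurable]: "\<And>n::nat. F n \<in> borel_measurable lebesgue"
  shows "mean L T (\<lambda>z. \<Sum>n. F n z) = (\<Sum>n. mean L T (F n))"
  unfolding mean_def divide_ennreal_def
  by (simp add: nn_integral_suminf flip: ennreal_suminf_multc)

lemma continuous_lebesgue_measurable:
  fixes f :: "'a::euclidean_space \<Rightarrow> 'b::topological_space"
  assumes "continuous_on UNIV f"
  shows "f \<in> borel_measurable lebesgue"
  by (rule measurable_completion) (simp add: borel_measurable_continuous_onI assms)

lemma continuous_bounded_on_Omega:
  fixes f :: "real \<times> (real^3) \<Rightarrow> real"
  assumes "continuous_on UNIV f"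
  obtains B where "B \<ge> 0" "\<And>z. z \<in> Omega L T \<Longrightarrow> \<bar>f z\<bar> \<le> B"
proof -
  have "compact (f ` ({0..T} \<times> cbox 0 (\<chi> i. L)))"
    by (intro compact_continuous_image compact_Times continuous_on_subset[OF assms]) auto
  then obtain B where B: "\<And>z. z \<in> {0..T} \<times> cbox 0 (\<chi> i. L) \<Longrightarrow> norm (f z) \<le> B"
    using compact_imp_bounded[of "f ` ({0..T} \<times> cbox 0 (\<chi> i. L))"] unfolding bounded_iff by blast
  show thesis
  proof (rule that[of "max 0 B"])
    fix z assume "z \<in> Omega L T"
    then have "z \<in> {0..T} \<times> cbox 0 (\<chi> i. L)"
      by (auto simp: Omega_def cell_def mem_box_cart less_eq_real_def)
    from B[OF this] show "\<bar>f z\<bar> \<le> max 0 B" by simp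
  qed simp
qed

lemma mean_finite:
  assumes L: "L > 0" "T > 0" and f: "continuous_on UNIV f"
  shows "mean L T (\<lambda>z. ennreal (f z)) < \<infinity>"
proof -
  obtain B where B: "B \<ge> 0" "\<And>z. z \<in> Omega L T \<Longrightarrow> \<bar>f z\<bar> \<le> B"
    by (rule continuous_bounded_on_Omega[OF f, of L T]) blast
  have "mean L T (\<lambda>z. ennreal (f z)) \<le> mean L T (\<lambda>z. ennreal B)"
  proof (rule mean_mono)
    fix z assume "z \<in> Omega L T"
    from B(2)[OF this] show "ennreal (f z) \<le> ennreal B" by (intro ennreal_leI) linarith
  qed
  also have "\<dots> = ennreal B * emeasure lborel (Omega L T) / ennreal (T * L ^ 3)"
    using Omega_borel by (simp add: mean_def nn_integral_cmult_indicator)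
  also have "\<dots> < \<infinity>"
  proof -
    have "bounded (Omega L T)"
      unfolding Omega_def by (intro bounded_Times bounded_cell) auto
    then have "emeasure lborel (Omega L T) < \<infinity>" by (rule emeasure_bounded_finite)
    then have "ennreal B * emeasure lborel (Omega L T) < \<infinity>"
      by (simp add: ennreal_mult_less_top)
    moreover have "ennreal (T * L ^ 3) \<noteq> 0" using L by simp
    ultimately show ?thesis
      by (metis ennreal_divide_eq_top_iff infinity_ennreal_def less_irrefl less_top)
  qed
  finally show ?thesis .
qed

text \<open>Tonelli's theorem, used to pass from the cell to space-time.\<close>

lemma mean_le_by_slices:
  assumes F: "continuous_on UNIV F" and G: "continuous_on UNIV G"
    and le: "\<And>t. (\<integral>\<^sup>+x\<in>cell L. ennreal (F (t, x)) \<partial>lborel) \<le> (\<integral>\<^sup>+x\<in>cell L. ennreal (G (t, x)) \<partial>lborel)"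
  shows "mean L T (\<lambda>z. ennreal (F z)) \<le> mean L T (\<lambda>z. ennreal (G z))"
proof -
  have fubini: "(\<integral>\<^sup>+z\<in>Omega L T. ennreal (H z) \<partial>lebesgue)
      = (\<integral>\<^sup>+t\<in>{0..T}. (\<integral>\<^sup>+x\<in>cell L. ennreal (H (t, x)) \<partial>lborel) \<partial>lborel)"
    if H: "continuous_on UNIV H" for H :: "real \<times> (real^3) \<Rightarrow> real"
  proof -
    have Hm: "H \<in> borel_measurable borel" by (rule borel_measurable_continuous_onI[OF H])
    have m: "(\<lambda>z. ennreal (H z) * indicator (Omega L T) z) \<in> borel_measurable (lborel \<Otimes>\<^sub>M lborel)"
      unfolding lborel_prod using Hm Omega_borel by simp
    have "(\<integral>\<^sup>+z\<in>Omega L T. ennreal (H z) \<partial>lebesgue)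
        = (\<integral>\<^sup>+z. ennreal (H z) * indicator (Omega L T) z \<partial>(lborel \<Otimes>\<^sub>M lborel))"
      unfolding lborel_prod by (rule nn_integral_completion)
    also have "\<dots> = (\<integral>\<^sup>+t. \<integral>\<^sup>+x. ennreal (H (t, x)) * indicator (Omega L T) (t, x) \<partial>lborel \<partial>lborel)"
      by (rule lborel.nn_integral_fst[OF m, symmetric])
    also have "\<dots> = (\<integral>\<^sup>+t\<in>{0..T}. (\<integral>\<^sup>+x\<in>cell L. ennreal (H (t, x)) \<partial>lborel) \<partial>lborel)"
      by (intro nn_integral_cong) (auto simp: Omega_def indicator_def)
    finally show ?thesis .
  qed
  show ?thesis
    unfolding mean_def fubini[OF F] fubini[OF G]
    by (intro divide_right_mono_ennreal nn_integral_mono mult_right_mono le) auto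
qed

section \<open>Size of a piece and of its gradient\<close>

definition speed ::
    "real \<Rightarrow> (real^3 \<Rightarrow> real) \<Rightarrow> (real \<Rightarrow> real^3 \<Rightarrow> real^3) \<Rightarrow> int \<Rightarrow> real \<times> (real^3) \<Rightarrow> real" where
  "speed L \<kappa> u r z = norm (lp L \<kappa> r (u (fst z)) (snd z))"

definition grad_size ::
    "real \<Rightarrow> (real^3 \<Rightarrow> real) \<Rightarrow> (real \<Rightarrow> real^3 \<Rightarrow> real^3) \<Rightarrow> int \<Rightarrow> real \<times> (real^3) \<Rightarrow> real" where
  "grad_size L \<kappa> u r z = (\<Sum>i\<in>UNIV. norm (pdiff (axis i 1) (lp L \<kappa> r (u (fst z))) (snd z)))"

lemma speed_nonneg: "0 \<le> speed L \<kappa> u r z"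
  by (simp add: speed_def)

lemma grad_size_nonneg: "0 \<le> grad_size L \<kappa> u r z"
  by (simp add: grad_size_def sum_nonneg)

lemma continuous_speed:
  assumes "L > 0" "lp_cutoff \<kappa>" "continuous_spectrum L u"
  shows "continuous_on UNIV (speed L \<kappa> u r)" "continuous_on UNIV (grad_size L \<kappa> u r)"
  unfolding speed_def[abs_def] grad_size_def[abs_def]
  by (intro continuous_intros continuous_lp assms)+

lemma lp_moment_eq_mean: "lp_moment L T \<kappa> u q n = mean L T (\<lambda>z. ennreal (speed L \<kappa> u (int q) z ^ n))"
  by (simp add: lp_moment_def avg_eq_mean speed_def case_prod_beta)

lemma abs_tensor_grad_le:
  "\<bar>tensor_grad a b v x\<bar> \<le> norm a * norm b * (\<Sum>i\<in>UNIV. norm (pdiff (axis i 1) v x))"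
proof -
  have "tensor_grad a b v x = (\<Sum>i\<in>UNIV. a $ i * (b \<bullet> pdiff (axis i 1) v x))"
    by (simp add: tensor_grad_def inner_vec_def sum_distrib_left mult.assoc)
  also have "\<bar>\<dots>\<bar> \<le> (\<Sum>i\<in>UNIV. norm a * (norm b * norm (pdiff (axis i 1) v x)))"
    unfolding real_norm_def[symmetric]
  proof (rule sum_norm_le)
    fix i
    show "norm (a $ i * (b \<bullet> pdiff (axis i 1) v x)) \<le> norm a * (norm b * norm (pdiff (axis i 1) v x))"
      unfolding norm_mult
      by (intro mult_mono) (simp_all add: component_le_norm_cart Cauchy_Schwarz_ineq2)
  qed
  finally show ?thesis by (simp add: sum_distrib_left mult.assoc)
qed

text \<open>Parseval is applied on the whole torus at each time. The factor \<open>9\<close> comes from the three directional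
derivatives, once through Cauchy-Schwarz and once through their sum.\<close>

lemma bernstein_mean:
  assumes L: "L > 0" and \<kappa>: "lp_cutoff \<kappa>" and u: "continuous_spectrum L u"
  shows "mean L T (\<lambda>z. ennreal ((grad_size L \<kappa> u r z)\<^sup>2))
    \<le> ennreal (9 * (2 * pi * (2 * 2 powi r / L))\<^sup>2) * mean L T (\<lambda>z. ennreal ((speed L \<kappa> u r z)\<^sup>2))"
proof -
  let ?B = "(2 * pi * (2 * 2 powi r / L))\<^sup>2"
  let ?v = "\<lambda>t. lp L \<kappa> r (u t)"
  let ?D = "\<lambda>i z. (norm (pdiff (axis i 1) (?v (fst z)) (snd z)))\<^sup>2"
  have [measurable]: "(\<lambda>z. ennreal (?D i z)) \<in> borel_measurable lebesgue" for i
    by (intro measurable_compose[OF _ measurable_ennreal] continuous_lebesgue_measurable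
        continuous_intros continuous_lp L \<kappa> u)
  have sm: "(\<lambda>z. ennreal ((speed L \<kappa> u r z)\<^sup>2)) \<in> borel_measurable lebesgue"
    by (intro measurable_compose[OF _ measurable_ennreal] continuous_lebesgue_measurable
        continuous_intros continuous_speed L \<kappa> u)
  have slice: "mean L T (\<lambda>z. ennreal (?D i z)) \<le> mean L T (\<lambda>z. ennreal (?B * (speed L \<kappa> u r z)\<^sup>2))" for i
  proof (rule mean_le_by_slices)
    fix t
    have cv: "continuous_on UNIV (?v t)"
      unfolding lp_trig_poly[OF L \<kappa>]
      by (intro continuous_at_imp_continuous_on ballI differentiable_imp_continuous_within
          bounded_smoothD(2)[OF bounded_smooth_trig_poly])
    have cp: "continuous_on UNIV (pdiff (axis i 1) (?v t))"
      unfolding lp_trig_poly[OF L \<kappa>] pdiff_trig_poly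
      by (intro continuous_at_imp_continuous_on ballI differentiable_imp_continuous_within
          bounded_smoothD(2)[OF bounded_smooth_trig_poly])
    have nn: "(\<integral>\<^sup>+x\<in>cell L. ennreal (h x) \<partial>lborel) = ennreal (LINT x:cell L|lborel. h x)"
      if "continuous_on UNIV h" "\<And>x. 0 \<le> h x" for h :: "real^3 \<Rightarrow> real"
    proof -
      have "(\<integral>\<^sup>+x\<in>cell L. ennreal (h x) \<partial>lborel) = (\<integral>\<^sup>+x. ennreal (indicator (cell L) x *\<^sub>R h x) \<partial>lborel)"
        by (intro nn_integral_cong) (auto simp: indicator_def)
      also have "\<dots> = ennreal (\<integral>x. indicator (cell L) x *\<^sub>R h x \<partial>lborel)"
        using set_integrable_cell[OF that(1), of L] that(2)
        by (intro nn_integral_eq_integral) (auto simp: set_integrable_def)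
      finally show ?thesis by (simp add: set_lebesgue_integral_def)
    qed
    have "(\<integral>\<^sup>+x\<in>cell L. ennreal ((norm (pdiff (axis i 1) (?v t) x))\<^sup>2) \<partial>lborel)
        = ennreal (LINT x:cell L|lborel. (norm (pdiff (axis i 1) (?v t) x))\<^sup>2)"
      by (intro nn continuous_intros cp) simp
    also have "\<dots> \<le> ennreal (?B * (LINT x:cell L|lborel. (norm (?v t x))\<^sup>2))"
      unfolding lp_trig_poly[OF L \<kappa>] lp_modes_def by (intro ennreal_leI bernstein_cell[OF L])
    also have "?B * (LINT x:cell L|lborel. (norm (?v t x))\<^sup>2)
        = (LINT x:cell L|lborel. ?B * (norm (?v t x))\<^sup>2)"
      by (rule set_integral_mult_right[symmetric])
    also have "ennreal \<dots> = (\<integral>\<^sup>+x\<in>cell L. ennreal (?B * (norm (?v t x))\<^sup>2) \<partial>lborel)"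
      by (intro nn[symmetric] continuous_intros cv) simp
    finally show "(\<integral>\<^sup>+x\<in>cell L. ennreal (?D i (t, x)) \<partial>lborel)
        \<le> (\<integral>\<^sup>+x\<in>cell L. ennreal (?B * (speed L \<kappa> u r (t, x))\<^sup>2) \<partial>lborel)"
      by (simp only: speed_def fst_conv snd_conv)
  qed (intro continuous_intros continuous_lp continuous_speed L \<kappa> u)+
  have "mean L T (\<lambda>z. ennreal ((grad_size L \<kappa> u r z)\<^sup>2)) \<le> mean L T (\<lambda>z. 3 * (\<Sum>i\<in>UNIV. ennreal (?D i z)))"
  proof (rule mean_mono)
    fix z
    have "(grad_size L \<kappa> u r z)\<^sup>2 = (\<Sum>i\<in>(UNIV :: 3 set). 1 * norm (pdiff (axis i 1) (?v (fst z)) (snd z)))\<^sup>2"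
      by (simp add: grad_size_def)
    also have "\<dots> \<le> (\<Sum>i\<in>(UNIV :: 3 set). 1\<^sup>2) * (\<Sum>i\<in>UNIV. ?D i z)"
      by (rule Cauchy_Schwarz_ineq_sum)
    finally have "ennreal ((grad_size L \<kappa> u r z)\<^sup>2) \<le> ennreal (3 * (\<Sum>i\<in>UNIV. ?D i z))"
      by (intro ennreal_leI) simp
    also have "\<dots> = 3 * (\<Sum>i\<in>UNIV. ennreal (?D i z))"
      by (simp add: ennreal_mult' sum_nonneg)
    finally show "ennreal ((grad_size L \<kappa> u r z)\<^sup>2) \<le> 3 * (\<Sum>i\<in>UNIV. ennreal (?D i z))" .
  qed
  also have "\<dots> = 3 * (\<Sum>i\<in>UNIV. mean L T (\<lambda>z. ennreal (?D i z)))"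
    by (subst mean_cmult; (subst mean_sum)?; measurable)
  also have "\<dots> \<le> 3 * (\<Sum>i\<in>(UNIV :: 3 set). mean L T (\<lambda>z. ennreal (?B * (speed L \<kappa> u r z)\<^sup>2)))"
    by (intro mult_left_mono sum_mono slice) simp
  also have "\<dots> = 9 * mean L T (\<lambda>z. ennreal (?B * (speed L \<kappa> u r z)\<^sup>2))"
    by (simp add: mult.assoc[symmetric] flip: ennreal_numeral ennreal_of_nat_eq_real_of_nat ennreal_mult)
  also have "\<dots> = 9 * (ennreal ?B * mean L T (\<lambda>z. ennreal ((speed L \<kappa> u r z)\<^sup>2)))"
    by (subst mean_cmult[OF sm, symmetric]) (simp add: ennreal_mult)
  also have "\<dots> = ennreal (9 * ?B) * mean L T (\<lambda>z. ennreal ((speed L \<kappa> u r z)\<^sup>2))"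
    by (subst ennreal_mult) (simp_all add: mult.assoc)
  finally show ?thesis .
qed

section \<open>Atoms and active regions\<close>

lemma finite_multi_indices: "finite {\<beta> :: nat^3. (\<Sum>i\<in>UNIV. \<beta> $ i) \<le> M}"
proof (rule finite_subset)
  show "finite {\<beta> :: nat^3. \<forall>i. \<beta> $ i \<in> {0..M}}" by (rule finite_vectors) simp
  show "{\<beta> :: nat^3. (\<Sum>i\<in>UNIV. \<beta> $ i) \<le> M} \<subseteq> {\<beta>. \<forall>i. \<beta> $ i \<in> {0..M}}"
  proof safe
    fix \<beta> :: "nat^3" and i assume "(\<Sum>i\<in>UNIV. \<beta> $ i) \<le> M"
    moreover have "\<beta> $ i \<le> (\<Sum>i\<in>UNIV. \<beta> $ i)" by (rule member_le_sum) auto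
    ultimately show "\<beta> $ i \<in> {0..M}" by simp
  qed
qed

lemma bounded_smooth_piece:
  assumes "L > 0" "lp_cutoff \<kappa>" "mollifier \<eta>"
  shows "bounded_smooth (piece L \<kappa> \<eta> u q k t)"
proof -
  have "bounded_smooth (\<lambda>x. cube_cutoff L \<eta> q k x *\<^sub>R lp L \<kappa> (int q) (u t) x)"
    unfolding lp_trig_poly[OF assms(1,2)]
    by (intro bounded_smooth_scaleR bounded_smooth_cube_cutoff bounded_smooth_trig_poly assms)
  then show ?thesis by (simp add: piece_def[abs_def])
qed

lemma bdd_above_mdiff_piece:
  assumes "L > 0" "lp_cutoff \<kappa>" "mollifier \<eta>"
  shows "bdd_above (range (\<lambda>x. norm (mdiff \<beta> (piece L \<kappa> \<eta> u q k t) x)))"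
  using bounded_smoothD(1)[OF bounded_smooth_mdiff[OF bounded_smooth_piece[OF assms]]]
  by (simp add: bdd_above_norm image_image[symmetric] flip: image_image)

lemma norm_mdiff_piece_le:
  assumes L: "L > 0" and \<kappa>: "lp_cutoff \<kappa>" and \<eta>: "mollifier \<eta>" and \<beta>: "(\<Sum>i\<in>UNIV. \<beta> $ i) \<le> M"
  shows "norm (mdiff \<beta> (piece L \<kappa> \<eta> u q k t) x)
    \<le> lam L q ^ (\<Sum>i\<in>UNIV. \<beta> $ i) * atom_coeff L \<kappa> \<eta> M u q k t"
proof -
  have "norm (mdiff \<beta> (piece L \<kappa> \<eta> u q k t) x) \<le> (SUP x. norm (mdiff \<beta> (piece L \<kappa> \<eta> u q k t) x))"
    by (rule cSUP_upper[OF UNIV_I bdd_above_mdiff_piece[OF L \<kappa> \<eta>]])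
  moreover have "(SUP x. norm (mdiff \<beta> (piece L \<kappa> \<eta> u q k t) x)) / lam L q ^ (\<Sum>i\<in>UNIV. \<beta> $ i)
      \<le> atom_coeff L \<kappa> \<eta> M u q k t"
    unfolding atom_coeff_def
    by (rule Max_ge) (use \<beta> in \<open>auto intro: finite_multi_indices\<close>)
  ultimately show ?thesis
    using lam_pos[OF L, of q] by (simp add: field_simps)
qed

lemma norm_piece_le:
  assumes L: "L > 0" and \<kappa>: "lp_cutoff \<kappa>" and \<eta>: "mollifier \<eta>"
  shows "norm (piece L \<kappa> \<eta> u q k t x) \<le> atom_coeff L \<kappa> \<eta> M u q k t"
  using norm_mdiff_piece_le[OF L \<kappa> \<eta>, of 0 M u q k t x] by (simp add: mdiff_def)

lemma norm_pdiff_piece_le: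
  assumes L: "L > 0" and \<kappa>: "lp_cutoff \<kappa>" and \<eta>: "mollifier \<eta>" and M: "M \<ge> 1"
  shows "norm (pdiff (axis i 1) (piece L \<kappa> \<eta> u q k t) x) \<le> lam L q * atom_coeff L \<kappa> \<eta> M u q k t"
proof -
  have s: "(\<Sum>j\<in>UNIV. axis i 1 $ j) = (1::nat)"
    by (simp add: axis_def)
  have "mdiff (axis i (1::nat)) f = pdiff (axis i 1) f" for f :: "real^3 \<Rightarrow> real^3"
    using exhaust_3[of i] by (elim disjE) (simp_all add: mdiff_def axis_def)
  then have md: "mdiff (axis i (Suc 0)) f = pdiff (axis i 1) f" for f :: "real^3 \<Rightarrow> real^3"
    by simp
  show ?thesis
    using norm_mdiff_piece_le[OF L \<kappa> \<eta>, of "axis i 1" M u q k t x] M unfolding s by (simp add: md)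
qed

text \<open>A piece is the sum of its atoms, and at most as many of them as there are near indices are nonzero at \<open>x\<close>,
each with \<open>x\<close> in its starred cube. The same count applies to the first derivatives: a cutoff that
vanishes at \<open>x\<close> has a minimum there, so its gradient vanishes too.\<close>

lemma lp_bound_by_atoms:
  assumes L: "L > 0" and \<kappa>: "lp_cutoff \<kappa>" and \<eta>: "mollifier \<eta>" and M: "M \<ge> 1" and x: "x \<in> cell L"
    and R: "\<And>k. k \<in> cube_index q \<Longrightarrow> x \<in> cube_star L q k \<Longrightarrow> \<bar>atom_coeff L \<kappa> \<eta> M u q k t\<bar> \<le> R"
    and R0: "0 \<le> R"
  shows "speed L \<kappa> u (int q) (t, x) \<le> real (card near_indices) * R"
    and "grad_size L \<kappa> u (int q) (t, x) \<le> 3 * real (card near_indices) * lam L q * R"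
proof -
  let ?v = "lp L \<kappa> (int q) (u t)" and ?b = "\<lambda>k. piece L \<kappa> \<eta> u q k t"
  let ?K = "{k \<in> cube_index q. cube_cutoff L \<eta> q k x \<noteq> 0}"
  have v_sum: "?v = (\<lambda>y. \<Sum>k\<in>cube_index q. 1 *\<^sub>R ?b k y)"
    by (simp add: piece_def scaleR_sum_left[symmetric] sum_cube_cutoff[OF L \<eta>])
  have R': "atom_coeff L \<kappa> \<eta> M u q k t \<le> R" if "k \<in> ?K" for k
    using R[of k] cube_cutoff_support(1)[OF L \<eta> _ x] that by force
  have count: "real (card ?K) * c \<le> real (card near_indices) * c" if "0 \<le> c" for c
    using card_overlapping_cutoffs[OF L \<eta> x, of q] that by (intro mult_right_mono) auto
  have restrict: "norm (\<Sum>k\<in>cube_index q. F k) \<le> real (card near_indices) * c"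
    if "\<And>k. k \<in> ?K \<Longrightarrow> norm (F k) \<le> c" "\<And>k. k \<in> cube_index q - ?K \<Longrightarrow> F k = 0" "0 \<le> c"
    for F :: "int^3 \<Rightarrow> real^3" and c
  proof -
    have "(\<Sum>k\<in>cube_index q. F k) = (\<Sum>k\<in>?K. F k)"
      using that(2) by (intro sum.mono_neutral_right finite_cube_index) auto
    also have "norm \<dots> \<le> real (card ?K) * c"
      using that(1) by (rule sum_norm_bound)
    also have "\<dots> \<le> real (card near_indices) * c" by (rule count[OF that(3)])
    finally show ?thesis .
  qed
  have "norm (\<Sum>k\<in>cube_index q. ?b k x) \<le> real (card near_indices) * R"
  proof (rule restrict)
    show "norm (?b k x) \<le> R" if "k \<in> ?K" for k
      using norm_piece_le[OF L \<kappa> \<eta>, of u q k t x M] R'[OF that] by (rule order_trans)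
  qed (use R0 in \<open>auto simp: piece_def\<close>)
  then show "speed L \<kappa> u (int q) (t, x) \<le> real (card near_indices) * R"
    by (simp add: speed_def v_sum)
  have "norm (pdiff (axis i 1) ?v x) \<le> real (card near_indices) * (lam L q * R)" for i
  proof -
    have "pdiff (axis i 1) ?v x = (\<Sum>k\<in>cube_index q. 1 *\<^sub>R pdiff (axis i 1) (?b k) x)"
      unfolding v_sum by (rule pdiff_sum) (rule bounded_smoothD(2)[OF bounded_smooth_piece[OF L \<kappa> \<eta>]])
    also have "norm \<dots> \<le> real (card near_indices) * (lam L q * R)"
    proof (rule restrict)
      fix k assume k: "k \<in> ?K"
      show "norm (1 *\<^sub>R pdiff (axis i 1) (?b k) x) \<le> lam L q * R"
        using norm_pdiff_piece_le[OF L \<kappa> \<eta> M, of i u q k t x]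
          mult_left_mono[OF R'[OF k] less_imp_le[OF lam_pos[OF L, of q]]] by simp
    next
      fix k assume "k \<in> cube_index q - ?K"
      then have z: "cube_cutoff L \<eta> q k x = 0" by simp
      have d1: "cube_cutoff L \<eta> q k differentiable at x"
        by (rule bounded_smoothD(2)[OF bounded_smooth_cube_cutoff[OF L \<eta>]])
      have d2: "?v differentiable at x"
        unfolding lp_trig_poly[OF L \<kappa>] by (rule bounded_smoothD(2)[OF bounded_smooth_trig_poly])
      have "(\<lambda>v. pdiff v (cube_cutoff L \<eta> q k) x) = (\<lambda>v. 0)"
        by (rule differential_zero_maxmin[OF UNIV_I open_UNIV has_derivative_pdiff[OF d1]])
           (simp add: z cube_cutoff_nonneg[OF L \<eta>])
      then have "pdiff (axis i 1) (cube_cutoff L \<eta> q k) x = 0" by (rule fun_cong)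
      then have "pdiff (axis i 1) (\<lambda>x. cube_cutoff L \<eta> q k x *\<^sub>R ?v x) x = 0"
        by (simp add: pdiff_scaleR[OF d1 d2] z)
      then show "1 *\<^sub>R pdiff (axis i 1) (?b k) x = 0" by (simp add: piece_def[abs_def])
    qed (use R0 lam_pos[OF L, of q] in auto)
    finally show ?thesis .
  qed
  then have "(\<Sum>i\<in>UNIV. norm (pdiff (axis i 1) ?v x)) \<le> (\<Sum>i\<in>(UNIV :: 3 set). real (card near_indices) * (lam L q * R))"
    by (intro sum_mono)
  then show "grad_size L \<kappa> u (int q) (t, x) \<le> 3 * real (card near_indices) * lam L q * R"
    by (simp add: grad_size_def mult.assoc)
qed

text \<open>A maximum of suprema of continuous functions is lower semicontinuous. The functions in question are
derivatives of the atom at fixed points, linear in the time-dependent amplitudes.\<close>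

lemma open_atom_coeff_greater:
  assumes L: "L > 0" and \<kappa>: "lp_cutoff \<kappa>" and \<eta>: "mollifier \<eta>" and u: "continuous_spectrum L u"
  shows "open {t. c < atom_coeff L \<kappa> \<eta> M u q k t}"
proof -
  let ?B = "{\<beta> :: nat^3. (\<Sum>i\<in>UNIV. \<beta> $ i) \<le> M}"
  let ?d = "\<lambda>\<beta> :: nat^3. lam L q ^ (\<Sum>i\<in>UNIV. \<beta> $ i)"
  let ?N = "\<lambda>\<beta> t x. norm (mdiff \<beta> (piece L \<kappa> \<eta> u q k t) x)"
  let ?I = "lp_modes L (int q) \<times> (UNIV :: (3 \<times> bool) set)"
  let ?\<alpha> = "\<lambda>t. trig_amplitude (lp_coeff L \<kappa> (int q) (u t))"
  let ?P = "\<lambda>i x. cube_cutoff L \<eta> q k x *\<^sub>R trig_mode i x"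
  have piece_sum: "piece L \<kappa> \<eta> u q k t = (\<lambda>x. \<Sum>i\<in>?I. ?\<alpha> t i *\<^sub>R ?P i x)" for t
    by (simp add: fun_eq_iff piece_def lp_trig_poly[OF L \<kappa>] trig_poly_modes scaleR_sum_right mult.commute)
  have P: "bounded_smooth (?P i)" for i
    by (intro bounded_smooth_scaleR bounded_smooth_cube_cutoff bounded_smooth_trig_mode L \<eta>)
  have \<alpha>: "continuous_on UNIV (\<lambda>t. ?\<alpha> t i)" if "i \<in> ?I" for i
  proof -
    obtain k' j s where i: "i = (k', j, s)" by (cases i)
    have "continuous_on UNIV (\<lambda>t. fourier_coeff L (u t) k' $ j)"
      using u that unfolding i continuous_spectrum_def lp_modes_def by blast
    then show ?thesis
      unfolding i trig_amplitude_def prod.case lp_coeff_def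
      by (cases s) (auto intro!: continuous_intros)
  qed
  have cont: "continuous_on UNIV (\<lambda>t. ?N \<beta> t x)" for \<beta> x
    unfolding piece_sum mdiff_sum[OF P] by (intro continuous_intros \<alpha>)
  have "c < atom_coeff L \<kappa> \<eta> M u q k t \<longleftrightarrow> (\<exists>\<beta>\<in>?B. \<exists>x. c * ?d \<beta> < ?N \<beta> t x)" for t
  proof -
    have "0 \<in> ?B" by simp
    then have "?B \<noteq> {}" by blast
    then have "c < atom_coeff L \<kappa> \<eta> M u q k t \<longleftrightarrow> (\<exists>\<beta>\<in>?B. c < (SUP x. ?N \<beta> t x) / ?d \<beta>)"
      unfolding atom_coeff_def using finite_multi_indices[of M] by (subst Max_gr_iff) auto
    also have "\<dots> \<longleftrightarrow> (\<exists>\<beta>\<in>?B. c * ?d \<beta> < (SUP x. ?N \<beta> t x))"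
      using lam_pos[OF L, of q] by (simp add: pos_less_divide_eq)
    also have "\<dots> \<longleftrightarrow> (\<exists>\<beta>\<in>?B. \<exists>x. c * ?d \<beta> < ?N \<beta> t x)"
      by (subst less_cSUP_iff[OF _ bdd_above_mdiff_piece[OF L \<kappa> \<eta>]]) auto
    finally show ?thesis .
  qed
  then have "{t. c < atom_coeff L \<kappa> \<eta> M u q k t} = (\<Union>\<beta>\<in>?B. \<Union>x. {t. c * ?d \<beta> < ?N \<beta> t x})"
    by auto
  also have "open \<dots>"
    by (intro open_UN ballI open_Collect_less continuous_on_const cont)
  finally show ?thesis .
qed

lemma atom_coeff_nonneg:
  assumes "L > 0" "lp_cutoff \<kappa>" "mollifier \<eta>"
  shows "0 \<le> atom_coeff L \<kappa> \<eta> M u q k t"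
  using norm_piece_le[OF assms, of u q k t 0 M] norm_ge_zero order_trans by blast

lemma active_region_borel:
  assumes L: "L > 0" and \<kappa>: "lp_cutoff \<kappa>" and \<eta>: "mollifier \<eta>" and u: "continuous_spectrum L u"
  shows "active_region L T \<kappa> \<eta> M \<sigma> u q \<in> sets borel"
proof -
  define C where "C = ennreal (\<sigma> q) * (lp_moment L T \<kappa> u q 3 / lp_moment L T \<kappa> u q 2)"
  let ?S = "\<lambda>k. {t. C < ennreal \<bar>atom_coeff L \<kappa> \<eta> M u q k t\<bar>}"
  have S: "?S k \<in> sets borel" for k
  proof (cases C)
    case (real c)
    then have "?S k = {t. c < atom_coeff L \<kappa> \<eta> M u q k t}"
      by (simp add: atom_coeff_nonneg[OF L \<kappa> \<eta>] ennreal_less_iff)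
    then show ?thesis using open_atom_coeff_greater[OF L \<kappa> \<eta> u] by simp
  qed simp
  have "(\<Union>k\<in>cube_index q. ({0..T} \<inter> ?S k) \<times> (cell L \<inter> cube_star L q k)) \<in> sets borel"
    by (intro sets.finite_UN finite_cube_index borel_Times sets.Int S cell_borel cube_star_borel L) auto
  moreover have "{(t, x) \<in> Omega L T. \<exists>k\<in>cube_index q. x \<in> cube_star L q k
        \<and> ennreal \<bar>atom_coeff L \<kappa> \<eta> M u q k t\<bar> > C}
      = (\<Union>k\<in>cube_index q. ({0..T} \<inter> ?S k) \<times> (cell L \<inter> cube_star L q k))"
    by (auto simp: Omega_def)
  ultimately show ?thesis unfolding active_region_def C_def[symmetric] by simp
qed

section \<open>Cubic means off the active regions\<close>

lemma mean_zero_imp_AE: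
  assumes L: "L > 0" "T > 0" and F: "F \<in> borel_measurable lebesgue"
    and z: "mean L T F = 0"
  shows "AE z in lebesgue. z \<in> Omega L T \<longrightarrow> F z = 0"
proof -
  have "(\<integral>\<^sup>+z\<in>Omega L T. F z \<partial>lebesgue) = 0"
    using z L by (simp add: mean_def)
  then have "AE z in lebesgue. F z * indicator (Omega L T) z = 0"
    using F by (subst (asm) nn_integral_0_iff_AE) auto
  then show ?thesis by eventually_elim (auto simp: indicator_def)
qed

lemma mean_zero_if_AE:
  assumes "AE z in lebesgue. z \<in> Omega L T \<longrightarrow> F z = 0"
  shows "mean L T F = 0"
proof -
  have "(\<integral>\<^sup>+z\<in>Omega L T. F z \<partial>lebesgue) = (\<integral>\<^sup>+z. 0 \<partial>(lebesgue :: (real \<times> (real^3)) measure))"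
    using assms by (intro nn_integral_cong_AE) (auto elim!: eventually_mono simp: indicator_def)
  then show ?thesis by (simp add: mean_def)
qed

lemma lp_powi_nat: "2 * 2 powi int q / L = 2 * lam L q"
  by (simp add: lam_def power_int_of_nat)

text \<open>On \<open>Z\<close> the piece is bounded by \<open>N * R\<close> with \<open>R = \<sigma> q * m3 / m2\<close>, so one factor of the cube can be
pulled out and the square integrated over all of \<open>Omega L T\<close>; the second moment cancels against the
denominator of \<open>R\<close>. For the gradient the factor is \<open>3 * N * lam L q * R\<close> and the square costs
\<open>144 * pi\<^sup>2 * (lam L q)\<^sup>2\<close> by Bernstein's inequality.\<close>

lemma quiet_cubic_means:
  assumes L: "L > 0" and T: "T > 0" and \<kappa>: "lp_cutoff \<kappa>" and \<eta>: "mollifier \<eta>" and M: "M \<ge> 1"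
    and u: "continuous_spectrum L u" and \<sigma>: "\<sigma> q > 0"
    and Z: "Z \<subseteq> Omega L T - active_region L T \<kappa> \<eta> M \<sigma> u q"
  defines "N \<equiv> real (card near_indices)"
  shows "mean L T (\<lambda>z. ennreal (speed L \<kappa> u (int q) z ^ 3 * indicator Z z))
      \<le> ennreal (N * \<sigma> q) * lp_moment L T \<kappa> u q 3" (is ?speed)
    and "mean L T (\<lambda>z. ennreal (grad_size L \<kappa> u (int q) z ^ 3 * indicator Z z))
      \<le> ennreal (432 * pi\<^sup>2 * N * \<sigma> q * lam L q ^ 3) * lp_moment L T \<kappa> u q 3" (is ?grad)
proof -
  let ?s = "speed L \<kappa> u (int q)" and ?g = "grad_size L \<kappa> u (int q)"
  note cs = continuous_speed[OF L \<kappa> u, of "int q"]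
  have ms: "(\<lambda>z. ennreal ((?s z)\<^sup>2)) \<in> borel_measurable lebesgue"
    and mg: "(\<lambda>z. ennreal ((?g z)\<^sup>2)) \<in> borel_measurable lebesgue"
    by (intro measurable_compose[OF _ measurable_ennreal] continuous_lebesgue_measurable
        continuous_intros cs)+
  define m2 where "m2 = lp_moment L T \<kappa> u q 2"
  define m3 where "m3 = lp_moment L T \<kappa> u q 3"
  have m2: "m2 = mean L T (\<lambda>z. ennreal ((?s z)\<^sup>2))"
    by (simp add: m2_def lp_moment_eq_mean)
  have m2_fin: "m2 < \<infinity>"
    unfolding m2_def lp_moment_eq_mean by (intro mean_finite L T continuous_intros cs)
  have m3_fin: "m3 < \<infinity>"
    unfolding m3_def lp_moment_eq_mean by (intro mean_finite L T continuous_intros cs)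
  have N: "N \<ge> 0" by (simp add: N_def)
  have bern: "mean L T (\<lambda>z. ennreal ((?g z)\<^sup>2)) \<le> ennreal (144 * pi\<^sup>2 * (lam L q)\<^sup>2) * m2"
  proof -
    have "9 * (2 * pi * (2 * 2 powi int q / L))\<^sup>2 = 144 * pi\<^sup>2 * (lam L q)\<^sup>2"
      unfolding lp_powi_nat by (simp add: power_mult_distrib)
    then show ?thesis using bernstein_mean[OF L \<kappa> u, of T "int q"] by (simp only: m2)
  qed
  have cube: "mean L T (\<lambda>z. ennreal (f z ^ 3 * indicator Z z)) \<le> ennreal c * mean L T (\<lambda>z. ennreal ((f z)\<^sup>2))"
    if f: "\<And>z. z \<in> Z \<Longrightarrow> f z \<le> c" and c: "c \<ge> 0"
      and m: "(\<lambda>z. ennreal ((f z)\<^sup>2)) \<in> borel_measurable lebesgue" for f :: "real \<times> (real^3) \<Rightarrow> real" and c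
  proof -
    have "mean L T (\<lambda>z. ennreal (f z ^ 3 * indicator Z z)) \<le> mean L T (\<lambda>z. ennreal c * ennreal ((f z)\<^sup>2))"
    proof (rule mean_mono)
      fix z
      have "f z ^ 3 * indicator Z z \<le> c * (f z)\<^sup>2"
        using mult_right_mono[OF f, of z "(f z)\<^sup>2"] c
        by (cases "z \<in> Z") (simp_all add: power3_eq_cube power2_eq_square)
      then show "ennreal (f z ^ 3 * indicator Z z) \<le> ennreal c * ennreal ((f z)\<^sup>2)"
        using c by (simp add: ennreal_leI flip: ennreal_mult)
    qed
    also have "\<dots> = ennreal c * mean L T (\<lambda>z. ennreal ((f z)\<^sup>2))" by (rule mean_cmult[OF m])
    finally show ?thesis .
  qed
  have "?speed \<and> ?grad"
  \<comment> \<open>For a piece that vanishes almost everywhere the active region is empty by convention and \<open>Z\<close> carries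
      no pointwise information, but then all the means are zero.\<close>
  proof (cases "AE (t, x) in lebesgue. (t, x) \<in> Omega L T \<longrightarrow> lp L \<kappa> (int q) (u t) x = 0")
    case True
    then have "AE z in lebesgue. z \<in> Omega L T \<longrightarrow> ennreal ((?s z)\<^sup>2) = 0"
      by eventually_elim (auto simp: speed_def)
    then have "m2 = 0" unfolding m2 by (rule mean_zero_if_AE)
    then have g0: "mean L T (\<lambda>z. ennreal ((?g z)\<^sup>2)) = 0" using bern by simp
    obtain B where B: "B \<ge> 0" "\<And>z. z \<in> Omega L T \<Longrightarrow> \<bar>?s z\<bar> \<le> B"
      by (rule continuous_bounded_on_Omega[OF cs(1), of L T]) blast
    obtain B' where B': "B' \<ge> 0" "\<And>z. z \<in> Omega L T \<Longrightarrow> \<bar>?g z\<bar> \<le> B'"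
      by (rule continuous_bounded_on_Omega[OF cs(2), of L T]) blast
    have "mean L T (\<lambda>z. ennreal (?s z ^ 3 * indicator Z z)) \<le> ennreal B * m2"
      unfolding m2 using B(2) Z by (intro cube ms B(1)) force
    moreover have "mean L T (\<lambda>z. ennreal (?g z ^ 3 * indicator Z z)) \<le> ennreal B' * mean L T (\<lambda>z. ennreal ((?g z)\<^sup>2))"
      using B'(2) Z by (intro cube mg B'(1)) force
    ultimately show ?thesis using \<open>m2 = 0\<close> g0 by simp
  next
    case False
    have m2_pos: "m2 \<noteq> 0"
    proof
      assume "m2 = 0"
      then have "AE z in lebesgue. z \<in> Omega L T \<longrightarrow> ennreal ((?s z)\<^sup>2) = 0"
        unfolding m2 by (rule mean_zero_imp_AE[OF L T ms])
      then have "AE (t, x) in lebesgue. (t, x) \<in> Omega L T \<longrightarrow> lp L \<kappa> (int q) (u t) x = 0"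
        by eventually_elim (auto simp: speed_def)
      then show False using False by blast
    qed
    define C where "C = ennreal (\<sigma> q) * (m3 / m2)"
    have Cm: "C * m2 = ennreal (\<sigma> q) * m3"
    proof -
      have "m3 / m2 * m2 = m3"
        using m2_pos m2_fin by (metis ennreal_mult_divide_eq ennreal_times_divide infinity_ennreal_def less_irrefl mult.commute)
      then show ?thesis by (simp add: C_def mult.assoc)
    qed
    have "C < \<infinity>"
    proof -
      have "m3 / m2 \<noteq> \<infinity>"
        using m2_pos m3_fin by (auto simp: ennreal_divide_eq_top_iff)
      then show ?thesis
        by (simp add: C_def ennreal_mult_less_top top.not_eq_extremum)
    qed
    then obtain R where R: "R \<ge> 0" "C = ennreal R" by (cases C) auto
    have quiet: "?s z \<le> N * R \<and> ?g z \<le> 3 * N * lam L q * R" if z: "z \<in> Z" for z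
    proof -
      obtain t x where tx: "z = (t, x)" by (cases z)
      have "(t, x) \<in> Omega L T" "(t, x) \<notin> active_region L T \<kappa> \<eta> M \<sigma> u q"
        using z Z tx by auto
      then have "\<not> (\<exists>k\<in>cube_index q. x \<in> cube_star L q k \<and> C < ennreal \<bar>atom_coeff L \<kappa> \<eta> M u q k t\<bar>)"
        using False unfolding active_region_def C_def m2_def m3_def by auto
      then have small: "\<bar>atom_coeff L \<kappa> \<eta> M u q k t\<bar> \<le> R" if "k \<in> cube_index q" "x \<in> cube_star L q k" for k
        using that R by (auto simp: not_less)
      have "x \<in> cell L" using \<open>(t, x) \<in> Omega L T\<close> by (simp add: Omega_def)
      from lp_bound_by_atoms[OF L \<kappa> \<eta> M this small R(1)] show ?thesis by (simp add: tx N_def)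
    qed
    have "mean L T (\<lambda>z. ennreal (?s z ^ 3 * indicator Z z)) \<le> ennreal (N * R) * m2"
      unfolding m2 using quiet N R(1) by (intro cube ms) auto
    also have "\<dots> = ennreal N * (C * m2)"
      using N R by (simp add: ennreal_mult mult.assoc)
    also have "\<dots> = ennreal (N * \<sigma> q) * m3"
      unfolding Cm using N \<sigma> by (simp add: ennreal_mult mult.assoc)
    finally have 1: ?speed by (simp add: m3_def)
    have lp: "lam L q > 0" by (rule lam_pos[OF L])
    have assoc: "ennreal a * (ennreal b * m) = ennreal (a * b) * m" if "0 \<le> a" "0 \<le> b" for a b m
      using that by (simp add: ennreal_mult mult.assoc)
    have "mean L T (\<lambda>z. ennreal (?g z ^ 3 * indicator Z z))
        \<le> ennreal (3 * N * lam L q * R) * mean L T (\<lambda>z. ennreal ((?g z)\<^sup>2))"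
      using quiet N R(1) lp by (intro cube mg) auto
    also have "\<dots> \<le> ennreal (3 * N * lam L q * R) * (ennreal (144 * pi\<^sup>2 * (lam L q)\<^sup>2) * m2)"
      by (intro mult_left_mono bern) simp
    also have "\<dots> = ennreal (432 * pi\<^sup>2 * N * lam L q ^ 3 * R) * m2"
      using N R(1) lp by (subst assoc) (simp_all add: power3_eq_cube power2_eq_square mult_ac)
    also have "\<dots> = ennreal (432 * pi\<^sup>2 * N * lam L q ^ 3) * (C * m2)"
      unfolding R(2) using N R(1) lp by (subst assoc) simp_all
    also have "\<dots> = ennreal (432 * pi\<^sup>2 * N * \<sigma> q * lam L q ^ 3) * m3"
      unfolding Cm using N \<sigma> lp by (subst assoc) (simp_all add: mult_ac)
    finally have 2: ?grad by (simp add: m3_def)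
    show ?thesis using 1 2 by blast
  qed
  then show ?speed ?grad by blast+
qed

section \<open>Summation of the flux\<close>

text \<open>Two instances of Tannery's theorem: each term of the sum tends to zero, and a geometric sequence
dominates them all.\<close>

lemma weighted_shift_tendsto_0:
  fixes \<delta> :: "nat \<Rightarrow> real"
  assumes \<delta>: "\<delta> \<longlonglongrightarrow> 0" and c: "0 \<le> c" "c < 1"
  shows "summable (\<lambda>n. c ^ n * \<delta> (p + n))" and "(\<lambda>p. \<Sum>n. c ^ n * \<delta> (p + n)) \<longlonglongrightarrow> 0"
    and "(\<lambda>p. \<Sum>i\<le>p. c ^ i * \<delta> (p - i)) \<longlonglongrightarrow> 0"
proof -
  obtain B where B: "\<And>n. \<bar>\<delta> n\<bar> \<le> B"
    using convergent_imp_Bseq[of \<delta>] \<delta> unfolding convergent_def Bseq_def real_norm_def by blast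
  have B0: "0 \<le> B" using B[of 0] by linarith
  have sum: "summable (\<lambda>n. c ^ n * B)"
    using c by (intro summable_mult2 summable_geometric) simp
  have bd: "\<bar>c ^ n * \<delta> m\<bar> \<le> c ^ n * B" for n m
    using B c by (simp add: abs_mult mult_left_mono)
  show "summable (\<lambda>n. c ^ n * \<delta> (p + n))"
    by (rule summable_comparison_test'[OF sum, of 0]) (use bd in simp)
  have "(\<lambda>p. c ^ k * \<delta> (p + k)) \<longlonglongrightarrow> c ^ k * 0" for k
    by (intro tendsto_intros LIMSEQ_ignore_initial_segment \<delta>)
  from tannerys_theorem[where F = sequentially and a = "\<lambda>k p. c ^ k * \<delta> (p + k)" and b = "\<lambda>k. 0" and M = "\<lambda>k. c ^ k * B"]
    this sum bd
  show "(\<lambda>p. \<Sum>n. c ^ n * \<delta> (p + n)) \<longlonglongrightarrow> 0" by (simp add: case_prod_unfold)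
  define a where "a k p = (if k \<le> p then c ^ k * \<delta> (p - k) else 0)" for k p
  have lim: "(\<lambda>p. a k p) \<longlonglongrightarrow> 0" for k
  proof (rule LIMSEQ_offset[of _ k])
    have "(\<lambda>p. c ^ k * \<delta> p) \<longlonglongrightarrow> c ^ k * 0" by (intro tendsto_intros \<delta>)
    then show "(\<lambda>p. a k (p + k)) \<longlonglongrightarrow> 0" by (simp add: a_def)
  qed
  have "\<bar>a k p\<bar> \<le> c ^ k * B" for k p
    using bd[of k "p - k"] B0 c by (auto simp: a_def)
  with tannerys_theorem[where F = sequentially and a = a and b = "\<lambda>k. 0" and M = "\<lambda>k. c ^ k * B"] lim sum
  have "(\<lambda>p. \<Sum>k. a k p) \<longlonglongrightarrow> 0" by (simp add: case_prod_unfold)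
  moreover have "(\<Sum>k. a k p) = (\<Sum>i\<le>p. c ^ i * \<delta> (p - i))" for p
  proof -
    have "(\<Sum>k. a k p) = (\<Sum>k\<le>p. a k p)"
      by (rule suminf_finite) (auto simp: a_def)
    then show ?thesis by (simp add: a_def)
  qed
  ultimately show "(\<lambda>p. \<Sum>i\<le>p. c ^ i * \<delta> (p - i)) \<longlonglongrightarrow> 0" by simp
qed

text \<open>Scaling two of the factors by the cube root \<open>\<theta>\<close> of the weight and the third by \<open>1 / \<theta>\<^sup>2\<close> leaves the product
unchanged; it is then at most the cube of the largest factor.\<close>

lemma weighted_young:
  fixes a b c \<tau> :: real
  assumes nn: "0 \<le> a" "0 \<le> b" "0 \<le> c" and \<tau>: "\<tau> > 0"
  shows "a * b * c \<le> \<tau> * (a ^ 3 + b ^ 3) + c ^ 3 / \<tau>\<^sup>2"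
proof -
  have crude: "x * y * z \<le> x ^ 3 + y ^ 3 + z ^ 3" if "0 \<le> x" "0 \<le> y" "0 \<le> z" for x y z :: real
  proof -
    let ?m = "max x (max y z)"
    have "x * y * z \<le> ?m * ?m * ?m"
      using that by (intro mult_mono) auto
    also have "\<dots> = ?m ^ 3" by (simp add: power3_eq_cube)
    also have "\<dots> \<le> x ^ 3 + y ^ 3 + z ^ 3"
      using that by (auto simp: max_def)
    finally show ?thesis .
  qed
  define \<theta> where "\<theta> = root 3 \<tau>"
  have \<theta>: "\<theta> > 0" "\<theta> ^ 3 = \<tau>"
    using \<tau> by (simp_all add: \<theta>_def)
  have "a * b * c = (\<theta> * a) * (\<theta> * b) * (c / \<theta>\<^sup>2)"
    using \<theta> by (simp add: power2_eq_square)
  also have "\<dots> \<le> (\<theta> * a) ^ 3 + (\<theta> * b) ^ 3 + (c / \<theta>\<^sup>2) ^ 3"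
    using nn \<theta> by (intro crude) auto
  also have "\<dots> = \<theta> ^ 3 * (a ^ 3 + b ^ 3) + c ^ 3 / (\<theta> ^ 3)\<^sup>2"
    by (simp add: power_mult_distrib power_divide distrib_left flip: power_mult)
  finally show ?thesis by (simp add: \<theta>)
qed

text \<open>The partial sums are bounded by those of the absolute values. A divergent \<open>infsum\<close> is zero by
convention.\<close>

lemma abs_infsum_le:
  fixes f :: "'a \<Rightarrow> real"
  assumes "\<And>F. finite F \<Longrightarrow> F \<subseteq> S \<Longrightarrow> ennreal (\<Sum>x\<in>F. \<bar>f x\<bar>) \<le> B"
  shows "ennreal \<bar>infsum f S\<bar> \<le> B"
proof (cases "f summable_on S \<and> B \<noteq> \<infinity>")
  case True
  then obtain b where b: "B = ennreal b" "0 \<le> b" by (cases B) auto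
  have "((\<lambda>F. \<bar>sum f F\<bar>) \<longlongrightarrow> \<bar>infsum f S\<bar>) (finite_subsets_at_top S)"
    using True by (intro tendsto_rabs infsum_tendsto) blast
  moreover have "\<forall>\<^sub>F F in finite_subsets_at_top S. \<bar>sum f F\<bar> \<le> b"
  proof (rule eventually_finite_subsets_at_top_weakI)
    fix F assume F: "finite F" "F \<subseteq> S"
    have "\<bar>sum f F\<bar> \<le> (\<Sum>x\<in>F. \<bar>f x\<bar>)" by (rule sum_abs)
    also have "\<dots> \<le> b" using assms[OF F] b by simp
    finally show "\<bar>sum f F\<bar> \<le> b" .
  qed
  ultimately have "\<bar>infsum f S\<bar> \<le> b"
    by (intro tendsto_upperbound) auto
  then show ?thesis using b by (simp add: ennreal_leI)
next
  case False
  then show ?thesis by (auto simp: infsum_not_exists)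
qed

definition flux_indices :: "nat \<Rightarrow> (int \<times> int \<times> int) set" where
  "flux_indices q = {(p1, p2, p3). p1 \<ge> int q - 1 \<and> p2 \<ge> int q \<and> -1 \<le> p3 \<and> p3 < int q \<and> \<bar>p1 - p2\<bar> < 2}"

definition flux_term ::
    "real \<Rightarrow> (real^3 \<Rightarrow> real) \<Rightarrow> (real \<Rightarrow> real^3 \<Rightarrow> real^3) \<Rightarrow> int \<Rightarrow> int \<Rightarrow> int \<Rightarrow> real \<times> (real^3) \<Rightarrow> real" where
  "flux_term L \<kappa> u p1 p2 p3 z = speed L \<kappa> u p1 z * speed L \<kappa> u p2 z * grad_size L \<kappa> u p3 z"

lemma flux_term_nonneg: "0 \<le> flux_term L \<kappa> u p1 p2 p3 z"
  by (simp add: flux_term_def speed_nonneg grad_size_nonneg)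

text \<open>The indices of the flux are parametrised as \<open>p2 = q + n\<close>, \<open>p1 = p2 + d\<close> with \<open>d\<close> in \<open>{-1, 0, 1}\<close>, and
\<open>p3 = j - 1\<close> with \<open>j \<le> q\<close>; the shift by one makes the lowest piece \<open>p3 = -1\<close> the term \<open>j = 0\<close>.\<close>

lemma abs_flux_le:
  "ennreal \<bar>flux L \<kappa> u q z\<bar>
    \<le> (\<Sum>n. \<Sum>d\<in>{-1, 0, 1}. \<Sum>j\<le>q. ennreal (flux_term L \<kappa> u (int (q + n) + d) (int (q + n)) (int j - 1) z))"
proof -
  obtain t x where z: "z = (t, x)" by (cases z)
  let ?f = "\<lambda>(p1, p2, p3). tensor_grad (lp L \<kappa> p1 (u t) x) (lp L \<kappa> p2 (u t) x) (lp L \<kappa> p3 (u t)) x"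
  let ?g = "\<lambda>(p1, p2, p3). flux_term L \<kappa> u p1 p2 p3 z"
  let ?h = "\<lambda>(n, d, j). (int (q + n) + d, int (q + n), int j - 1)"
  let ?B = "\<Sum>n. \<Sum>d\<in>{-1, 0, 1}. \<Sum>j\<le>q. ennreal (flux_term L \<kappa> u (int (q + n) + d) (int (q + n)) (int j - 1) z)"
  have flux: "flux L \<kappa> u q z = infsum ?f (flux_indices q)"
    by (simp add: flux_def z flux_indices_def)
  have "ennreal (\<Sum>p\<in>F. \<bar>?f p\<bar>) \<le> ?B" if F: "finite F" "F \<subseteq> flux_indices q" for F
  proof -
    have "finite ((\<lambda>(p1, p2, p3). nat (p2 - int q)) ` F)" using F by simp
    then obtain N where N: "\<And>p. p \<in> F \<Longrightarrow> nat (fst (snd p) - int q) < N"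
      unfolding finite_nat_set_iff_bounded by (auto simp: case_prod_beta)
    let ?X = "{..<N} \<times> ({-1, 0, 1} \<times> {..q})"
    have sub: "F \<subseteq> ?h ` ?X"
    proof
      fix p assume p: "p \<in> F"
      obtain p1 p2 p3 where pp: "p = (p1, p2, p3)" by (cases p)
      have i: "p2 \<ge> int q" "-1 \<le> p3" "p3 < int q" "\<bar>p1 - p2\<bar> < 2"
        using p F(2) by (auto simp: pp flux_indices_def)
      have "p = ?h (nat (p2 - int q), p1 - p2, nat (p3 + 1))"
        using i by (simp add: pp)
      moreover have "(nat (p2 - int q), p1 - p2, nat (p3 + 1)) \<in> ?X"
        using i N[OF p] by (auto simp: pp)
      ultimately show "p \<in> ?h ` ?X" by blast
    qed
    have "(\<Sum>p\<in>F. \<bar>?f p\<bar>) \<le> (\<Sum>p\<in>F. ?g p)"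
      by (intro sum_mono) (auto simp: z flux_term_def speed_def grad_size_def abs_tensor_grad_le)
    also have "\<dots> \<le> (\<Sum>p\<in>?h ` ?X. ?g p)"
      using sub by (intro sum_mono2) (auto simp: flux_term_nonneg)
    also have "\<dots> = (\<Sum>p\<in>?X. ?g (?h p))"
      by (rule sum.reindex_cong[of ?h]) (auto simp: inj_on_def)
    also have "\<dots> = (\<Sum>n<N. \<Sum>d\<in>{-1, 0, 1}. \<Sum>j\<le>q. flux_term L \<kappa> u (int (q + n) + d) (int (q + n)) (int j - 1) z)"
      by (simp only: sum.cartesian_product' prod.case)
    finally have "ennreal (\<Sum>p\<in>F. \<bar>?f p\<bar>)
        \<le> ennreal (\<Sum>n<N. \<Sum>d\<in>{-1, 0, 1}. \<Sum>j\<le>q. flux_term L \<kappa> u (int (q + n) + d) (int (q + n)) (int j - 1) z)"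
      by (rule ennreal_leI)
    also have "\<dots> = (\<Sum>n<N. \<Sum>d\<in>{-1, 0, 1}. \<Sum>j\<le>q. ennreal (flux_term L \<kappa> u (int (q + n) + d) (int (q + n)) (int j - 1) z))"
      by (simp only: sum_ennreal flux_term_nonneg sum_nonneg)
    also have "\<dots> \<le> ?B"
      by (rule sum_le_suminf) auto
    finally show ?thesis .
  qed
  then show ?thesis unfolding flux by (rule abs_infsum_le)
qed

lemma continuous_indicator_measurable:
  fixes f :: "'a::euclidean_space \<Rightarrow> real"
  assumes "continuous_on UNIV f" "Z \<in> sets lebesgue"
  shows "(\<lambda>z. ennreal (f z * indicator Z z)) \<in> borel_measurable lebesgue"
  by (intro measurable_compose[OF _ measurable_ennreal] borel_measurable_times
      continuous_lebesgue_measurable borel_measurable_indicator assms)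

text \<open>The cubic mean of \<open>u_m\<close> is of size \<open>\<delta> m / lam L m\<close>, that of the gradient of \<open>u_(j - 1)\<close> of size
\<open>(lam L j)\<^sup>2 * \<delta> j\<close>, and \<open>lam L m = lam L j * 2 ^ e\<close>. Young's inequality with the weight \<open>lam L m * c ^ e\<close>
therefore produces the factors \<open>c ^ e\<close> and \<open>(1 / (2 * c)\<^sup>2) ^ e\<close>. Both decay geometrically in the gap \<open>e\<close>
for any \<open>c\<close> strictly between \<open>1/2\<close> and \<open>1\<close>; the choice \<open>c = 2/3\<close> gives \<open>2/3\<close> and \<open>9/16\<close>.\<close>

lemma mean_flux_term_le:
  assumes L: "L > 0" and \<kappa>: "lp_cutoff \<kappa>" and u: "continuous_spectrum L u"
    and Z: "Z \<in> sets lebesgue"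
    and s: "\<And>p. mean L T (\<lambda>z. ennreal (speed L \<kappa> u (int p) z ^ 3 * indicator Z z)) \<le> ennreal (\<delta> p / lam L p)"
    and g: "\<And>j. mean L T (\<lambda>z. ennreal (grad_size L \<kappa> u (int j - 1) z ^ 3 * indicator Z z))
        \<le> ennreal ((lam L j)\<^sup>2 * \<delta> j)"
    and \<delta>: "\<And>p. 0 \<le> \<delta> p" and m': "m \<le> Suc m'" and j: "j \<le> m"
  shows "mean L T (\<lambda>z. ennreal (flux_term L \<kappa> u (int m') (int m) (int j - 1) z * indicator Z z))
    \<le> ennreal ((2/3) ^ (m - j) * (2 * \<delta> m' + \<delta> m + \<delta> j))"
proof -
  define e where "e = m - j"
  define \<tau> where "\<tau> = lam L m * (2/3) ^ e"
  have lp: "lam L p > 0" for p by (rule lam_pos[OF L])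
  have \<tau>: "\<tau> > 0" using lp by (simp add: \<tau>_def)
  let ?s = "\<lambda>p z. speed L \<kappa> u (int p) z ^ 3 * indicator Z z"
  let ?g = "\<lambda>z. grad_size L \<kappa> u (int j - 1) z ^ 3 * indicator Z z"
  have comb: "ennreal (a * x + a * y + b * w) = (ennreal a * ennreal x + ennreal a * ennreal y) + ennreal b * ennreal w"
    if "0 \<le> a" "0 \<le> b" "0 \<le> x" "0 \<le> y" "0 \<le> w" for a b x y w
    using that by (simp add: ennreal_mult)
  have [measurable]: "(\<lambda>z. ennreal (?s p z)) \<in> borel_measurable lebesgue" "(\<lambda>z. ennreal (?g z)) \<in> borel_measurable lebesgue" for p
    by (intro continuous_indicator_measurable Z continuous_intros continuous_speed L \<kappa> u)+
  have "mean L T (\<lambda>z. ennreal (flux_term L \<kappa> u (int m') (int m) (int j - 1) z * indicator Z z))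
      \<le> mean L T (\<lambda>z. (ennreal \<tau> * ennreal (?s m' z) + ennreal \<tau> * ennreal (?s m z)) + ennreal (1 / \<tau>\<^sup>2) * ennreal (?g z))"
  proof (rule mean_mono)
    fix z
    have "flux_term L \<kappa> u (int m') (int m) (int j - 1) z * indicator Z z
        \<le> \<tau> * ?s m' z + \<tau> * ?s m z + 1 / \<tau>\<^sup>2 * ?g z"
      using weighted_young[OF speed_nonneg speed_nonneg grad_size_nonneg \<tau>, of L \<kappa> u "int m'" z L \<kappa> u "int m" z L \<kappa> u "int j - 1" z]
      by (auto simp: flux_term_def indicator_def distrib_left)
    then have "ennreal (flux_term L \<kappa> u (int m') (int m) (int j - 1) z * indicator Z z)
        \<le> ennreal (\<tau> * ?s m' z + \<tau> * ?s m z + 1 / \<tau>\<^sup>2 * ?g z)" by (rule ennreal_leI)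
    also have "\<dots> = (ennreal \<tau> * ennreal (?s m' z) + ennreal \<tau> * ennreal (?s m z)) + ennreal (1 / \<tau>\<^sup>2) * ennreal (?g z)"
      using \<tau> by (intro comb) (simp_all add: speed_nonneg grad_size_nonneg)
    finally show "ennreal (flux_term L \<kappa> u (int m') (int m) (int j - 1) z * indicator Z z)
        \<le> (ennreal \<tau> * ennreal (?s m' z) + ennreal \<tau> * ennreal (?s m z)) + ennreal (1 / \<tau>\<^sup>2) * ennreal (?g z)" .
  qed
  also have "\<dots> = (ennreal \<tau> * mean L T (\<lambda>z. ennreal (?s m' z)) + ennreal \<tau> * mean L T (\<lambda>z. ennreal (?s m z)))
      + ennreal (1 / \<tau>\<^sup>2) * mean L T (\<lambda>z. ennreal (?g z))"
    by (subst mean_add, measurable)+ (subst mean_cmult, measurable)+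
  also have "\<dots> \<le> (ennreal \<tau> * ennreal (\<delta> m' / lam L m') + ennreal \<tau> * ennreal (\<delta> m / lam L m))
      + ennreal (1 / \<tau>\<^sup>2) * ennreal ((lam L j)\<^sup>2 * \<delta> j)"
    by (intro add_mono mult_left_mono s g) auto
  also have "\<dots> = ennreal (\<tau> * (\<delta> m' / lam L m') + \<tau> * (\<delta> m / lam L m) + 1 / \<tau>\<^sup>2 * ((lam L j)\<^sup>2 * \<delta> j))"
    using \<tau> \<delta> lp[THEN less_imp_le] by (intro comb[symmetric]) simp_all
  also have "\<dots> \<le> ennreal ((2/3) ^ e * (2 * \<delta> m' + \<delta> m + \<delta> j))"
  proof (rule ennreal_leI)
    have "lam L m \<le> 2 * lam L m'"
    proof -
      have "(2::real) ^ m \<le> 2 ^ Suc m'" using m' by (intro power_increasing) auto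
      then show ?thesis using L by (simp add: lam_def divide_right_mono)
    qed
    then have 1: "\<tau> * (\<delta> m' / lam L m') \<le> (2/3) ^ e * (2 * \<delta> m')"
    proof -
      have "lam L m / lam L m' \<le> 2"
        using \<open>lam L m \<le> 2 * lam L m'\<close> lp[of m'] by (simp add: pos_divide_le_eq)
      then have "(2/3) ^ e * \<delta> m' * (lam L m / lam L m') \<le> (2/3) ^ e * \<delta> m' * 2"
        using \<delta>[of m'] by (intro mult_left_mono) auto
      then show ?thesis by (simp add: \<tau>_def mult_ac)
    qed
    have 2: "\<tau> * (\<delta> m / lam L m) = (2/3) ^ e * \<delta> m"
      using lp[of m] by (simp add: \<tau>_def)
    have "lam L m = lam L j * 2 ^ e"
      using j by (simp add: lam_def e_def flip: power_add)
    then have "1 / \<tau>\<^sup>2 * (lam L j)\<^sup>2 = 1 / (2 ^ e * (2/3) ^ e)\<^sup>2"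
      using lp[of j] by (simp add: \<tau>_def power_mult_distrib)
    also have "\<dots> = (9/16) ^ e"
      by (simp add: power_mult_distrib[symmetric] power_mult[symmetric] mult.commute[of e] power_one_over[symmetric] flip: power_divide)
         (simp add: power_mult power2_eq_square power_divide)
    also have "\<dots> \<le> (2/3) ^ e" by (intro power_mono) auto
    finally have 3: "1 / \<tau>\<^sup>2 * ((lam L j)\<^sup>2 * \<delta> j) \<le> (2/3) ^ e * \<delta> j"
      using mult_right_mono[OF _ \<delta>[of j]] by (simp only: mult.assoc[symmetric])
    show "\<tau> * (\<delta> m' / lam L m') + \<tau> * (\<delta> m / lam L m) + 1 / \<tau>\<^sup>2 * ((lam L j)\<^sup>2 * \<delta> j)
        \<le> (2/3) ^ e * (2 * \<delta> m' + \<delta> m + \<delta> j)"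
      using 1 2 3 by (simp only: distrib_left)
  qed
  finally show ?thesis by (simp add: e_def)
qed

text \<open>Summing the bounds for single terms over the lower index \<open>j\<close> leaves a geometric series and the
convolution \<open>S q\<close> of a geometric sequence with \<open>\<delta>\<close>; summing over \<open>n\<close> leaves a weighted tail of \<open>\<delta>\<close>.\<close>

lemma mean_flux_tendsto_0:
  assumes L: "L > 0" and \<kappa>: "lp_cutoff \<kappa>" and u: "continuous_spectrum L u"
    and Z: "Z \<in> sets lebesgue"
    and s: "\<And>p. mean L T (\<lambda>z. ennreal (speed L \<kappa> u (int p) z ^ 3 * indicator Z z)) \<le> ennreal (\<delta> p / lam L p)"
    and g: "\<And>j. mean L T (\<lambda>z. ennreal (grad_size L \<kappa> u (int j - 1) z ^ 3 * indicator Z z))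
        \<le> ennreal ((lam L j)\<^sup>2 * \<delta> j)"
    and \<delta>: "\<And>p. 0 \<le> \<delta> p" and lim: "\<delta> \<longlonglongrightarrow> 0"
  shows "(\<lambda>q. mean L T (\<lambda>z. ennreal (\<bar>flux L \<kappa> u q z\<bar> * indicator Z z))) \<longlonglongrightarrow> 0"
proof -
  \<comment> \<open>\<open>\<Delta> m\<close> dominates \<open>\<delta>\<close> at \<open>m\<close> and at both neighbours, and so covers all three values of \<open>d\<close>.\<close>
  define \<Delta> where "\<Delta> m = \<delta> (m - 1) + \<delta> m + \<delta> (Suc m)" for m
  define S where "S q = (\<Sum>i\<le>q. (2/3) ^ i * \<delta> (q - i))" for q
  have \<Delta>_lim: "\<Delta> \<longlonglongrightarrow> 0"
  proof -
    have "(\<lambda>m. \<delta> (m - 1)) \<longlonglongrightarrow> 0"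
      by (rule LIMSEQ_offset[of _ 1]) (simp add: lim)
    from tendsto_add[OF tendsto_add[OF this lim] LIMSEQ_Suc[OF lim]]
    show ?thesis by (simp add: \<Delta>_def[abs_def])
  qed
  have \<Delta>: "0 \<le> \<Delta> m" for m using \<delta> by (simp add: \<Delta>_def)
  have S: "0 \<le> S q" for q using \<delta> by (simp add: S_def sum_nonneg)
  note shift = weighted_shift_tendsto_0[OF \<Delta>_lim, of "2/3"]
  have geo: "(\<Sum>i\<le>q. (2/3 :: real) ^ i) \<le> 3" for q
  proof -
    have "(\<Sum>i\<le>q. (2/3 :: real) ^ i) = 3 - 2 * (2/3) ^ q"
      by (induction q) simp_all
    then show ?thesis by simp
  qed
  define W where "W q = 27 * (\<Sum>n. (2/3) ^ n * \<Delta> (q + n)) + 9 * S q" for q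
  have bound: "mean L T (\<lambda>z. ennreal (\<bar>flux L \<kappa> u q z\<bar> * indicator Z z)) \<le> ennreal (W q)" if q: "q \<ge> 1" for q
  proof -
    let ?F = "\<lambda>n d j z. ennreal (flux_term L \<kappa> u (int (q + n) + d) (int (q + n)) (int j - 1) z * indicator Z z)"
    have [measurable]: "?F n d j \<in> borel_measurable lebesgue" for n d j
      unfolding flux_term_def
      by (intro continuous_indicator_measurable Z continuous_intros continuous_speed L \<kappa> u)
    have "mean L T (\<lambda>z. ennreal (\<bar>flux L \<kappa> u q z\<bar> * indicator Z z))
        \<le> mean L T (\<lambda>z. \<Sum>n. \<Sum>d\<in>{-1, 0, 1}. \<Sum>j\<le>q. ?F n d j z)"
    proof (rule mean_mono)
      fix z
      show "ennreal (\<bar>flux L \<kappa> u q z\<bar> * indicator Z z) \<le> (\<Sum>n. \<Sum>d\<in>{-1, 0, 1}. \<Sum>j\<le>q. ?F n d j z)"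
        using abs_flux_le[of L \<kappa> u q z] by (cases "z \<in> Z") (simp_all only: indicator_simps simp_thms mult_1_right mult_zero_right ennreal_0 zero_le)
    qed
    also have "\<dots> = (\<Sum>n. \<Sum>d\<in>{-1, 0, 1}. \<Sum>j\<le>q. mean L T (?F n d j))"
      by (simp only: mean_suminf mean_sum borel_measurable_sum \<open>\<And>n d j. ?F n d j \<in> borel_measurable lebesgue\<close>)
    also have "\<dots> \<le> (\<Sum>n. ennreal ((2/3) ^ n * (27 * \<Delta> (q + n) + 3 * S q)))"
    proof (rule suminf_le)
      fix n
      have single: "mean L T (?F n d j) \<le> ennreal ((2/3) ^ n * ((2/3) ^ (q - j) * (3 * \<Delta> (q + n) + \<delta> j)))"
        if d: "d \<in> {-1, 0, 1}" and j: "j \<in> {..q}" for d j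
      proof -
        define m' where "m' = nat (int (q + n) + d)"
        have m': "int (q + n) + d = int m'" "q + n \<le> Suc m'"
          using d q by (auto simp: m'_def)
        have "m' \<in> {q + n - 1, q + n, Suc (q + n)}"
          using d q by (auto simp: m'_def)
        then have "\<delta> m' \<le> \<Delta> (q + n)"
          using \<delta>[of "q + n - 1"] \<delta>[of "q + n"] \<delta>[of "Suc (q + n)"] by (auto simp: \<Delta>_def)
        moreover have "\<delta> (q + n) \<le> \<Delta> (q + n)"
          using \<delta>[of "q + n - 1"] \<delta>[of "Suc (q + n)"] by (simp add: \<Delta>_def)
        ultimately have le: "2 * \<delta> m' + \<delta> (q + n) + \<delta> j \<le> 3 * \<Delta> (q + n) + \<delta> j" by simp
        have "mean L T (?F n d j) \<le> ennreal ((2/3) ^ (q + n - j) * (2 * \<delta> m' + \<delta> (q + n) + \<delta> j))"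
          unfolding m'(1) using j by (intro mean_flux_term_le[OF L \<kappa> u Z s g \<delta> m'(2)]) simp
        also have "\<dots> \<le> ennreal ((2/3) ^ (q + n - j) * (3 * \<Delta> (q + n) + \<delta> j))"
          by (intro ennreal_leI mult_left_mono le) simp
        also have "q + n - j = n + (q - j)" using j by simp
        finally show ?thesis by (simp add: power_add mult.assoc)
      qed
      have "(\<Sum>d\<in>{-1, 0, 1}. \<Sum>j\<le>q. mean L T (?F n d j))
          \<le> (\<Sum>d\<in>{-1, 0, 1::int}. \<Sum>j\<le>q. ennreal ((2/3) ^ n * ((2/3) ^ (q - j) * (3 * \<Delta> (q + n) + \<delta> j))))"
        by (intro sum_mono single)
      also have "\<dots> = ennreal (\<Sum>d\<in>{-1, 0, 1::int}. \<Sum>j\<le>q. (2/3) ^ n * ((2/3) ^ (q - j) * (3 * \<Delta> (q + n) + \<delta> j)))"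
        using \<Delta> \<delta> by (subst sum_ennreal; (subst sum_ennreal)?) (auto intro!: sum_nonneg)
      also have "(\<Sum>d\<in>{-1, 0, 1::int}. \<Sum>j\<le>q. (2/3) ^ n * ((2/3) ^ (q - j) * (3 * \<Delta> (q + n) + \<delta> j)))
          = 3 * ((2/3) ^ n * (\<Sum>j\<le>q. (2/3) ^ (q - j) * (3 * \<Delta> (q + n) + \<delta> j)))"
        by (simp add: sum_distrib_left)
      also have "(\<Sum>j\<le>q. (2/3) ^ (q - j) * (3 * \<Delta> (q + n) + \<delta> j))
          = (\<Sum>i\<le>q. (2/3) ^ i * (3 * \<Delta> (q + n) + \<delta> (q - i)))"
        by (rule sum.reindex_bij_witness[of _ "\<lambda>i. q - i" "\<lambda>j. q - j"]) auto
      also have "\<dots> = 3 * \<Delta> (q + n) * (\<Sum>i\<le>q. (2/3) ^ i) + S q"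
        by (simp add: S_def distrib_left sum.distrib sum_distrib_left mult_ac)
      also have "ennreal (3 * ((2/3) ^ n * (3 * \<Delta> (q + n) * (\<Sum>i\<le>q. (2/3) ^ i) + S q)))
          \<le> ennreal (3 * ((2/3) ^ n * (3 * \<Delta> (q + n) * 3 + S q)))"
        using \<Delta> by (intro ennreal_leI mult_left_mono add_right_mono geo) auto
      also have "3 * ((2/3) ^ n * (3 * \<Delta> (q + n) * 3 + S q)) = (2/3) ^ n * (27 * \<Delta> (q + n) + 3 * S q)"
        by (simp add: algebra_simps)
      finally show "(\<Sum>d\<in>{-1, 0, 1}. \<Sum>j\<le>q. mean L T (?F n d j)) \<le> ennreal ((2/3) ^ n * (27 * \<Delta> (q + n) + 3 * S q))" .
    qed auto
    also have "\<dots> = ennreal (W q)"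
    proof -
      have "(\<lambda>n. (2/3) ^ n * \<Delta> (q + n)) sums (\<Sum>n. (2/3) ^ n * \<Delta> (q + n))"
        by (rule summable_sums[OF shift(1)]) auto
      moreover have "(\<lambda>n. (2/3 :: real) ^ n) sums 3"
        using geometric_sums[of "2/3 :: real"] by simp
      ultimately have "(\<lambda>n. 27 * ((2/3) ^ n * \<Delta> (q + n)) + (2/3) ^ n * (3 * S q)) sums
          (27 * (\<Sum>n. (2/3) ^ n * \<Delta> (q + n)) + 3 * (3 * S q))"
        by (intro sums_add sums_mult sums_mult2)
      then have "(\<lambda>n. (2/3) ^ n * (27 * \<Delta> (q + n) + 3 * S q)) sums W q"
        by (simp add: W_def algebra_simps)
      then show ?thesis
        using \<Delta> S sums_unique[of _ "W q"] by (subst suminf_ennreal2) (auto simp: sums_iff)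
    qed
    finally show ?thesis .
  qed
  have "W \<longlonglongrightarrow> 27 * 0 + 9 * 0"
    unfolding W_def S_def using shift(2) weighted_shift_tendsto_0(3)[OF lim, of "2/3"]
    by (intro tendsto_intros) auto
  then have "(\<lambda>q. ennreal (W q)) \<longlonglongrightarrow> ennreal 0"
    by (intro tendsto_ennrealI) simp
  then have W0: "(\<lambda>q. ennreal (W q)) \<longlonglongrightarrow> 0" by simp
  show ?thesis
  proof (rule tendsto_sandwich[OF _ _ tendsto_const W0])
    show "\<forall>\<^sub>F q in sequentially. mean L T (\<lambda>z. ennreal (\<bar>flux L \<kappa> u q z\<bar> * indicator Z z)) \<le> ennreal (W q)"
      using eventually_ge_at_top[of 1] by eventually_elim (rule bound)
  qed simp
qed

section \<open>Accumulation of the energy flux\<close>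

lemma mean_indicator_le:
  "(\<And>z. 0 \<le> f z) \<Longrightarrow> mean L T (\<lambda>z. ennreal (f z * indicator Z z)) \<le> mean L T (\<lambda>z. ennreal (f z))"
  by (intro mean_mono ennreal_leI) (auto simp: indicator_def)

text \<open>The normalised cubic means \<open>a\<close> and \<open>b\<close> are finite for every index and eventually at most a constant
times \<open>\<sigma>\<close>, taken at the preceding index in the case of \<open>b\<close>. Hence \<open>a + b\<close> is a null sequence that bounds the cubic means of all indices.\<close>

lemma quiet_flux_tendsto_0:
  assumes L: "L > 0" and T: "T > 0" and \<kappa>: "lp_cutoff \<kappa>" and \<eta>: "mollifier \<eta>" and M: "M \<ge> 1"
    and u: "continuous_spectrum L u" and \<sigma>: "\<And>q. \<sigma> q > 0" and \<sigma>0: "\<sigma> \<longlonglongrightarrow> 0"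
    and K: "\<forall>\<^sub>F q in sequentially. ennreal (lam L q) * lp_moment L T \<kappa> u q 3 \<le> ennreal K"
    and Z: "Z \<in> sets lebesgue"
    and quiet: "\<And>q. q > q0 \<Longrightarrow> Z \<subseteq> Omega L T - active_region L T \<kappa> \<eta> M \<sigma> u q"
  shows "(\<lambda>q. mean L T (\<lambda>z. ennreal (\<bar>flux L \<kappa> u q z\<bar> * indicator Z z))) \<longlonglongrightarrow> 0"
proof -
  define N where "N = real (card near_indices)"
  define K' where "K' = max 0 K"
  let ?s = "\<lambda>p. mean L T (\<lambda>z. ennreal (speed L \<kappa> u p z ^ 3 * indicator Z z))"
  let ?g = "\<lambda>p. mean L T (\<lambda>z. ennreal (grad_size L \<kappa> u p z ^ 3 * indicator Z z))"
  have N: "N \<ge> 0" by (simp add: N_def)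
  have lp: "lam L p > 0" for p by (rule lam_pos[OF L])
  have s_fin: "?s p < \<infinity>" for p
    by (rule le_less_trans[OF mean_indicator_le mean_finite])
       (intro zero_le_power speed_nonneg L T continuous_intros continuous_speed \<kappa> u)+
  have g_fin: "?g p < \<infinity>" for p
    by (rule le_less_trans[OF mean_indicator_le mean_finite])
       (intro zero_le_power grad_size_nonneg L T continuous_intros continuous_speed \<kappa> u)+
  \<comment> \<open>The gradient of the piece \<open>j - 1\<close> is normalised by \<open>lam L j\<close>, in line with the shifted index of the flux
      sum.\<close>
  define a where "a p = lam L p * enn2real (?s (int p))" for p
  define b where "b j = enn2real (?g (int j - 1)) / (lam L j)\<^sup>2" for j
  have a0: "0 \<le> a p" for p using lp by (simp add: a_def less_imp_le)
  have b0: "0 \<le> b p" for p by (simp add: b_def)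
  have decay: "\<forall>\<^sub>F p in sequentially. a p \<le> N * \<sigma> p * K' \<and> b (Suc p) \<le> 108 * pi\<^sup>2 * N * \<sigma> p * K'"
    using K eventually_gt_at_top[of q0]
  proof eventually_elim
    case (elim p)
    let ?m3 = "lp_moment L T \<kappa> u p 3"
    have m3: "ennreal (lam L p) * ?m3 \<le> ennreal K'"
      using elim(1) by (rule order_trans) (simp add: K'_def ennreal_leI)
    note q = quiet_cubic_means[OF L T \<kappa> \<eta> M u \<sigma> quiet[OF elim(2)], folded N_def]
    have enn: "x * enn2real y \<le> z" if "ennreal x * y \<le> ennreal z" "0 \<le> x" "0 \<le> z" for x y z
    proof -
      have "enn2real (ennreal x * y) \<le> z" using that by (intro enn2real_leI)
      then show ?thesis using that by (simp add: enn2real_mult)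
    qed
    have "ennreal (lam L p) * ?s (int p) \<le> ennreal (lam L p) * (ennreal (N * \<sigma> p) * ?m3)"
      by (intro mult_left_mono q(1)) simp
    also have "\<dots> = ennreal (N * \<sigma> p) * (ennreal (lam L p) * ?m3)" by (rule mult.left_commute)
    also have "\<dots> \<le> ennreal (N * \<sigma> p) * ennreal K'" by (intro mult_left_mono m3) simp
    also have "\<dots> = ennreal (N * \<sigma> p * K')"
      using N \<sigma>[of p] by (simp add: ennreal_mult'' K'_def)
    finally have A: "a p \<le> N * \<sigma> p * K'"
      unfolding a_def using N \<sigma>[of p] lp[of p] by (intro enn) (auto simp: K'_def)
    let ?c = "108 * pi\<^sup>2 * N * \<sigma> p"
    have c: "0 \<le> ?c" using N \<sigma>[of p] by simp
    have c2: "0 \<le> ?c * (lam L (Suc p))\<^sup>2" using c by (rule mult_nonneg_nonneg) simp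
    have l: "lam L (Suc p) = 2 * lam L p" by (simp add: lam_def)
    have "?g (int p) \<le> ennreal (?c * (lam L (Suc p))\<^sup>2 * lam L p) * ?m3"
      using q(2) by (simp add: l power3_eq_cube power2_eq_square mult_ac)
    also have "\<dots> = ennreal (?c * (lam L (Suc p))\<^sup>2) * (ennreal (lam L p) * ?m3)"
      by (subst ennreal_mult[OF c2 less_imp_le[OF lp]]) (rule mult.assoc)
    also have "\<dots> \<le> ennreal (?c * (lam L (Suc p))\<^sup>2) * ennreal K'" by (intro mult_left_mono m3) simp
    also have "\<dots> = ennreal (?c * (lam L (Suc p))\<^sup>2 * K')"
      using c by (intro ennreal_mult[symmetric]) (simp_all add: K'_def)
    finally have "1 * enn2real (?g (int p)) \<le> ?c * (lam L (Suc p))\<^sup>2 * K'"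
      using c by (intro enn) (auto simp: K'_def)
    then have B: "b (Suc p) \<le> ?c * K'"
      using lp[of "Suc p"] by (simp add: b_def pos_divide_le_eq mult_ac)
    show ?case using A B by blast
  qed
  have small: "(\<lambda>p. c * \<sigma> p * K') \<longlonglongrightarrow> 0" for c
  proof -
    have "(\<lambda>p. c * \<sigma> p * K') \<longlonglongrightarrow> c * 0 * K'" by (intro tendsto_intros \<sigma>0)
    then show ?thesis by simp
  qed
  have "a \<longlonglongrightarrow> 0"
  proof (rule tendsto_sandwich[OF _ _ tendsto_const small])
    show "\<forall>\<^sub>F p in sequentially. a p \<le> N * \<sigma> p * K'" using decay by eventually_elim blast
  qed (simp add: a0)
  moreover have "b \<longlonglongrightarrow> 0"
  proof (rule LIMSEQ_imp_Suc, rule tendsto_sandwich[OF _ _ tendsto_const small])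
    show "\<forall>\<^sub>F p in sequentially. b (Suc p) \<le> 108 * pi\<^sup>2 * N * \<sigma> p * K'" using decay by eventually_elim blast
  qed (simp add: b0)
  ultimately have ab: "(\<lambda>p. a p + b p) \<longlonglongrightarrow> 0"
    using tendsto_add[of a 0 sequentially b 0] by simp
  show ?thesis
  proof (rule mean_flux_tendsto_0[OF L \<kappa> u Z _ _ _ ab])
    fix p
    show "0 \<le> a p + b p" using a0 b0 by simp
    have "?s (int p) = ennreal (a p / lam L p)"
      using s_fin[of "int p"] lp[of p] by (simp add: a_def)
    also have "\<dots> \<le> ennreal ((a p + b p) / lam L p)"
      using b0[of p] lp[of p] by (intro ennreal_leI divide_right_mono) auto
    finally show "?s (int p) \<le> ennreal ((a p + b p) / lam L p)" .
    have "?g (int p - 1) = ennreal ((lam L p)\<^sup>2 * b p)"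
      using g_fin[of "int p - 1"] lp[of p] by (simp add: b_def)
    also have "\<dots> \<le> ennreal ((lam L p)\<^sup>2 * (a p + b p))"
      using a0[of p] by (intro ennreal_leI mult_left_mono) auto
    finally show "?g (int p - 1) \<le> ennreal ((lam L p)\<^sup>2 * (a p + b p))" .
  qed
qed

lemma flux_accumulates_on_limsup_active_region:
  assumes L: "L > 0" and T: "T > 0" and \<kappa>: "lp_cutoff \<kappa>" and \<eta>: "mollifier \<eta>" and M: "M \<ge> 1"
    and u: "continuous_spectrum L u" and \<sigma>: "\<And>q. \<sigma> q > 0" and \<sigma>0: "\<sigma> \<longlonglongrightarrow> 0"
    and lim: "limsup (\<lambda>q. ennreal (lam L q) * lp_moment L T \<kappa> u q 3) < \<infinity>"
  shows "flux_accumulates_on L T \<kappa> u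
           (\<Inter>p\<in>{1..}. \<Union>q\<in>{p<..}. active_region L T \<kappa> \<eta> M \<sigma> u q)"
proof -
  let ?A = "active_region L T \<kappa> \<eta> M \<sigma> u"
  define Gs where "Gs p = (\<Union>q\<in>{p<..}. ?A q)" for p :: nat
  have Gs: "Gs p \<in> sets lebesgue" for p
    unfolding Gs_def
    by (intro sets.countable_UN' countableI_type) (use active_region_borel[OF L \<kappa> \<eta> u] in \<open>auto simp: sets_completionI_sets\<close>)
  have sub: "Gs p \<subseteq> Omega L T" for p
    unfolding Gs_def active_region_def by (auto split: if_splits)
  have dec: "Gs (Suc p) \<subseteq> Gs p" for p
    unfolding Gs_def by (intro UN_mono) auto
  have G: "(\<Inter>p\<in>{1..}. \<Union>q\<in>{p<..}. ?A q) = (\<Inter>p\<in>{1..}. Gs p)"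
    by (simp add: Gs_def)
  have G_sets: "(\<Inter>p\<in>{1..}. Gs p) \<in> sets lebesgue"
    by (intro sets.countable_INT') (use Gs in auto)
  obtain c where "limsup (\<lambda>q. ennreal (lam L q) * lp_moment L T \<kappa> u q 3) < c" "c < \<infinity>"
    using dense[OF lim] by blast
  moreover obtain K where "c = ennreal K"
    using \<open>c < \<infinity>\<close> by (cases c) auto
  ultimately have K: "\<forall>\<^sub>F q in sequentially. ennreal (lam L q) * lp_moment L T \<kappa> u q 3 \<le> ennreal K"
    by (auto dest!: Limsup_lessD elim!: eventually_mono intro: less_imp_le)
  have flux: "(\<lambda>p. avg L T (\<lambda>z. \<bar>flux L \<kappa> u p z\<bar> * indicator (Omega L T - Gs q) z)) \<longlonglongrightarrow> 0" for q
    unfolding avg_eq_mean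
  proof (rule quiet_flux_tendsto_0[OF L T \<kappa> \<eta> M u \<sigma> \<sigma>0 K])
    show "Omega L T - Gs q \<in> sets lebesgue" using Gs by auto
    show "Omega L T - Gs q \<subseteq> Omega L T - ?A p" if "p > q" for p
      using that by (auto simp: Gs_def)
  qed
  show ?thesis
    unfolding flux_accumulates_on_def G
  proof (intro conjI exI[of _ Gs])
    show "(\<Inter>p\<in>{1..}. Gs p) \<subseteq> Omega L T" using sub[of 1] by auto
  qed (use Gs sub dec flux G_sets in auto)
qed

theorem theorem4p3:
  fixes L T :: real
    and \<kappa> \<eta> :: "real^3 \<Rightarrow> real"
    and M :: nat
    and \<sigma> :: "nat \<Rightarrow> real"
    and f u0 :: "real^3 \<Rightarrow> real^3"
    and u :: "real \<Rightarrow> real^3 \<Rightarrow> real^3"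
  assumes "L > 0" and "T > 0"
    and "lp_cutoff \<kappa>"
    and "mollifier \<eta>" and "M > 1"
    and "\<And>q. \<sigma> q > 0" and "decseq \<sigma>" and "\<sigma> \<longlonglongrightarrow> 0"
    and "(\<lambda>q. ln (\<sigma> q) / real q) \<longlonglongrightarrow> 0"
    and "admissible_force L f" and "u0 \<in> torus_L2 L"
    and "weakly_continuous_L2 L T u"
    and "weak_euler_solution L T f u0 u"
    and "limsup (\<lambda>q. ennreal (lam L q) * lp_moment L T \<kappa> u q 3) < \<infinity>"
  shows "flux_accumulates_on L T \<kappa> u
           (\<Inter>p\<in>{1..}. \<Union>q\<in>{p<..}. active_region L T \<kappa> \<eta> M \<sigma> u q)"
proof -
  \<comment> \<open>All objects in the conclusion see \<open>u\<close> only at times in \<open>[0, T]\<close>, where freezing changes nothing.\<close>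
  define v where "v t = u (max 0 (min T t))" for t
  have v: "v t = u t" if "t \<in> {0..T}" for t
    using that by (simp add: v_def)
  have avg_cong: "avg L T F = avg L T G" if "\<And>t x. (t, x) \<in> Omega L T \<Longrightarrow> F (t, x) = G (t, x)" for F G
    unfolding avg_def using that
    by (intro arg_cong2[where f = "(/)"] nn_integral_cong refl) (auto simp: indicator_def)
  have vO: "v t = u t" if "(t, x) \<in> Omega L T" for t x
    using that v by (simp add: Omega_def)
  have moment: "lp_moment L T \<kappa> v q n = lp_moment L T \<kappa> u q n" for q n
    unfolding lp_moment_def by (rule avg_cong) (simp add: vO)
  have flux: "avg L T (\<lambda>z. \<bar>flux L \<kappa> v p z\<bar> * indicator S z) = avg L T (\<lambda>z. \<bar>flux L \<kappa> u p z\<bar> * indicator S z)" for p S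
    by (rule avg_cong) (simp add: flux_def vO)
  have atom: "atom_coeff L \<kappa> \<eta> M v q k t = atom_coeff L \<kappa> \<eta> M u q k t" if "(t, x) \<in> Omega L T" for q k t x
    by (simp add: atom_coeff_def piece_def[abs_def] vO[OF that])
  have active: "active_region L T \<kappa> \<eta> M \<sigma> v q = active_region L T \<kappa> \<eta> M \<sigma> u q" for q
  proof -
    have "((t, x) \<in> Omega L T \<longrightarrow> lp L \<kappa> (int q) (v t) x = 0)
        = ((t, x) \<in> Omega L T \<longrightarrow> lp L \<kappa> (int q) (u t) x = 0)" for t x
      by (auto simp: vO)
    moreover have "((t, x) \<in> Omega L T \<and> (\<exists>k\<in>cube_index q. x \<in> cube_star L q k \<and> ennreal \<bar>atom_coeff L \<kappa> \<eta> M v q k t\<bar> > C))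
        = ((t, x) \<in> Omega L T \<and> (\<exists>k\<in>cube_index q. x \<in> cube_star L q k \<and> ennreal \<bar>atom_coeff L \<kappa> \<eta> M u q k t\<bar> > C))" for t x C
      by (auto simp: atom)
    ultimately show ?thesis
      unfolding active_region_def moment by (simp only:)
  qed
  have "continuous_spectrum L v"
    unfolding v_def by (rule continuous_spectrum_clamp[OF assms(1,2,12)])
  moreover have "limsup (\<lambda>q. ennreal (lam L q) * lp_moment L T \<kappa> v q 3) < \<infinity>"
    unfolding moment by (rule assms(14))
  ultimately have "flux_accumulates_on L T \<kappa> v
      (\<Inter>p\<in>{1..}. \<Union>q\<in>{p<..}. active_region L T \<kappa> \<eta> M \<sigma> v q)"
    using assms by (intro flux_accumulates_on_limsup_active_region) auto
  then show ?thesis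
    unfolding active flux_accumulates_on_def flux .
qed

end
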